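(* There is a constant $C_n$, depending only on the dimension $n$, with the following property. If $\sigma(x,\xi,\eta)$, $x,\xi,\eta\in\mathbb R^n$, is a (smooth) bilinear symbol such that $$C(\sigma):=\sup_{\substack{|\beta|\le[\frac n2]+1\\ |\alpha|\le2(2n+1)}}\ \sup_{\xi,y\in\mathbb R^n}\left\|\partial_\xi^\alpha\partial_y^\beta\sigma(y,\xi-\cdot,\cdot)\right\|_{L^2}<\infty,$$ then $T_\sigma$ maps $L^2\times L^2$ continuously into $L^2$, with $$\|T_\sigma\|_{L^2\times L^2\to L^2}\le C_n\,C(\sigma).$$
   Context: $L^2=L^2(\mathbb R^n)$, and $[\cdot]$ denotes the integer part. In the definition of $C(\sigma)$, $\alpha,\beta$ are multi-indices in $\mathbb N_0^n$, and for fixed $y,\xi$ the $L^2$ norm is taken in $\eta\in\mathbb R^n$ of the function $\eta\mapsto\partial_\xi^\alpha\partial_y^\beta[\sigma(y,\xi-\eta,\eta)]$. With $\widehat f$ the Fourier transform and $\mathcal S$ the Schwartz class on $\mathbb R^n$, $$T_\sigma(f,g)(x)=\int_{\mathbb R^n}\int_{\mathbb R^n}\sigma(x,\xi,\eta)\widehat f(\xi)\widehat g(\eta)e^{ix\cdot(\xi+\eta)}\,d\xi\,d\eta,\qquad f,g\in\mathcal S,$$ and boundedness on $L^2\times L^2$ refers to its extension by density. *)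

theory Defs
  imports "HOL-Analysis.Analysis"
begin

definition dir_deriv :: "'a::real_normed_vector \<Rightarrow> ('a \<Rightarrow> complex) \<Rightarrow> 'a \<Rightarrow> complex" where
  "dir_deriv v f x = vector_derivative (\<lambda>t::real. f (x + t *\<^sub>R v)) (at 0)"

fun Ck :: "nat \<Rightarrow> ('a::euclidean_space \<Rightarrow> complex) \<Rightarrow> bool" where
  "Ck 0 f \<longleftrightarrow> continuous_on UNIV f"
| "Ck (Suc k) f \<longleftrightarrow> f differentiable_on UNIV \<and> (\<forall>b\<in>Basis. Ck k (dir_deriv b f))"

definition smooth :: "('a::euclidean_space \<Rightarrow> complex) \<Rightarrow> bool" where
  "smooth f \<longleftrightarrow> (\<forall>k. Ck k f)"

type_synonym 'n multi_index = "'n \<Rightarrow> nat"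

definition degree :: "'n::finite multi_index \<Rightarrow> nat" where
  "degree \<alpha> = (\<Sum>i\<in>UNIV. \<alpha> i)"

definition monomial :: "'n::finite multi_index \<Rightarrow> real^'n \<Rightarrow> real" where
  "monomial \<alpha> x = (\<Prod>i\<in>UNIV. (x $ i) ^ \<alpha> i)"

text \<open>The index type carries no order, so the coordinate derivatives are composed along an
  arbitrary fixed enumeration of it; on smooth functions the result does not depend on the choice.\<close>

definition mderiv :: "'n::finite multi_index \<Rightarrow> (real^'n \<Rightarrow> complex) \<Rightarrow> real^'n \<Rightarrow> complex" where
  "mderiv \<alpha> f =
     foldr (\<lambda>i. dir_deriv (axis i 1) ^^ \<alpha> i) (SOME xs. distinct xs \<and> set xs = UNIV) f"

definition schwartz :: "(real^'n::finite \<Rightarrow> complex) set" where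
  "schwartz = {f. smooth f \<and> (\<forall>\<alpha> \<beta>. bounded (range (\<lambda>x. monomial \<alpha> x *\<^sub>R mderiv \<beta> f x)))}"

text \<open>Elements of \<open>L2\<close> are functions, not classes; statements about them are read
  almost everywhere.\<close>

definition L2norm :: "(real^'n::finite \<Rightarrow> complex) \<Rightarrow> ennreal" where
  "L2norm f = (let I = (\<integral>\<^sup>+x. ennreal ((cmod (f x))\<^sup>2) \<partial>lborel)
               in if I = \<infinity> then \<infinity> else ennreal (sqrt (enn2real I)))"

definition L2 :: "(real^'n::finite \<Rightarrow> complex) set" where
  "L2 = {f. f \<in> borel_measurable lborel \<and> L2norm f < \<infinity>}"

type_synonym 'n bilinear_operator =
  "(real^'n \<Rightarrow> complex) \<Rightarrow> (real^'n \<Rightarrow> complex) \<Rightarrow> real^'n \<Rightarrow> complex"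

definition L2_bilinear :: "'n::finite bilinear_operator \<Rightarrow> bool" where
  "L2_bilinear B \<longleftrightarrow>
     (\<forall>f\<in>L2. \<forall>g\<in>L2. B f g \<in> L2) \<and>
     (\<forall>f\<in>L2. \<forall>h\<in>L2. \<forall>g\<in>L2. \<forall>a b.
        AE x in lborel. B (\<lambda>x. a * f x + b * h x) g x = a * B f g x + b * B h g x) \<and>
     (\<forall>f\<in>L2. \<forall>g\<in>L2. \<forall>h\<in>L2. \<forall>a b.
        AE x in lborel. B f (\<lambda>x. a * g x + b * h x) x = a * B f g x + b * B f h x)"

definition L2_opnorm :: "'n::finite bilinear_operator \<Rightarrow> ennreal" where
  "L2_opnorm B = (SUP (f, g) \<in> {(f, g). f \<in> L2 \<and> g \<in> L2 \<and> L2norm f \<le> 1 \<and> L2norm g \<le> 1}.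
                    L2norm (B f g))"

type_synonym 'n bilinear_symbol = "real^'n \<Rightarrow> real^'n \<Rightarrow> real^'n \<Rightarrow> complex"

definition fourier :: "(real^'n::finite \<Rightarrow> complex) \<Rightarrow> real^'n \<Rightarrow> complex" where
  "fourier f \<xi> = (LINT x|lborel. f x * cis (- (x \<bullet> \<xi>)))"

definition T_integrand :: "'n::finite bilinear_symbol \<Rightarrow> (real^'n \<Rightarrow> complex) \<Rightarrow> (real^'n \<Rightarrow> complex)
    \<Rightarrow> real^'n \<Rightarrow> (real^'n) \<times> (real^'n) \<Rightarrow> complex" where
  "T_integrand \<sigma> f g x = (\<lambda>(\<xi>, \<eta>). \<sigma> x \<xi> \<eta> * fourier f \<xi> * fourier g \<eta> * cis (x \<bullet> (\<xi> + \<eta>)))"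

definition T_op :: "'n::finite bilinear_symbol \<Rightarrow> 'n bilinear_operator" where
  "T_op \<sigma> f g x = (LINT p|lborel. T_integrand \<sigma> f g x p)"

text \<open>Both derivatives act on \<open>(y, \<xi>) \<mapsto> \<sigma>(y, \<xi> - \<eta>, \<eta>)\<close> with \<open>\<eta>\<close> frozen; the norm is taken in \<open>\<eta>\<close>.\<close>

definition symbol_const :: "'n::finite bilinear_symbol \<Rightarrow> ennreal" where
  "symbol_const \<sigma> =
     (SUP (\<alpha>, \<beta>) \<in> {(\<alpha> :: 'n multi_index, \<beta> :: 'n multi_index).
                    degree \<beta> \<le> CARD('n) div 2 + 1 \<and> degree \<alpha> \<le> 2 * (2 * CARD('n) + 1)}.
      SUP (\<xi>, y) \<in> UNIV.
        L2norm (\<lambda>\<eta>. mderiv \<alpha> (\<lambda>\<xi>'. mderiv \<beta> (\<lambda>y'. \<sigma> y' (\<xi>' - \<eta>) \<eta>) y) \<xi>))"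

end

theory Submission
  imports Defs "HOL-Probability.Characteristic_Functions" "HOL-Probability.Sinc_Integral"
begin

text \<open>
  Freeze the position variable first.  For fixed \<open>y\<close> put \<open>\<tau> = \<sigma>(y, \<cdot>, \<cdot>)\<close>.  In the variable
  \<open>\<xi> + \<eta>\<close>, now called \<open>\<xi>\<close>, the output of the frozen operator is the inverse Fourier transform of
  \<open>F(\<xi>) = \<integral> \<tau>(\<xi> - \<eta>, \<eta>) f'(\<xi> - \<eta>) g'(\<eta>) d\<eta>\<close>, where \<open>f'\<close> and \<open>g'\<close> are the Fourier transforms.
  The hypothesis bounds the \<open>L\<^sup>2\<close> norm in \<open>\<eta>\<close> of \<open>\<tau>(\<xi> - \<eta>, \<eta>)\<close> uniformly in \<open>\<xi>\<close>, so Cauchy-Schwarz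
  in \<open>\<eta>\<close> and Plancherel's inequality (\<open>fourier_sqnorm_le\<close>) make the frozen operator bounded from
  \<open>L\<^sup>2 \<times> L\<^sup>2\<close> to \<open>L\<^sup>2\<close> (\<open>sqnorm_mult_op_le\<close>).

  The position is released by a Sobolev inequality: \<open>|T(f, g)(x)|\<^sup>2\<close> is at most a constant times the
  integral over \<open>y\<close> in the cube \<open>x - [0,1]\<^sup>n\<close> of the squares, at \<open>x\<close>, of the operators whose frozen
  symbols are \<open>\<partial>\<^sub>y\<^sup>\<beta> \<sigma>(y, \<cdot>, \<cdot>)\<close> with \<open>|\<beta>| \<le> [n/2] + 1\<close> (\<open>mult_op_local_bound\<close>).  Each of these is
  bounded on \<open>L\<^sup>2\<close>, but the bound must survive integration over all \<open>y\<close>, which requires decay away from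
  \<open>x = y\<close>.  It comes from the \<open>\<xi>\<close> derivatives: a derivative of the symbol in \<open>\<xi>\<^sub>j\<close> trades a factor
  \<open>1 + i (u\<^sub>j - y\<^sub>j)\<close> on \<open>f(u)\<close> for the factor \<open>1 + i (x\<^sub>j - y\<^sub>j)\<close> on the output (\<open>mult_op_coord\<close>).  Hence
  the frozen operator is also bounded when the output and \<open>f\<close> both carry the weight
  \<open>\<Prod>\<^sub>j (1 + (x\<^sub>j - y\<^sub>j)\<^sup>2)\<^sup>-\<^sup>1\<close> (\<open>mult_op_weighted_bound\<close>).  On the cube this weight is bounded below, and
  its integral over \<open>y\<close> is finite, so integrating in \<open>y\<close> yields the estimate for Schwartz functions
  (\<open>sqnorm_frozen_diagonal_le\<close>).  Only the first function is localized; the norm of the second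
  enters globally at each \<open>y\<close>.

  Schwartz functions are dense in \<open>L\<^sup>2\<close> (\<open>approximable_sqnorm_finite\<close>), and the operator on
  \<open>L\<^sup>2 \<times> L\<^sup>2\<close> is the almost everywhere limit along rapidly converging approximations (locale
  \<open>schwartz_form\<close>).
\<close>

section \<open>Iterated directional derivatives\<close>

lemma has_vector_derivative_line:
  fixes f :: "'a::real_normed_vector \<Rightarrow> complex"
  assumes "f differentiable (at (x + t *\<^sub>R v))"
  shows "((\<lambda>s. f (x + s *\<^sub>R v)) has_vector_derivative frechet_derivative f (at (x + t *\<^sub>R v)) v) (at t)"
proof -
  have "(f has_derivative frechet_derivative f (at (x + t *\<^sub>R v))) (at (x + t *\<^sub>R v))"
    using assms frechet_derivative_works by blast
  then have "((\<lambda>s. f (x + s *\<^sub>R v)) has_derivative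
      (\<lambda>h. frechet_derivative f (at (x + t *\<^sub>R v)) (h *\<^sub>R v))) (at t)"
    by (rule has_derivative_compose[rotated]) (auto intro!: derivative_eq_intros)
  moreover have "frechet_derivative f (at (x + t *\<^sub>R v)) (h *\<^sub>R v)
      = h *\<^sub>R frechet_derivative f (at (x + t *\<^sub>R v)) v" for h
    using linear_frechet_derivative[OF assms] by (rule linear_cmul)
  ultimately show ?thesis
    unfolding has_vector_derivative_def by simp
qed

lemma dir_deriv_eq_frechet:
  assumes "f differentiable (at x)"
  shows "dir_deriv v f x = frechet_derivative f (at x) v"
  unfolding dir_deriv_def
  by (rule vector_derivative_at) (use has_vector_derivative_line[of f x 0 v] assms in simp)

lemma dir_deriv_eqI:
  "((\<lambda>t. f (x + t *\<^sub>R v)) has_vector_derivative d) (at 0) \<Longrightarrow> dir_deriv v f x = d"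
  unfolding dir_deriv_def by (rule vector_derivative_at)

lemma has_vector_derivative_dir_deriv:
  assumes "\<And>x. f differentiable (at x)"
  shows "((\<lambda>s. f (x + s *\<^sub>R v)) has_vector_derivative dir_deriv v f (x + t *\<^sub>R v)) (at t)"
  using has_vector_derivative_line[OF assms] dir_deriv_eq_frechet[OF assms] by metis

lemma smooth_differentiable: "smooth f \<Longrightarrow> f differentiable (at x)"
  unfolding smooth_def using Ck.simps(2)[of 0 f] by (auto simp: differentiable_on_def)

lemma smooth_dir_deriv: "smooth f \<Longrightarrow> b \<in> Basis \<Longrightarrow> smooth (dir_deriv b f)"
  unfolding smooth_def using Ck.simps(2) by blast

lemma smooth_continuous: "smooth f \<Longrightarrow> continuous_on S f"
  unfolding smooth_def using Ck.simps(1) continuous_on_subset by blast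

text \<open>Smoothness as a greatest fixed point: it is inherited by every member of a set of
  differentiable functions that is closed under the coordinate derivatives.\<close>

lemma smooth_coinduct:
  fixes Z :: "('a::euclidean_space \<Rightarrow> complex) set"
  assumes "f \<in> Z" and d: "\<And>f x. f \<in> Z \<Longrightarrow> f differentiable (at x)"
    and c: "\<And>f b. f \<in> Z \<Longrightarrow> b \<in> Basis \<Longrightarrow> dir_deriv b f \<in> Z"
  shows "smooth f"
proof -
  have "Ck k f" if "f \<in> Z" for k f
    using that
  proof (induction k arbitrary: f)
    case 0
    then have "\<And>x. isCont f x" using d differentiable_imp_continuous_within by blast
    then show ?case by (simp add: continuous_at_imp_continuous_on)
  next
    case (Suc k)
    then show ?case using c d by (auto intro: differentiable_at_imp_differentiable_on)
  qed
  then show ?thesis using assms(1) by (auto simp: smooth_def)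
qed

text \<open>Symmetry of second derivatives.  Writing \<open>f (x + s a + t b)\<close> as an integral of
  \<open>\<partial>\<^sub>b f\<close> in \<open>t\<close> and differentiating under that integral in \<open>s\<close> represents
  \<open>\<partial>\<^sub>a f (x + t b)\<close> as an integral of \<open>\<partial>\<^sub>a \<partial>\<^sub>b f\<close>, so its derivative in \<open>t\<close> can be read off.\<close>

lemma dir_deriv_commute:
  fixes f :: "'a::euclidean_space \<Rightarrow> complex"
  assumes f: "smooth f" and a: "a \<in> Basis" and b: "b \<in> Basis"
  shows "dir_deriv a (dir_deriv b f) = dir_deriv b (dir_deriv a f)"
proof
  fix x
  note fb = smooth_dir_deriv[OF f b] and fa = smooth_dir_deriv[OF f a]
  note fab = smooth_dir_deriv[OF fb a] and fba = smooth_dir_deriv[OF fa b]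
  define G where "G = (\<lambda>\<tau>. dir_deriv a (dir_deriv b f) (x + \<tau> *\<^sub>R b))"
  have contG: "continuous_on UNIV G"
    unfolding G_def
    by (rule continuous_on_compose2[OF smooth_continuous[OF fab, of UNIV]]) (auto intro!: continuous_intros)
  have contb: "continuous_on S (\<lambda>\<tau>. dir_deriv b f (y + \<tau> *\<^sub>R b))" for y S
    by (rule continuous_on_compose2[OF smooth_continuous[OF fb, of UNIV]]) (auto intro!: continuous_intros)
  have ftc: "integral {0..t} (\<lambda>\<tau>. dir_deriv b f (y + \<tau> *\<^sub>R b)) = f (y + t *\<^sub>R b) - f y" if "0 \<le> t" for y t
  proof -
    have "((\<lambda>\<tau>. dir_deriv b f (y + \<tau> *\<^sub>R b)) has_integral f (y + t *\<^sub>R b) - f (y + 0 *\<^sub>R b)) {0..t}"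
      by (rule fundamental_theorem_of_calculus[OF that])
         (rule has_vector_derivative_at_within[OF has_vector_derivative_dir_deriv[OF smooth_differentiable[OF f]]])
    then show ?thesis by (simp add: integral_unique)
  qed
  have eq: "dir_deriv a f (x + t *\<^sub>R b) = dir_deriv a f x + integral {0..t} G" if "0 \<le> t" for t
  proof -
    have "((\<lambda>s. integral (cbox 0 t) (\<lambda>\<tau>. dir_deriv b f ((x + s *\<^sub>R a) + \<tau> *\<^sub>R b))) has_vector_derivative
        integral (cbox 0 t) (\<lambda>\<tau>. dir_deriv a (dir_deriv b f) ((x + \<tau> *\<^sub>R b) + 0 *\<^sub>R a))) (at 0 within UNIV)"
    proof (rule leibniz_rule_vector_derivative[where U=UNIV and fx="\<lambda>s \<tau>. dir_deriv a (dir_deriv b f) ((x + \<tau> *\<^sub>R b) + s *\<^sub>R a)"])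
      fix s \<tau> :: real
      have e: "x + s *\<^sub>R a + \<tau> *\<^sub>R b = (x + \<tau> *\<^sub>R b) + s *\<^sub>R a" for s by simp
      show "((\<lambda>s. dir_deriv b f (x + s *\<^sub>R a + \<tau> *\<^sub>R b)) has_vector_derivative
         dir_deriv a (dir_deriv b f) (x + \<tau> *\<^sub>R b + s *\<^sub>R a)) (at s within UNIV)"
        unfolding e using has_vector_derivative_dir_deriv[OF smooth_differentiable[OF fb]] by simp
    next
      fix s show "(\<lambda>\<tau>. dir_deriv b f (x + s *\<^sub>R a + \<tau> *\<^sub>R b)) integrable_on cbox 0 t"
        by (intro integrable_continuous contb)
    next
      show "continuous_on (UNIV \<times> cbox 0 t) (\<lambda>(s, \<tau>). dir_deriv a (dir_deriv b f) (x + \<tau> *\<^sub>R b + s *\<^sub>R a))"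
        unfolding split_beta
        by (rule continuous_on_compose2[OF smooth_continuous[OF fab, of UNIV]]) (auto intro!: continuous_intros)
    qed auto
    moreover have "integral (cbox 0 t) (\<lambda>\<tau>. dir_deriv b f ((x + s *\<^sub>R a) + \<tau> *\<^sub>R b))
        = f ((x + t *\<^sub>R b) + s *\<^sub>R a) - f (x + s *\<^sub>R a)" for s
      using ftc[OF that, of "x + s *\<^sub>R a"] by (simp add: algebra_simps)
    moreover have "((\<lambda>s. f ((x + t *\<^sub>R b) + s *\<^sub>R a) - f (x + s *\<^sub>R a)) has_vector_derivative
        dir_deriv a f ((x + t *\<^sub>R b) + 0 *\<^sub>R a) - dir_deriv a f (x + 0 *\<^sub>R a)) (at 0)"
      by (intro has_vector_derivative_diff has_vector_derivative_dir_deriv smooth_differentiable f)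
    ultimately have "integral {0..t} G = dir_deriv a f (x + t *\<^sub>R b) - dir_deriv a f x"
      by (simp add: G_def vector_derivative_unique_at)
    then show ?thesis by simp
  qed
  have "((\<lambda>t. integral {0..t} G) has_vector_derivative G 0) (at 0 within {0..1})"
    by (rule integral_has_vector_derivative) (auto intro: continuous_on_subset[OF contG])
  then have "((\<lambda>t. dir_deriv a f x + integral {0..t} G) has_vector_derivative G 0) (at 0 within {0..1})"
    by (auto intro!: derivative_eq_intros)
  then have "((\<lambda>t. dir_deriv a f (x + t *\<^sub>R b)) has_vector_derivative G 0) (at 0 within {0..1})"
    by (rule has_vector_derivative_transform[rotated 2]) (auto simp: eq)
  moreover have "((\<lambda>t. dir_deriv a f (x + t *\<^sub>R b)) has_vector_derivative
      dir_deriv b (dir_deriv a f) (x + 0 *\<^sub>R b)) (at 0 within {0..1})"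
    by (rule has_vector_derivative_at_within)
       (rule has_vector_derivative_dir_deriv[OF smooth_differentiable[OF fa]])
  ultimately have "G 0 = dir_deriv b (dir_deriv a f) (x + 0 *\<^sub>R b)"
    using vector_derivative_unique_within_closed_interval[of 0 1 0] by auto
  then show "dir_deriv a (dir_deriv b f) x = dir_deriv b (dir_deriv a f) x"
    by (simp add: G_def)
qed

text \<open>The derivative along a word of directions.  Words, rather than multi-indices, are what
  Taylor expansions and products of first-order operators produce.\<close>

definition word_deriv :: "'a::real_normed_vector list \<Rightarrow> ('a \<Rightarrow> complex) \<Rightarrow> 'a \<Rightarrow> complex" where
  "word_deriv ds f = foldr dir_deriv ds f"

lemma word_deriv_simps [simp]:
  "word_deriv [] f = f"
  "word_deriv (d # ds) f = dir_deriv d (word_deriv ds f)"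
  by (simp_all add: word_deriv_def)

lemma word_deriv_append: "word_deriv (xs @ ys) f = word_deriv xs (word_deriv ys f)"
  by (simp add: word_deriv_def)

lemma smooth_word_deriv: "smooth f \<Longrightarrow> set ds \<subseteq> Basis \<Longrightarrow> smooth (word_deriv ds f)"
  by (induction ds) (auto intro: smooth_dir_deriv)

text \<open>Reordering a word reduces to the symmetry of second derivatives, applied to smooth functions only.\<close>

lemma word_deriv_permute:
  fixes f :: "'a::euclidean_space \<Rightarrow> complex"
  assumes f: "smooth f" and "set ds \<subseteq> Basis" and m: "mset ds = mset es"
  shows "word_deriv ds f = word_deriv es f"
proof -
  have "fold dir_deriv (rev ds) f = fold dir_deriv (rev es) f"
    using assms by (intro fold_permuted_eq[where P=smooth]) (auto intro: smooth_dir_deriv dir_deriv_commute)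
  then show ?thesis by (simp add: word_deriv_def foldr_conv_fold)
qed

text \<open>The word that the fixed enumeration of the coordinates assigns to a multi-index, so that
  \<open>mderiv\<close> becomes a derivative along a word.\<close>

definition coord_word :: "('n::finite) multi_index \<Rightarrow> 'n list" where
  "coord_word \<alpha> = concat (map (\<lambda>i. replicate (\<alpha> i) i) (SOME xs. distinct xs \<and> set xs = UNIV))"

abbreviation coord_dirs :: "'n::finite list \<Rightarrow> (real^'n) list" where
  "coord_dirs w \<equiv> map (\<lambda>i. axis i 1) w"

lemma mderiv_eq_word_deriv: "mderiv \<alpha> f = word_deriv (coord_dirs (coord_word \<alpha>)) f"
proof -
  have "foldr (\<lambda>i. dir_deriv (axis i 1) ^^ \<alpha> i) xs f
     = word_deriv (coord_dirs (concat (map (\<lambda>i. replicate (\<alpha> i) i) xs))) f" for xs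
  proof (induction xs)
    case (Cons i xs)
    have "(dir_deriv (axis i 1) ^^ m) g = word_deriv (coord_dirs (replicate m i)) g" for m g
      by (induction m) auto
    then show ?case using Cons by (simp add: word_deriv_append)
  qed simp
  then show ?thesis by (simp add: mderiv_def coord_word_def)
qed

lemma coord_word_exists:
  fixes w :: "'n::finite list"
  shows "mset (coord_word (count_list w)) = mset w" "degree (count_list w) = length w"
proof -
  define xs :: "'n list" where "xs = (SOME xs. distinct xs \<and> set xs = UNIV)"
  have "\<exists>xs::'n list. distinct xs \<and> set xs = UNIV" using finite_distinct_list[of "UNIV::'n set"] by auto
  then have xs: "distinct xs" "set xs = UNIV" unfolding xs_def by (metis (mono_tags, lifting) someI_ex)+
  have "count (mset (concat (map (\<lambda>i. replicate (\<alpha> i) i) ys))) j = (if j \<in> set ys then \<alpha> j else 0)"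
    if "distinct ys" for ys j and \<alpha> :: "'n multi_index"
    using that by (induction ys) auto
  then show "mset (coord_word (count_list w)) = mset w"
    using xs unfolding coord_word_def xs_def[symmetric]
    by (intro multiset_eqI) (simp add: count_mset)
  have "(\<Sum>i\<in>UNIV. count_list w i) = length w"
    by (rule sum_count_set) auto
  then show "degree (count_list w) = length w" by (simp add: degree_def)
qed

lemma word_deriv_eq_mderiv:
  fixes f :: "real^'n::finite \<Rightarrow> complex"
  assumes "smooth f"
  shows "word_deriv (coord_dirs w) f = mderiv (count_list w) f"
  unfolding mderiv_eq_word_deriv
  using assms coord_word_exists(1)[of w] by (intro word_deriv_permute) (auto simp: axis_in_Basis_iff)

text \<open>Iterated derivatives along a line.  Because all words of a given length are summed, differentiating
  the sum over words of length \<open>m\<close> prepends one letter and produces exactly the sum over words of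
  length \<open>m + 1\<close>, without multinomial coefficients.\<close>

lemma has_vector_derivative_word_derivs_line:
  fixes f :: "'a::euclidean_space \<Rightarrow> complex" and d :: "'i::finite \<Rightarrow> 'a"
  assumes f: "smooth f" and d: "\<And>i. d i \<in> Basis" "inj d" and v: "v = (\<Sum>i\<in>UNIV. c i *\<^sub>R d i)"
  shows "((\<lambda>s. \<Sum>w | length w = m. prod_list (map c w) *\<^sub>R word_deriv (map d w) f (x + s *\<^sub>R v)) has_vector_derivative
     (\<Sum>w | length w = Suc m. prod_list (map c w) *\<^sub>R word_deriv (map d w) f (x + t *\<^sub>R v))) (at t)"
proof -
  have fin: "finite {w::'i list. length w = m}"
    using finite_lists_length_eq[of "UNIV::'i set" m] by simp
  have dv: "dir_deriv v g y = (\<Sum>i\<in>UNIV. c i *\<^sub>R dir_deriv (d i) g y)" if "smooth g" for g y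
  proof -
    interpret l: linear "frechet_derivative g (at y)"
      by (rule linear_frechet_derivative[OF smooth_differentiable[OF that]])
    show ?thesis
      by (simp add: dir_deriv_eq_frechet[OF smooth_differentiable[OF that]] v l.sum l.scaleR)
  qed
  have sm: "smooth (word_deriv (map d w) f)" for w
    using f d by (auto intro!: smooth_word_deriv)
  have "((\<lambda>s. \<Sum>w | length w = m. prod_list (map c w) *\<^sub>R word_deriv (map d w) f (x + s *\<^sub>R v)) has_vector_derivative
     (\<Sum>w | length w = m. prod_list (map c w) *\<^sub>R dir_deriv v (word_deriv (map d w) f) (x + t *\<^sub>R v))) (at t)"
  proof (rule has_vector_derivative_sum)
    fix w :: "'i list"
    show "((\<lambda>s. prod_list (map c w) *\<^sub>R word_deriv (map d w) f (x + s *\<^sub>R v)) has_vector_derivative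
      prod_list (map c w) *\<^sub>R dir_deriv v (word_deriv (map d w) f) (x + t *\<^sub>R v)) (at t)"
      by (rule bounded_linear.has_vector_derivative[OF bounded_linear_scaleR_right])
         (rule has_vector_derivative_dir_deriv[OF smooth_differentiable[OF sm]])
  qed
  also have "(\<Sum>w | length w = m. prod_list (map c w) *\<^sub>R dir_deriv v (word_deriv (map d w) f) (x + t *\<^sub>R v))
     = (\<Sum>w | length w = m. \<Sum>i\<in>UNIV. prod_list (map c (i # w)) *\<^sub>R word_deriv (map d (i # w)) f (x + t *\<^sub>R v))"
    by (simp add: dv[OF sm] scaleR_sum_right mult.commute)
  also have "\<dots> = (\<Sum>(w, i) \<in> {w. length w = m} \<times> UNIV. prod_list (map c (i # w)) *\<^sub>R word_deriv (map d (i # w)) f (x + t *\<^sub>R v))"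
    by (rule sum.cartesian_product)
  also have "\<dots> = (\<Sum>w | length w = Suc m. prod_list (map c w) *\<^sub>R word_deriv (map d w) f (x + t *\<^sub>R v))"
    by (rule sum.reindex_bij_witness[where i="\<lambda>w. (tl w, hd w)" and j="\<lambda>(w, i). i # w"])
       (auto simp: length_Suc_conv)
  finally show ?thesis .
qed

section \<open>Schwartz functions\<close>

definition rapid :: "(real^'n::finite \<Rightarrow> complex) \<Rightarrow> bool" where
  "rapid f \<longleftrightarrow> (\<forall>\<alpha>. bounded (range (\<lambda>x. monomial \<alpha> x *\<^sub>R f x)))"

lemma schwartz_iff_word_deriv:
  "f \<in> schwartz \<longleftrightarrow> smooth f \<and> (\<forall>w. rapid (word_deriv (coord_dirs w) f))"
proof
  assume "f \<in> schwartz"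
  then show "smooth f \<and> (\<forall>w. rapid (word_deriv (coord_dirs w) f))"
    by (auto simp: schwartz_def rapid_def word_deriv_eq_mderiv)
next
  assume "smooth f \<and> (\<forall>w. rapid (word_deriv (coord_dirs w) f))"
  then show "f \<in> schwartz"
    by (auto simp: schwartz_def rapid_def mderiv_eq_word_deriv)
qed

lemma schwartz_smooth: "f \<in> schwartz \<Longrightarrow> smooth f"
  by (simp add: schwartz_iff_word_deriv)

lemma schwartz_rapid: "f \<in> schwartz \<Longrightarrow> rapid f"
  unfolding schwartz_iff_word_deriv by (metis list.simps(8) word_deriv_simps(1))

lemma schwartz_dir_deriv: "f \<in> schwartz \<Longrightarrow> dir_deriv (axis i 1) f \<in> schwartz"
proof -
  assume f: "f \<in> schwartz"
  have "rapid (word_deriv (coord_dirs w) (dir_deriv (axis i 1) f))" for w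
  proof -
    have "rapid (word_deriv (coord_dirs (w @ [i])) f)"
      using f unfolding schwartz_iff_word_deriv by blast
    then show ?thesis by (simp add: word_deriv_append)
  qed
  then show ?thesis
    using f by (auto simp: schwartz_iff_word_deriv axis_in_Basis_iff intro: smooth_dir_deriv)
qed

text \<open>Membership without computing derivatives: it is enough to find a set closed under the coordinate
  derivatives in which every member decays rapidly.\<close>

lemma schwartz_coinduct:
  fixes Z :: "(real^'n::finite \<Rightarrow> complex) set"
  assumes "f \<in> Z" and diff: "\<And>f x. f \<in> Z \<Longrightarrow> f differentiable (at x)"
    and d: "\<And>f i. f \<in> Z \<Longrightarrow> dir_deriv (axis i 1) f \<in> Z"
    and r: "\<And>f. f \<in> Z \<Longrightarrow> rapid f"
  shows "f \<in> schwartz"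
proof -
  have "word_deriv (coord_dirs w) f \<in> Z" for w
    by (induction w) (auto simp: assms(1) d)
  moreover have "smooth f"
    using assms(1) diff
  proof (rule smooth_coinduct)
    fix g and b :: "real^'n" assume "g \<in> Z" "b \<in> Basis"
    then show "dir_deriv b g \<in> Z" using d by (auto simp: Basis_vec_def)
  qed
  ultimately show ?thesis using r by (auto simp: schwartz_iff_word_deriv)
qed

text \<open>A class of functions that act on the Schwartz space by multiplication.  The resolvents
  \<open>1 / (1 + i (x\<^sub>i - c))\<close> make it possible to divide a Schwartz function by a weight of
  the form \<open>\<Prod>\<^sub>i (1 + i (x\<^sub>i - c\<^sub>i))\<close>.\<close>

inductive_set moderate :: "(real^'n::finite \<Rightarrow> complex) set" where
  const: "(\<lambda>_. c) \<in> moderate"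
| coord: "(\<lambda>x. of_real (x $ i)) \<in> moderate"
| resolvent: "(\<lambda>x. inverse (1 + \<i> * of_real (x $ i - c))) \<in> moderate"
| add: "p \<in> moderate \<Longrightarrow> q \<in> moderate \<Longrightarrow> (\<lambda>x. p x + q x) \<in> moderate"
| mult: "p \<in> moderate \<Longrightarrow> q \<in> moderate \<Longrightarrow> (\<lambda>x. p x * q x) \<in> moderate"

lemma moderate_sum: "(\<And>i. i \<in> I \<Longrightarrow> p i \<in> moderate) \<Longrightarrow> (\<lambda>x. \<Sum>i\<in>I. p i x) \<in> moderate"
  by (induction I rule: infinite_finite_induct) (auto intro: moderate.intros)

lemma moderate_prod: "(\<And>i. i \<in> I \<Longrightarrow> p i \<in> moderate) \<Longrightarrow> (\<lambda>x. \<Prod>i\<in>I. p i x) \<in> moderate"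
  by (induction I rule: infinite_finite_induct) (auto intro: moderate.intros)

lemma moderate_power: "p \<in> moderate \<Longrightarrow> (\<lambda>x. p x ^ m) \<in> moderate"
  by (induction m) (auto intro: moderate.intros)

lemma one_plus_i_nz: "1 + \<i> * complex_of_real t \<noteq> 0"
  by (simp add: complex_eq_iff)

lemma norm_one_plus_i_sq: "(cmod (1 + \<i> * complex_of_real t))\<^sup>2 = 1 + t\<^sup>2"
  by (simp add: cmod_power2)

lemma norm_one_plus_i_ge1: "1 \<le> cmod (1 + \<i> * complex_of_real t)"
  by (rule power2_le_imp_le) (simp_all add: norm_one_plus_i_sq)

lemma differentiable_coord: "(\<lambda>x::real^'n::finite. complex_of_real (x $ i)) differentiable (at x)"
proof -
  have "((\<lambda>x::real^'n. complex_of_real (x $ i)) has_derivative (\<lambda>x. complex_of_real (x $ i))) (at x)"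
    by (rule bounded_linear.has_derivative[OF bounded_linear_of_real])
       (rule bounded_linear_imp_has_derivative[OF bounded_linear_vec_nth])
  then show ?thesis by (auto simp: differentiable_def)
qed

lemma moderate_differentiable:
  fixes p :: "real^'n::finite \<Rightarrow> complex"
  shows "p \<in> moderate \<Longrightarrow> p differentiable (at x)"
proof (induction arbitrary: x rule: moderate.induct)
  case (resolvent i c)
  have "(\<lambda>x. 1 + \<i> * complex_of_real (x $ i - c)) differentiable (at x)" for x :: "real^'n"
    by (auto intro!: derivative_intros differentiable_coord)
  then show ?case by (rule differentiable_inverse) (rule one_plus_i_nz)
qed (auto intro!: derivative_intros differentiable_coord)

lemma dir_deriv_mult:
  assumes "f differentiable (at x)" "g differentiable (at x)"
  shows "dir_deriv v (\<lambda>x. f x * g x) x = f x * dir_deriv v g x + dir_deriv v f x * g x"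
  using has_vector_derivative_mult[OF has_vector_derivative_line[of f x 0 v] has_vector_derivative_line[of g x 0 v]] assms
  by (intro dir_deriv_eqI) (simp add: dir_deriv_eq_frechet)

lemma dir_deriv_add:
  assumes "f differentiable (at x)" "g differentiable (at x)"
  shows "dir_deriv v (\<lambda>x. f x + g x) x = dir_deriv v f x + dir_deriv v g x"
  using has_vector_derivative_add[OF has_vector_derivative_line[of f x 0 v] has_vector_derivative_line[of g x 0 v]] assms
  by (intro dir_deriv_eqI) (simp add: dir_deriv_eq_frechet)

lemma dir_deriv_coord:
  "dir_deriv (axis j 1) (\<lambda>x::real^'n::finite. complex_of_real (x $ i)) x = (if i = j then 1 else 0)"
  by (rule dir_deriv_eqI)
     (auto intro!: derivative_eq_intros bounded_linear.has_vector_derivative[OF bounded_linear_of_real]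
       simp: axis_def has_real_derivative_iff_has_vector_derivative[symmetric] split: if_splits)

lemma dir_deriv_resolvent:
  "dir_deriv (axis j 1) (\<lambda>x::real^'n::finite. inverse (1 + \<i> * complex_of_real (x $ i - c))) x
    = (if i = j then - \<i> else 0) * (inverse (1 + \<i> * of_real (x $ i - c)) * inverse (1 + \<i> * of_real (x $ i - c)))"
proof (rule dir_deriv_eqI)
  have "((\<lambda>t. inverse (1 + \<i> * (complex_of_real (x $ i - c) + t * of_real (axis j 1 $ i)))) has_field_derivative
      - (\<i> * of_real (axis j 1 $ i)) * (inverse (1 + \<i> * of_real (x $ i - c)) * inverse (1 + \<i> * of_real (x $ i - c)))) (at (of_real 0))"
    using one_plus_i_nz[of "x $ i - c"] by (auto intro!: derivative_eq_intros simp: field_simps)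
  from has_vector_derivative_real_field[OF this]
  show "((\<lambda>t. inverse (1 + \<i> * complex_of_real ((x + t *\<^sub>R axis j 1) $ i - c))) has_vector_derivative
      (if i = j then - \<i> else 0) * (inverse (1 + \<i> * of_real (x $ i - c)) * inverse (1 + \<i> * of_real (x $ i - c)))) (at 0)"
    by (auto simp: axis_def o_def algebra_simps)
qed

lemma moderate_dir_deriv:
  fixes p :: "real^'n::finite \<Rightarrow> complex"
  shows "p \<in> moderate \<Longrightarrow> dir_deriv (axis j 1) p \<in> moderate"
proof (induction rule: moderate.induct)
  case (const c)
  have "dir_deriv (axis j 1) (\<lambda>_::real^'n. c) = (\<lambda>_. 0)" by (intro ext dir_deriv_eqI) auto
  then show ?case using moderate.const[of 0] by simp
next
  case (coord i)
  show ?case unfolding dir_deriv_coord[abs_def] by (rule moderate.const)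
next
  case (resolvent i c)
  show ?case unfolding dir_deriv_resolvent[abs_def] by (intro moderate.intros)
next
  case (add p q)
  then show ?case by (subst ext[OF dir_deriv_add]) (auto intro: moderate.intros moderate_differentiable)
next
  case (mult p q)
  then show ?case by (subst ext[OF dir_deriv_mult]) (auto intro!: moderate.intros intro: moderate_differentiable)
qed

lemma rapid_add: "rapid f \<Longrightarrow> rapid g \<Longrightarrow> rapid (\<lambda>x. f x + g x)"
  unfolding rapid_def by (auto simp: scaleR_add_right bounded_plus_comp)

lemma rapid_mult_bounded:
  assumes "rapid f" "\<And>x. cmod (q x) \<le> B" shows "rapid (\<lambda>x. f x * q x)"
  unfolding rapid_def
proof
  fix \<alpha>
  obtain C where C: "\<And>x. norm (monomial \<alpha> x *\<^sub>R f x) \<le> C"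
    using assms(1) unfolding rapid_def bounded_iff by blast
  have "norm (monomial \<alpha> x *\<^sub>R (f x * q x)) \<le> C * B" for x
  proof -
    have "norm (monomial \<alpha> x *\<^sub>R (f x * q x)) = norm (monomial \<alpha> x *\<^sub>R f x) * norm (q x)"
      by (simp add: norm_mult)
    also have "\<dots> \<le> C * B" using C assms(2) by (intro mult_mono) (auto intro: order_trans[OF norm_ge_zero C])
    finally show ?thesis .
  qed
  then show "bounded (range (\<lambda>x. monomial \<alpha> x *\<^sub>R (f x * q x)))"
    unfolding bounded_iff by blast
qed

lemma monomial_mult_coord: "monomial \<alpha> x * x $ i = monomial (\<alpha>(i := Suc (\<alpha> i))) x"
  unfolding monomial_def
  by (simp add: prod.remove[of UNIV i] mult_ac)

lemma rapid_mult_moderate: "q \<in> moderate \<Longrightarrow> rapid f \<Longrightarrow> rapid (\<lambda>x. f x * q x)"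
proof (induction arbitrary: f rule: moderate.induct)
  case (const c)
  show ?case by (rule rapid_mult_bounded[OF const]) auto
next
  case (coord i)
  have "monomial \<alpha> x *\<^sub>R (f x * complex_of_real (x $ i)) = monomial (\<alpha>(i := Suc (\<alpha> i))) x *\<^sub>R f x" for \<alpha> x
    by (simp add: monomial_mult_coord[symmetric] scaleR_conv_of_real)
  then show ?case using coord by (simp add: rapid_def)
next
  case (resolvent i c)
  show ?case
  proof (rule rapid_mult_bounded[OF resolvent])
    show "cmod (inverse (1 + \<i> * complex_of_real (x $ i - c))) \<le> 1" for x
      using norm_one_plus_i_ge1[of "x $ i - c"]
      unfolding norm_inverse by (intro inverse_le_1_iff[THEN iffD2] disjI2)
  qed
next
  case (add p q)
  then show ?case by (simp add: distrib_left rapid_add)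
next
  case (mult p q)
  then show ?case by (metis (no_types, lifting) ext mult.assoc)
qed

text \<open>By the Leibniz rule the products \<open>f q\<close> are closed under derivatives only up to sums.\<close>

inductive_set moderate_span :: "(real^'n::finite \<Rightarrow> complex) set" where
  mult: "f \<in> schwartz \<Longrightarrow> q \<in> moderate \<Longrightarrow> (\<lambda>x. f x * q x) \<in> moderate_span"
| add: "f \<in> moderate_span \<Longrightarrow> g \<in> moderate_span \<Longrightarrow> (\<lambda>x. f x + g x) \<in> moderate_span"

lemma moderate_span_schwartz: "f \<in> moderate_span \<Longrightarrow> f \<in> schwartz"
proof (rule schwartz_coinduct[where Z=moderate_span])
  have df: "f \<in> moderate_span \<Longrightarrow> f differentiable (at x)" for f :: "real^'n \<Rightarrow> complex" and x
    by (induction rule: moderate_span.induct)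
       (simp_all add: differentiable_mult differentiable_add smooth_differentiable schwartz_smooth moderate_differentiable)
  show "f \<in> moderate_span \<Longrightarrow> f differentiable (at x)" for f :: "real^'n \<Rightarrow> complex" and x
    by (rule df)
  show "dir_deriv (axis i 1) f \<in> moderate_span" if "f \<in> moderate_span" for f :: "real^'n \<Rightarrow> complex" and i
    using that
  proof induction
    case (mult f q)
    have "(\<lambda>x. f x * dir_deriv (axis i 1) q x + dir_deriv (axis i 1) f x * q x) \<in> moderate_span"
      by (intro moderate_span.add moderate_span.mult[OF mult(1) moderate_dir_deriv[OF mult(2)]]
          moderate_span.mult[OF schwartz_dir_deriv[OF mult(1)] mult(2)])
    moreover have "dir_deriv (axis i 1) (\<lambda>x. f x * q x)
        = (\<lambda>x. f x * dir_deriv (axis i 1) q x + dir_deriv (axis i 1) f x * q x)"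
      by (rule ext) (rule dir_deriv_mult[OF smooth_differentiable[OF schwartz_smooth[OF mult(1)]]
          moderate_differentiable[OF mult(2)]])
    ultimately show ?case by simp
  next
    case (add f g)
    have "dir_deriv (axis i 1) (\<lambda>x. f x + g x) = (\<lambda>x. dir_deriv (axis i 1) f x + dir_deriv (axis i 1) g x)"
      by (rule ext) (rule dir_deriv_add[OF df[OF add(1)] df[OF add(2)]])
    then show ?case using moderate_span.add[OF add(3,4)] by simp
  qed
  show "f \<in> moderate_span \<Longrightarrow> rapid f" for f :: "real^'n \<Rightarrow> complex"
    by (induction rule: moderate_span.induct) (auto intro: rapid_add rapid_mult_moderate schwartz_rapid)
qed

lemma schwartz_mult_moderate: "f \<in> schwartz \<Longrightarrow> q \<in> moderate \<Longrightarrow> (\<lambda>x. f x * q x) \<in> schwartz"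
  by (rule moderate_span_schwartz[OF moderate_span.mult])

lemma schwartz_add:
  assumes "f \<in> schwartz" "g \<in> schwartz" shows "(\<lambda>x. f x + g x) \<in> schwartz"
  using moderate_span.add[OF moderate_span.mult moderate_span.mult, OF assms(1) moderate.const[of 1] assms(2) moderate.const[of 1]]
  by (auto intro: moderate_span_schwartz)

lemma schwartz_cmult: "f \<in> schwartz \<Longrightarrow> (\<lambda>x. c * f x) \<in> schwartz"
  using schwartz_mult_moderate[OF _ moderate.const[of c]] by (simp add: mult.commute)

text \<open>Every derivative of \<open>exp (- p)\<close> is a moderate multiple of \<open>exp (- p)\<close>, so decay has to be checked
  for this one function only.\<close>

lemma schwartz_exp_moderate:
  assumes "p \<in> moderate" and r: "rapid (\<lambda>x. exp (- p x))"
  shows "(\<lambda>x. exp (- p x)) \<in> schwartz"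
proof (rule schwartz_coinduct[where Z="{(\<lambda>x. exp (- p x) * q x) |q. q \<in> moderate}"])
  note dp = moderate_differentiable[OF assms(1)]
  have ex: "(\<lambda>x. exp (- p x)) differentiable (at x)" for x
  proof -
    obtain p' where "(p has_derivative p') (at x)" using dp[of x] by (auto simp: differentiable_def)
    then have "((\<lambda>x. exp (- p x)) has_derivative (\<lambda>h. exp (- p x) * - p' h)) (at x)"
      using has_derivative_compose[OF has_derivative_minus DERIV_exp[unfolded has_field_derivative_def]] by blast
    then show ?thesis by (auto simp: differentiable_def)
  qed
  have dex: "dir_deriv v (\<lambda>x. exp (- p x)) x = exp (- p x) * (- 1 * dir_deriv v p x)" for v x
  proof (rule dir_deriv_eqI)
    have "((\<lambda>t. p (x + t *\<^sub>R v)) has_vector_derivative dir_deriv v p (x + 0 *\<^sub>R v)) (at 0)"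
      by (rule has_vector_derivative_dir_deriv[OF dp])
    then have "((\<lambda>t. - p (x + t *\<^sub>R v)) has_vector_derivative - dir_deriv v p x) (at 0)"
      using has_vector_derivative_minus by simp force
    from field_vector_diff_chain_at[OF this, of exp "exp (- p x)"]
    show "((\<lambda>t. exp (- p (x + t *\<^sub>R v))) has_vector_derivative exp (- p x) * (- 1 * dir_deriv v p x)) (at 0)"
      by (auto simp: o_def mult_ac)
  qed
  fix f assume "f \<in> {(\<lambda>x. exp (- p x) * q x) |q. q \<in> moderate}"
  then obtain q where f: "f = (\<lambda>x. exp (- p x) * q x)" and q: "q \<in> moderate" by auto
  show "f differentiable (at x)" for x
    unfolding f by (intro differentiable_mult ex moderate_differentiable q)
  show "rapid f" unfolding f by (rule rapid_mult_moderate[OF q r])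
  show "dir_deriv (axis i 1) f \<in> {(\<lambda>x. exp (- p x) * q x) |q. q \<in> moderate}" for i
  proof -
    have "dir_deriv (axis i 1) f = (\<lambda>x. exp (- p x) * (dir_deriv (axis i 1) q x + (- 1 * dir_deriv (axis i 1) p x) * q x))"
      unfolding f by (rule ext, subst dir_deriv_mult[OF ex moderate_differentiable[OF q]])
        (simp add: dex algebra_simps)
    moreover have "(\<lambda>x. (dir_deriv (axis i 1) q x + (- 1 * dir_deriv (axis i 1) p x) * q x)) \<in> moderate"
      using q assms(1) by (intro moderate.intros moderate_dir_deriv)
    ultimately show ?thesis unfolding mem_Collect_eq by (intro exI conjI)
  qed
qed (use moderate.const[of 1] in force)

text \<open>The weight \<open>\<Prod>\<^sub>i (1 + x\<^sub>i\<^sup>2)\<close> has an integrable reciprocal and controls all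
  decay that is needed.\<close>

definition weight :: "real^'n::finite \<Rightarrow> real" where
  "weight x = (\<Prod>i\<in>UNIV. 1 + (x $ i)\<^sup>2)"

lemma weight_ge1: "1 \<le> weight x"
  unfolding weight_def by (rule prod_ge_1) simp

lemma weight_pos: "0 < weight x" using weight_ge1[of x] by linarith

lemma weight_minus: "weight (x - y) = weight (y - x)"
  unfolding weight_def by (simp add: power2_commute)

lemma continuous_weight [continuous_intros]:
  "continuous_on S f \<Longrightarrow> continuous_on S (\<lambda>x. weight (f x))"
  unfolding weight_def by (intro continuous_intros)

lemma weight_measurable [measurable]: "weight \<in> borel_measurable borel"
  by (intro borel_measurable_continuous_onI continuous_intros)

text \<open>A Peetre inequality, which lets the weight at a sum of frequencies be split between two functions.\<close>

lemma weight_add_le: "weight (x + y) \<le> 2 ^ CARD('n::finite) * (weight x * weight (y::real^'n))"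
proof -
  have "1 + (a + b)\<^sup>2 \<le> 2 * ((1 + a\<^sup>2) * (1 + b\<^sup>2))" for a b :: real
  proof -
    have "0 \<le> (a - b)\<^sup>2 + 2 * (a * b)\<^sup>2 + 1" by simp
    then show ?thesis by (simp add: power2_eq_square algebra_simps)
  qed
  then have "weight (x + y) \<le> (\<Prod>i\<in>UNIV. 2 * ((1 + (x $ i)\<^sup>2) * (1 + (y $ i)\<^sup>2)))"
    unfolding weight_def by (intro prod_mono) simp
  then show ?thesis by (simp add: weight_def prod.distrib)
qed

definition weight_mass :: "'n::finite itself \<Rightarrow> ennreal" where
  "weight_mass _ = (\<integral>\<^sup>+ (x::real^'n). ennreal (1 / weight x) \<partial>lborel)"

lemma weight_mass_finite: "weight_mass TYPE('n::finite) < \<infinity>"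
proof -
  have eq: "ennreal (1 / weight (x::real^'n)) = (\<Prod>b\<in>Basis. ennreal (inverse (1 + (x \<bullet> b)\<^sup>2)))" for x
  proof -
    have "(\<Prod>b\<in>Basis. inverse (1 + (x \<bullet> b)\<^sup>2)) = (\<Prod>i\<in>UNIV. inverse (1 + (x $ i)\<^sup>2))"
    proof -
      have B: "Basis = (\<lambda>i. axis i (1::real)) ` (UNIV::'n set)"
        unfolding Basis_vec_def Basis_real_def by blast
      show ?thesis unfolding B
        by (subst prod.reindex) (simp_all add: inj_on_def axis_eq_axis inner_axis)
    qed
    then show ?thesis by (simp add: prod_ennreal weight_def prod_dividef inverse_eq_divide)
  qed
  have "integrable lborel (\<lambda>t::real. inverse (1 + t\<^sup>2))"
    using integrable_inverse_1_plus_square by (simp add: set_integrable_def)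
  then have 1: "(\<integral>\<^sup>+ (t::real). ennreal (inverse (1 + t\<^sup>2)) \<partial>lborel) < \<infinity>"
    by (subst (asm) integrable_iff_bounded) (auto simp: abs_of_nonneg)
  have "weight_mass TYPE('n) = (\<Prod>b\<in>(Basis::(real^'n) set). (\<integral>\<^sup>+ (t::real). ennreal (inverse (1 + t\<^sup>2)) \<partial>lborel))"
    unfolding weight_mass_def eq by (rule nn_integral_lborel_prod) auto
  also have "\<dots> < \<infinity>" using 1 by (simp add: power_less_top_ennreal)
  finally show ?thesis .
qed

lemma moderate_weight: "(\<lambda>x. complex_of_real (weight x)) \<in> moderate"
proof -
  have "(\<lambda>x. \<Prod>i\<in>UNIV. 1 + (complex_of_real (x $ i))^2) \<in> moderate"
    by (intro moderate_prod moderate.add moderate.const moderate_power moderate.coord)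
  then show ?thesis by (simp add: weight_def)
qed

lemma schwartz_bound:
  fixes f :: "real^'n::finite \<Rightarrow> complex"
  assumes "f \<in> schwartz" obtains C where "0 < C" "\<And>x. cmod (f x) \<le> C / weight x"
proof -
  have "rapid (\<lambda>x. f x * of_real (weight x))"
    by (rule rapid_mult_moderate[OF moderate_weight schwartz_rapid[OF assms]])
  then have "bounded (range (\<lambda>x. monomial (\<lambda>_. 0) x *\<^sub>R (f x * of_real (weight x))))"
    unfolding rapid_def by blast
  then obtain C where C: "\<And>x. norm (monomial (\<lambda>_. 0) x *\<^sub>R (f x * of_real (weight x))) \<le> C"
    unfolding bounded_iff by blast
  have C: "cmod (f x) * weight x \<le> C" for x
    using C[of x] weight_pos[of x] by (simp add: monomial_def norm_mult abs_of_pos)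
  have "cmod (f x) * weight x \<le> \<bar>C\<bar> + 1" for x
    using C[of x] by linarith
  then show ?thesis
    by (intro that[of "\<bar>C\<bar> + 1"]) (simp_all add: pos_le_divide_eq[OF weight_pos])
qed

lemma schwartz_measurable: "f \<in> schwartz \<Longrightarrow> f \<in> borel_measurable borel"
  by (intro borel_measurable_continuous_onI smooth_continuous schwartz_smooth)

lemma schwartz_integrable:
  fixes f :: "real^'n::finite \<Rightarrow> complex"
  assumes f: "f \<in> schwartz" shows "integrable lborel f"
proof -
  obtain C where C: "0 < C" "\<And>x. cmod (f x) \<le> C / weight x" using schwartz_bound[OF f] by metis
  show ?thesis
  proof (rule integrableI_bounded)
    show "f \<in> borel_measurable lborel" using schwartz_measurable[OF f] by simp
    have "(\<integral>\<^sup>+ x. ennreal (norm (f x)) \<partial>lborel) \<le> (\<integral>\<^sup>+ (x::real^'n). ennreal C * ennreal (1 / weight x) \<partial>lborel)"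
      using C by (intro nn_integral_mono) (simp add: ennreal_mult'[symmetric] ennreal_leI)
    also have "\<dots> = ennreal C * weight_mass TYPE('n)"
      unfolding weight_mass_def by (intro nn_integral_cmult) measurable
    also have "\<dots> < \<infinity>" using weight_mass_finite[where 'n='n] by (simp add: ennreal_mult_less_top)
    finally show "(\<integral>\<^sup>+ x. ennreal (norm (f x)) \<partial>lborel) < \<infinity>" .
  qed
qed

definition sqnorm :: "('a::euclidean_space \<Rightarrow> complex) \<Rightarrow> ennreal" where
  "sqnorm f = (\<integral>\<^sup>+ x. ennreal ((cmod (f x))\<^sup>2) \<partial>lborel)"

lemma schwartz_sqnorm_finite: "f \<in> schwartz \<Longrightarrow> sqnorm f < \<infinity>"
proof -
  assume f: "f \<in> schwartz"
  obtain C where C: "0 < C" "\<And>x. cmod (f x) \<le> C / weight x" using schwartz_bound[OF f] by metis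
  have "(cmod (f x))\<^sup>2 \<le> C * cmod (f x)" for x
  proof -
    have "cmod (f x) \<le> C" using C(2)[of x] C(1) weight_ge1[of x]
      by (smt (verit) frac_le div_by_1)
    then show ?thesis by (simp add: power2_eq_square mult_right_mono)
  qed
  then have "sqnorm f \<le> (\<integral>\<^sup>+ x. ennreal C * ennreal (cmod (f x)) \<partial>lborel)"
    unfolding sqnorm_def using C(1) by (intro nn_integral_mono) (auto simp: ennreal_mult'[symmetric] intro!: ennreal_leI)
  also have "\<dots> = ennreal C * (\<integral>\<^sup>+ x. ennreal (cmod (f x)) \<partial>lborel)"
    using schwartz_measurable[OF f] by (intro nn_integral_cmult) simp
  also have "\<dots> < \<infinity>" using schwartz_integrable[OF f]
    by (auto simp: integrable_iff_bounded ennreal_mult_less_top)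
  finally show ?thesis .
qed

section \<open>Lebesgue integration on Euclidean spaces\<close>

lemma ennreal_norm_integral_le:
  fixes f :: "'a \<Rightarrow> 'b::{banach, second_countable_topology}"
  shows "ennreal (norm (integral\<^sup>L M f)) \<le> (\<integral>\<^sup>+ x. ennreal (norm (f x)) \<partial>M)"
proof (cases "integrable M f")
  case True then show ?thesis by (rule integral_norm_bound_ennreal)
next
  case False then show ?thesis by (simp add: not_integrable_integral_eq)
qed

lemma nn_integral_translate:
  fixes f :: "'a::euclidean_space \<Rightarrow> ennreal"
  assumes "f \<in> borel_measurable borel"
  shows "(\<integral>\<^sup>+ x. f (c + x) \<partial>lborel) = (\<integral>\<^sup>+ x. f x \<partial>lborel)"
  by (subst (2) lborel_distr_plus[of c, symmetric]) (use assms in \<open>simp add: nn_integral_distr\<close>)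

lemma nn_integral_reflect:
  fixes f :: "'a::euclidean_space \<Rightarrow> ennreal"
  assumes [measurable]: "f \<in> borel_measurable borel"
  shows "(\<integral>\<^sup>+ x. f (- x) \<partial>lborel) = (\<integral>\<^sup>+ x. f x \<partial>lborel)"
proof -
  have "(lborel :: 'a measure) = distr lborel borel uminus"
    using lborel_affine[of "-1" "0::'a"] by (simp add: density_1)
  then have "(\<integral>\<^sup>+ x. f x \<partial>lborel) = (\<integral>\<^sup>+ x. f x \<partial>(distr lborel borel uminus))" by simp
  also have "\<dots> = (\<integral>\<^sup>+ x. f (- x) \<partial>lborel)" by (rule nn_integral_distr) measurable
  finally show ?thesis by simp
qed

lemma nn_integral_scale:
  fixes f :: "'a::euclidean_space \<Rightarrow> ennreal"
  assumes [measurable]: "f \<in> borel_measurable borel" and "c \<noteq> 0"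
  shows "(\<integral>\<^sup>+ x. f x \<partial>lborel) = ennreal (\<bar>c\<bar> ^ DIM('a)) * (\<integral>\<^sup>+ x. f (c *\<^sub>R x) \<partial>lborel)"
proof -
  have "(\<integral>\<^sup>+ x. f x \<partial>lborel) = (\<integral>\<^sup>+ x. f x \<partial>density (distr lborel borel (\<lambda>x. 0 + c *\<^sub>R x)) (\<lambda>_. ennreal (\<bar>c\<bar> ^ DIM('a))))"
    by (subst lborel_affine[of c 0]) (use assms(2) in auto)
  also have "\<dots> = (\<integral>\<^sup>+ x. ennreal (\<bar>c\<bar> ^ DIM('a)) * f x \<partial>distr lborel borel (\<lambda>x. 0 + c *\<^sub>R x))"
    by (rule nn_integral_density) auto
  also have "\<dots> = ennreal (\<bar>c\<bar> ^ DIM('a)) * (\<integral>\<^sup>+ x. f (c *\<^sub>R x) \<partial>lborel)"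
    by (simp add: nn_integral_cmult nn_integral_distr)
  finally show ?thesis .
qed

lemma integral_translate:
  fixes f :: "'a::euclidean_space \<Rightarrow> 'b::{banach, second_countable_topology}"
  assumes "f \<in> borel_measurable borel"
  shows "(LINT x|lborel. f (c + x)) = (LINT x|lborel. f x)"
  by (subst (2) lborel_distr_plus[of c, symmetric]) (use assms in \<open>simp add: integral_distr\<close>)

lemma integrable_translate:
  fixes f :: "'a::euclidean_space \<Rightarrow> 'b::{banach, second_countable_topology}"
  assumes "integrable lborel f"
  shows "integrable lborel (\<lambda>x. f (c + x))"
proof -
  have "integrable (distr lborel borel ((+) c)) f" using assms by (simp add: lborel_distr_plus)
  then show ?thesis by (subst (asm) integrable_distr_eq) (use assms in auto)
qed

lemma measurable_lborel_pair:
  fixes f :: "'a::euclidean_space \<times> 'b::euclidean_space \<Rightarrow> 'c::topological_space"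
  shows "f \<in> borel_measurable (lborel \<Otimes>\<^sub>M lborel) \<longleftrightarrow> f \<in> borel_measurable borel"
  by (simp add: lborel_prod)

lemma Tonelli_lborel:
  fixes f :: "'a::euclidean_space \<Rightarrow> 'b::euclidean_space \<Rightarrow> ennreal"
  assumes "(\<lambda>p. f (fst p) (snd p)) \<in> borel_measurable borel"
  shows "(\<integral>\<^sup>+ x. \<integral>\<^sup>+ y. f x y \<partial>lborel \<partial>lborel) = (\<integral>\<^sup>+ p. f (fst p) (snd p) \<partial>lborel)"
    and "(\<integral>\<^sup>+ y. \<integral>\<^sup>+ x. f x y \<partial>lborel \<partial>lborel) = (\<integral>\<^sup>+ p. f (fst p) (snd p) \<partial>lborel)"
proof -
  have m: "(\<lambda>p. f (fst p) (snd p)) \<in> borel_measurable (lborel \<Otimes>\<^sub>M lborel)"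
    using assms by (simp add: measurable_lborel_pair)
  show "(\<integral>\<^sup>+ x. \<integral>\<^sup>+ y. f x y \<partial>lborel \<partial>lborel) = (\<integral>\<^sup>+ p. f (fst p) (snd p) \<partial>lborel)"
    using lborel.nn_integral_fst[OF m] by (simp add: lborel_prod)
  show "(\<integral>\<^sup>+ y. \<integral>\<^sup>+ x. f x y \<partial>lborel \<partial>lborel) = (\<integral>\<^sup>+ p. f (fst p) (snd p) \<partial>lborel)"
    using lborel_pair.nn_integral_snd[of "\<lambda>p. f (fst p) (snd p)"] m by (simp add: lborel_prod split_beta)
qed

lemma Fubini_lborel:
  fixes f :: "'a::euclidean_space \<Rightarrow> 'b::euclidean_space \<Rightarrow> complex"
  assumes m: "(\<lambda>p. f (fst p) (snd p)) \<in> borel_measurable borel"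
    and fin: "(\<integral>\<^sup>+ x. \<integral>\<^sup>+ y. ennreal (norm (f x y)) \<partial>lborel \<partial>lborel) < \<infinity>"
  shows "integrable lborel (\<lambda>p. f (fst p) (snd p))"
    and "(LINT x|lborel. LINT y|lborel. f x y) = (LINT p|lborel. f (fst p) (snd p))"
    and "(LINT y|lborel. LINT x|lborel. f x y) = (LINT p|lborel. f (fst p) (snd p))"
    and "integrable lborel (\<lambda>x. LINT y|lborel. f x y)"
proof -
  have "(\<integral>\<^sup>+ p. ennreal (norm (f (fst p) (snd p))) \<partial>lborel) < \<infinity>"
    using fin m by (subst (asm) Tonelli_lborel(1)) auto
  then show i: "integrable lborel (\<lambda>p. f (fst p) (snd p))"
    using m by (intro integrableI_bounded) auto
  then have i': "integrable (lborel \<Otimes>\<^sub>M lborel) (\<lambda>(x, y). f x y)"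
    by (simp add: lborel_prod split_beta')
  show "integrable lborel (\<lambda>x. LINT y|lborel. f x y)"
    using lborel_pair.integrable_fst'[OF i'] by simp
  show "(LINT x|lborel. LINT y|lborel. f x y) = (LINT p|lborel. f (fst p) (snd p))"
    using lborel_pair.integral_fst[OF i'] by (simp add: lborel_prod split_beta')
  show "(LINT y|lborel. LINT x|lborel. f x y) = (LINT p|lborel. f (fst p) (snd p))"
    using lborel_pair.integral_snd[OF i'] by (simp add: lborel_prod split_beta')
qed

text \<open>Integration by parts in divergence form, from translation invariance alone:
  \<open>\<integral> G(p + v) - G(p) dp\<close> vanishes and equals \<open>\<integral>\<^sub>0\<^sup>1 \<integral> G'(p + t v) dp dt\<close>.\<close>

lemma integral_line_derivative_eq_0:
  fixes G G' :: "'a::euclidean_space \<Rightarrow> complex"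
  assumes d: "\<And>p t. ((\<lambda>s. G (p + s *\<^sub>R v)) has_vector_derivative G' (p + t *\<^sub>R v)) (at t)"
    and c: "continuous_on UNIV G'" and i: "integrable lborel G" and i': "integrable lborel G'"
  shows "(LINT p|lborel. G' p) = 0"
proof -
  define f where "f = (\<lambda>p (t::real). indicator {0..1} t *\<^sub>R G' (t *\<^sub>R v + p))"
  have m': "G' \<in> borel_measurable borel" using c by (rule borel_measurable_continuous_onI)
  have m: "(\<lambda>q. f (fst q) (snd q)) \<in> borel_measurable borel"
  proof -
    have "(\<lambda>q::'a \<times> real. G' (snd q *\<^sub>R v + fst q)) \<in> borel_measurable borel"
      by (intro borel_measurable_continuous_onI continuous_on_compose2[OF c] continuous_intros) auto
    moreover have "(\<lambda>q::'a \<times> real. indicator {0..1} (snd q) :: real) \<in> borel_measurable (borel \<Otimes>\<^sub>M borel)"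
      by measurable
    ultimately show ?thesis unfolding f_def by (simp add: borel_prod)
  qed
  have "(\<integral>\<^sup>+ p. \<integral>\<^sup>+ t. ennreal (norm (f p t)) \<partial>lborel \<partial>lborel) = (\<integral>\<^sup>+ t. \<integral>\<^sup>+ p. ennreal (norm (f p t)) \<partial>lborel \<partial>lborel)"
    using m by (subst Tonelli_lborel(1), simp, subst Tonelli_lborel(2)) auto
  also have "\<dots> = (\<integral>\<^sup>+ (t::real). indicator {0..1} t * (\<integral>\<^sup>+ p. ennreal (norm (G' p)) \<partial>lborel) \<partial>lborel)"
  proof (rule nn_integral_cong)
    fix t :: real
    have "(\<integral>\<^sup>+ p. ennreal (norm (f p t)) \<partial>lborel) = indicator {0..1} t * (\<integral>\<^sup>+ p. ennreal (norm (G' (t *\<^sub>R v + p))) \<partial>lborel)"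
      unfolding f_def by (simp split: split_indicator)
    also have "(\<integral>\<^sup>+ p. ennreal (norm (G' (t *\<^sub>R v + p))) \<partial>lborel) = (\<integral>\<^sup>+ p. ennreal (norm (G' p)) \<partial>lborel)"
      by (rule nn_integral_translate) (use m' in measurable)
    finally show "(\<integral>\<^sup>+ p. ennreal (norm (f p t)) \<partial>lborel) = indicator {0..1} t * (\<integral>\<^sup>+ p. ennreal (norm (G' p)) \<partial>lborel)" .
  qed
  also have "\<dots> < \<infinity>"
    using i' by (simp add: nn_integral_multc integrable_iff_bounded)
  finally have fin: "(\<integral>\<^sup>+ p. \<integral>\<^sup>+ t. ennreal (norm (f p t)) \<partial>lborel \<partial>lborel) < \<infinity>" .
  have 1: "(LINT t|lborel. f p t) = G (v + p) - G p" for p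
  proof -
    have "(LINT t|lborel. indicator {0..1} t *\<^sub>R G' (p + t *\<^sub>R v)) = G (p + 1 *\<^sub>R v) - G (p + 0 *\<^sub>R v)"
      by (rule integral_FTC_Icc)
        (auto intro!: has_vector_derivative_at_within d continuous_on_compose2[OF c] continuous_intros)
    then show ?thesis by (simp add: f_def add.commute)
  qed
  have 2: "(LINT p|lborel. f p t) = indicator {0..1} t *\<^sub>R (LINT p|lborel. G' p)" for t
    unfolding f_def using integral_translate[OF m', of "t *\<^sub>R v"] by simp
  have mG: "G \<in> borel_measurable borel" using borel_measurable_integrable[OF i] by simp
  have "0 = (LINT p|lborel. G (v + p) - G p)"
    using i integrable_translate[OF i, of v] integral_translate[OF mG, of v] by simp
  also have "\<dots> = (LINT t|lborel. LINT p|lborel. f p t)"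
    using Fubini_lborel(2,3)[OF m fin] by (simp add: 1)
  also have "\<dots> = (LINT p|lborel. G' p)"
    unfolding 2 by simp
  finally show ?thesis by simp
qed

text \<open>The fundamental theorem of calculus gives one-sided derivatives at the end points of an interval;
  here the point is interior to an interval centred at it.\<close>

lemma has_vector_derivative_of_integral:
  fixes \<phi> g :: "real \<Rightarrow> complex"
  assumes g: "continuous_on UNIV g" and \<phi>: "\<And>a b. a \<le> b \<Longrightarrow> integral {a..b} g = \<phi> b - \<phi> a"
  shows "(\<phi> has_vector_derivative g t) (at t)"
proof -
  have "((\<lambda>u. integral {t - 1..u} g) has_vector_derivative g t) (at t within {t - 1..t + 1})"
    by (rule integral_has_vector_derivative) (auto intro: continuous_on_subset[OF g])
  then have "((\<lambda>u. \<phi> (t - 1) + integral {t - 1..u} g) has_vector_derivative g t) (at t within {t - 1..t + 1})"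
    using has_vector_derivative_add[OF has_vector_derivative_const] by fastforce
  then have "(\<phi> has_vector_derivative g t) (at t within {t - 1..t + 1})"
    by (rule has_vector_derivative_transform[rotated 2]) (auto simp: \<phi>)
  then show ?thesis
    by (simp add: at_within_Icc_at)
qed

section \<open>The Fourier transform\<close>

lemma cis_measurable [measurable]: "cis \<in> borel_measurable borel"
  by (intro borel_measurable_continuous_onI continuous_intros)

lemma cnj_measurable [measurable]: "cnj \<in> borel_measurable borel"
  by (intro borel_measurable_continuous_onI continuous_intros)

lemma integrable_mult_cis:
  fixes f :: "'a::euclidean_space \<Rightarrow> complex"
  assumes "integrable lborel f" "c \<in> borel_measurable borel"
  shows "integrable lborel (\<lambda>x. f x * cis (c x))"
  by (rule Bochner_Integration.integrable_bound[OF assms(1)])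
     (use assms in \<open>auto simp: norm_mult intro!: borel_measurable_times measurable_compose[OF _ cis_measurable]\<close>)

lemma norm_fourier_le: "cmod (fourier f \<xi>) \<le> (LINT x|lborel. cmod (f x))"
proof -
  have "cmod (fourier f \<xi>) \<le> (LINT x|lborel. cmod (f x * cis (- (x \<bullet> \<xi>))))"
    unfolding fourier_def by (rule integral_norm_bound)
  then show ?thesis by (simp add: norm_mult)
qed

lemma continuous_fourier:
  assumes f: "integrable lborel f" shows "continuous_on UNIV (fourier f)"
proof (rule continuous_at_imp_continuous_on, rule ballI)
  fix \<xi>
  have "(\<lambda>n. fourier f (u n)) \<longlonglongrightarrow> fourier f \<xi>" if u: "u \<longlonglongrightarrow> \<xi>" for u
    unfolding fourier_def
  proof (rule integral_dominated_convergence[where w="\<lambda>x. cmod (f x)"])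
    show "AE x in lborel. (\<lambda>n. f x * cis (- (x \<bullet> u n))) \<longlonglongrightarrow> f x * cis (- (x \<bullet> \<xi>))"
      unfolding cis_conv_exp using u by (intro AE_I2 tendsto_intros)
  qed (use f in \<open>auto simp: norm_mult intro!: integrable_mult_cis borel_measurable_integrable\<close>)
  then show "isCont (fourier f) \<xi>" by (simp add: continuous_at_sequentially o_def)
qed

lemma fourier_measurable: "integrable lborel f \<Longrightarrow> fourier f \<in> borel_measurable borel"
  by (intro borel_measurable_continuous_onI continuous_fourier)

lemma fourier_add:
  assumes "integrable lborel f" "integrable lborel g"
  shows "fourier (\<lambda>x. f x + g x) \<xi> = fourier f \<xi> + fourier g \<xi>"
  unfolding fourier_def using assms
  by (simp add: distrib_right integrable_mult_cis)

lemma fourier_cmult: "fourier (\<lambda>x. c * f x) \<xi> = c * fourier f \<xi>"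
  unfolding fourier_def by (simp add: mult.assoc)

text \<open>The multiplication formula of Fourier analysis, for a general bounded kernel.\<close>

lemma integral_kernel_swap:
  fixes A :: "'a::euclidean_space \<Rightarrow> complex" and B :: "'b::euclidean_space \<Rightarrow> complex"
  assumes A: "integrable lborel A" and B: "integrable lborel B"
    and k: "continuous_on UNIV (\<lambda>p. k (fst p) (snd p))" "\<And>x y. cmod (k x y) \<le> 1"
  shows "(LINT x|lborel. A x * (LINT y|lborel. B y * k x y)) = (LINT y|lborel. B y * (LINT x|lborel. A x * k x y))"
proof -
  have mk: "(\<lambda>p. k (fst p) (snd p)) \<in> borel_measurable (borel \<Otimes>\<^sub>M borel)"
    using borel_measurable_continuous_onI[OF k(1)] by (simp add: borel_prod)
  have mA [measurable]: "A \<in> borel_measurable borel" and mB [measurable]: "B \<in> borel_measurable borel"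
    using A B by (simp_all add: integrable_iff_bounded)
  have m: "(\<lambda>p. A (fst p) * (B (snd p) * k (fst p) (snd p))) \<in> borel_measurable borel"
    unfolding borel_prod[symmetric] using mk by measurable
  have "(\<integral>\<^sup>+ x. \<integral>\<^sup>+ y. ennreal (norm (A x * (B y * k x y))) \<partial>lborel \<partial>lborel)
      \<le> (\<integral>\<^sup>+ x. \<integral>\<^sup>+ y. ennreal (norm (A x)) * ennreal (norm (B y)) \<partial>lborel \<partial>lborel)"
    using k(2) by (intro nn_integral_mono)
      (auto simp: norm_mult ennreal_mult[symmetric] intro!: ennreal_leI mult_left_mono mult_right_le_one_le)
  also have "\<dots> = (\<integral>\<^sup>+ x. ennreal (norm (A x)) \<partial>lborel) * (\<integral>\<^sup>+ y. ennreal (norm (B y)) \<partial>lborel)"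
    by (simp add: nn_integral_cmult nn_integral_multc)
  also have "\<dots> < \<infinity>" using A B by (simp add: integrable_iff_bounded ennreal_mult_less_top)
  finally have fin: "(\<integral>\<^sup>+ x. \<integral>\<^sup>+ y. ennreal (norm (A x * (B y * k x y))) \<partial>lborel \<partial>lborel) < \<infinity>" .
  have "(LINT x|lborel. LINT y|lborel. A x * (B y * k x y)) = (LINT y|lborel. LINT x|lborel. A x * (B y * k x y))"
    using Fubini_lborel(2,3)[OF m fin] by simp
  moreover have "(LINT x|lborel. A x * (B y * k x y)) = (LINT x|lborel. B y * (A x * k x y))" for y
    by (simp add: mult_ac)
  ultimately show ?thesis by simp
qed

section \<open>The Plancherel inequality\<close>

lemma lborel_integral_prod:
  fixes f :: "'a::euclidean_space \<Rightarrow> real \<Rightarrow> 'b::{real_normed_field, banach, second_countable_topology}"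
  assumes f: "\<And>b. b \<in> Basis \<Longrightarrow> integrable lborel (f b)"
  shows "integrable lborel (\<lambda>x. \<Prod>b\<in>Basis. f b (x \<bullet> b))"
    and "(LINT x|lborel. (\<Prod>b\<in>Basis. f b (x \<bullet> b))) = (\<Prod>b\<in>Basis. (LINT t|lborel. f b t))"
proof -
  interpret product_sigma_finite "\<lambda>_::'a. lborel :: real measure" ..
  have fm: "f b \<in> borel_measurable borel" if "b \<in> Basis" for b
    using f[OF that] by (simp add: integrable_iff_bounded)
  have m: "(\<lambda>x. \<Prod>b\<in>Basis. f b (x \<bullet> b)) \<in> borel_measurable borel"
    by (intro borel_measurable_prod measurable_compose[OF _ fm]) auto
  have g: "(\<lambda>h. \<Sum>b\<in>Basis. h b *\<^sub>R b) \<in> measurable (\<Pi>\<^sub>M b\<in>(Basis::'a set). (lborel::real measure)) borel"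
    by measurable
  have e: "(\<Prod>b\<in>Basis. f b ((\<Sum>b\<in>Basis. h b *\<^sub>R b) \<bullet> b)) = (\<Prod>b\<in>Basis. f b (h b))" for h
    by (intro prod.cong) simp_all
  have L: "(lborel :: 'a measure) = distr (\<Pi>\<^sub>M b\<in>Basis. lborel) borel (\<lambda>h. \<Sum>b\<in>Basis. h b *\<^sub>R b)"
    by (rule lborel_eq)
  show "integrable lborel (\<lambda>x. \<Prod>b\<in>Basis. f b (x \<bullet> b))"
    unfolding L
    by (subst integrable_distr_eq[OF g m]) (simp add: e product_integrable_prod f)
  show "(LINT x|lborel. (\<Prod>b\<in>Basis. f b (x \<bullet> b))) = (\<Prod>b\<in>Basis. (LINT t|lborel. f b t))"
    unfolding L by (subst integral_distr[OF g m]) (simp add: e product_integral_prod f)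
qed

definition gauss :: "real \<Rightarrow> 'a::euclidean_space \<Rightarrow> real" where
  "gauss c x = (\<Prod>b\<in>Basis. exp (- (c * (x \<bullet> b))\<^sup>2 / 2))"

definition gauss_hat :: "real \<Rightarrow> 'a::euclidean_space \<Rightarrow> real" where
  "gauss_hat c \<xi> = (\<Prod>b\<in>Basis. 2 * pi * normal_density 0 c (\<xi> \<bullet> b))"

lemma gauss_nonneg: "0 \<le> gauss c x" and gauss_le1: "gauss c x \<le> 1"
  unfolding gauss_def by (auto intro!: prod_nonneg prod_le_1)

lemma gauss_measurable [measurable]: "gauss c \<in> borel_measurable borel"
  unfolding gauss_def by measurable

lemma gauss_hat_nonneg: "0 \<le> gauss_hat c x"
  unfolding gauss_hat_def by (auto intro!: prod_nonneg)

lemma gauss_hat_minus: "gauss_hat c (x - y) = gauss_hat c (y - x)"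
  unfolding gauss_hat_def normal_density_def by (simp add: inner_diff_left power2_commute)

lemma gauss_hat_measurable [measurable]: "gauss_hat c \<in> borel_measurable borel"
  unfolding gauss_hat_def by measurable

lemma integrable_gauss_1: "c > 0 \<Longrightarrow> integrable lborel (\<lambda>t::real. exp (- (c * t)\<^sup>2 / 2))"
proof -
  assume c: "c > 0"
  have "exp (- (c * t)\<^sup>2 / 2) = sqrt (2 * pi * (1 / c)\<^sup>2) * normal_density 0 (1 / c) t" for t
    using c by (simp add: normal_density_def power_mult_distrib power_divide field_simps)
  then show ?thesis using integrable_normal_density[of "1 / c" 0] c by simp
qed

text \<open>This is the characteristic function of the normal distribution in the scaled variable \<open>c t\<close>; the
  result is again a normal density, whose total mass is then known.\<close>

lemma fourier_gauss_1:
  assumes c: "c > 0"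
  shows "(LINT t|lborel. complex_of_real (exp (- (c * t)\<^sup>2 / 2)) * cis (- (t * z))) = of_real (2 * pi * normal_density 0 c z)"
proof -
  have "complex_of_real (exp (- (- z / c)\<^sup>2 / 2)) = (LINT t|std_normal_distribution. iexp ((- z / c) * t))"
    using char_std_normal_distribution by (metis char_def)
  also have "\<dots> = (LINT t|lborel. std_normal_density t *\<^sub>R iexp ((- z / c) * t))"
    by (rule integral_density) (auto intro!: borel_measurable_continuous_onI continuous_intros)
  also have "\<dots> = \<bar>c\<bar> *\<^sub>R (LINT t|lborel. std_normal_density (0 + c * t) *\<^sub>R iexp ((- z / c) * (0 + c * t)))"
    using c by (intro lborel_integral_real_affine) auto
  also have "(LINT t|lborel. std_normal_density (0 + c * t) *\<^sub>R iexp ((- z / c) * (0 + c * t)))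
      = (LINT t|lborel. complex_of_real (1 / sqrt (2 * pi)) * (complex_of_real (exp (- (c * t)\<^sup>2 / 2)) * cis (- (t * z))))"
    using c by (intro Bochner_Integration.integral_cong) (auto simp: cis_conv_exp std_normal_density_def scaleR_conv_of_real field_simps)
  also have "\<dots> = complex_of_real (1 / sqrt (2 * pi)) * (LINT t|lborel. complex_of_real (exp (- (c * t)\<^sup>2 / 2)) * cis (- (t * z)))"
    by simp
  finally have "(LINT t|lborel. complex_of_real (exp (- (c * t)\<^sup>2 / 2)) * cis (- (t * z)))
     = of_real (sqrt (2 * pi) / c * exp (- (- z / c)\<^sup>2 / 2))"
    using c by (simp add: scaleR_conv_of_real field_simps)
  also have "sqrt (2 * pi) / c * exp (- (- z / c)\<^sup>2 / 2) = 2 * pi * normal_density 0 c z"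
  proof -
    have "sqrt (2 * pi) * sqrt (2 * pi) = 2 * pi" by simp
    then show ?thesis using c by (simp add: normal_density_def real_sqrt_mult power_divide divide_simps mult_ac)
  qed
  finally show ?thesis .
qed

lemma gauss_integrable:
  assumes "c > 0" shows "integrable lborel (gauss c :: 'a::euclidean_space \<Rightarrow> real)"
  unfolding gauss_def using lborel_integral_prod(1)[of "\<lambda>_ t. exp (- (c * t)\<^sup>2 / 2)"] integrable_gauss_1[OF assms] by simp

lemma fourier_gauss:
  fixes \<zeta> :: "'a::euclidean_space"
  assumes c: "c > 0"
  shows "(LINT x|lborel. complex_of_real (gauss c x) * cis (- (x \<bullet> \<zeta>))) = of_real (gauss_hat c \<zeta>)"
proof -
  have i: "integrable lborel (\<lambda>t. complex_of_real (exp (- (c * t)\<^sup>2 / 2)) * cis (- (t * z)))" for z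
    by (rule integrable_mult_cis[OF integrable_of_real[OF integrable_gauss_1[OF c]]]) measurable
  have "complex_of_real (gauss c x) * cis (- (x \<bullet> \<zeta>))
      = (\<Prod>b\<in>Basis. complex_of_real (exp (- (c * (x \<bullet> b))\<^sup>2 / 2)) * cis (- ((x \<bullet> b) * (\<zeta> \<bullet> b))))" for x
  proof -
    have "\<i> * complex_of_real (- (x \<bullet> \<zeta>)) = (\<Sum>b\<in>Basis. \<i> * complex_of_real (- ((x \<bullet> b) * (\<zeta> \<bullet> b))))"
      by (subst euclidean_inner) (simp add: sum_distrib_left sum_negf)
    then have "cis (- (x \<bullet> \<zeta>)) = (\<Prod>b\<in>Basis. cis (- ((x \<bullet> b) * (\<zeta> \<bullet> b))))"
      unfolding cis_conv_exp by (simp only: exp_sum finite_Basis)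
    then show ?thesis unfolding gauss_def prod.distrib of_real_prod by simp
  qed
  then have "(LINT x|lborel. complex_of_real (gauss c x) * cis (- (x \<bullet> \<zeta>)))
      = (LINT x|lborel. (\<Prod>b\<in>Basis. complex_of_real (exp (- (c * (x \<bullet> b))\<^sup>2 / 2)) * cis (- ((x \<bullet> b) * (\<zeta> \<bullet> b)))))"
    by (simp only:)
  also have "\<dots> = (\<Prod>b\<in>Basis. LINT t|lborel. complex_of_real (exp (- (c * t)\<^sup>2 / 2)) * cis (- (t * (\<zeta> \<bullet> b))))"
    by (rule lborel_integral_prod(2)[of "\<lambda>b t. complex_of_real (exp (- (c * t)\<^sup>2 / 2)) * cis (- (t * (\<zeta> \<bullet> b)))"]) (rule i)
  finally show ?thesis
    unfolding fourier_gauss_1[OF c] gauss_hat_def of_real_prod .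
qed

lemma gauss_hat_mass:
  assumes "c > 0"
  shows "(\<integral>\<^sup>+ (\<zeta>::'a::euclidean_space). ennreal (gauss_hat c \<zeta>) \<partial>lborel) = ennreal ((2 * pi) ^ DIM('a))"
proof -
  have 1: "(\<integral>\<^sup>+ t. ennreal (2 * pi * normal_density 0 c t) \<partial>lborel) = ennreal (2 * pi)"
    using assms by (subst nn_integral_eq_integral) auto
  have "(\<integral>\<^sup>+ (\<zeta>::'a). ennreal (gauss_hat c \<zeta>) \<partial>lborel)
      = (\<integral>\<^sup>+ (\<zeta>::'a). (\<Prod>b\<in>Basis. ennreal (2 * pi * normal_density 0 c (\<zeta> \<bullet> b))) \<partial>lborel)"
    unfolding gauss_hat_def by (simp add: prod_ennreal)
  also have "\<dots> = (\<Prod>b\<in>(Basis::'a set). (\<integral>\<^sup>+ t. ennreal (2 * pi * normal_density 0 c t) \<partial>lborel))"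
    by (rule nn_integral_lborel_prod) auto
  finally show ?thesis unfolding 1 by (simp add: ennreal_power)
qed

text \<open>Damping \<open>|fourier F|\<^sup>2\<close> by a Gaussian and expanding the square gives the quadratic form of
  convolution with a positive kernel of mass \<open>(2 \<pi>)\<^sup>n\<close>, which Schur's test bounds uniformly in the
  width of the Gaussian.\<close>

lemma gauss_fourier_sqnorm_le:
  fixes F :: "real^'n::finite \<Rightarrow> complex"
  assumes F: "integrable lborel F" and c: "c > 0"
  shows "(\<integral>\<^sup>+ x. ennreal (gauss c x * (cmod (fourier F x))\<^sup>2) \<partial>lborel) \<le> ennreal ((2 * pi) ^ CARD('n)) * sqnorm F"
proof -
  define N where "N = (LINT x|lborel. cmod (F x))"
  have [measurable]: "F \<in> borel_measurable borel" using F by (simp add: integrable_iff_bounded)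
  have [measurable]: "fourier F \<in> borel_measurable borel" by (rule fourier_measurable[OF F])
  have bd: "cmod (fourier F x) \<le> N" for x unfolding N_def by (rule norm_fourier_le)
  have cF: "integrable lborel (\<lambda>y. cnj (F y))" using F by simp
  have cFh: "cnj (fourier F x) = (LINT y|lborel. cnj (F y) * cis (y \<bullet> x))" for x
    unfolding fourier_def by (subst Bochner_Integration.integral_cnj[symmetric]) (simp add: cis_cnj)
  define A where "A = (\<lambda>x. complex_of_real (gauss c x) * cnj (fourier F x))"
  have A: "integrable lborel A"
  proof (rule Bochner_Integration.integrable_bound[where f="\<lambda>x. gauss c x * N"])
    show "integrable lborel (\<lambda>x. gauss c x * N)" by (simp add: gauss_integrable[OF c])
    show "A \<in> borel_measurable lborel" unfolding A_def by measurable
    show "AE x in lborel. norm (A x) \<le> norm (gauss c x * N)"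
      unfolding A_def using bd gauss_nonneg
      by (intro AE_I2) (auto simp: norm_mult abs_mult intro!: mult_left_mono order_trans[OF bd])
  qed
  have gi: "integrable lborel (\<lambda>x. complex_of_real (gauss c x) * cis (- (\<xi> \<bullet> x)))" for \<xi> :: "real^'n"
    by (rule integrable_mult_cis[OF integrable_of_real[OF gauss_integrable[OF c]]]) measurable
  have inner: "(LINT x|lborel. A x * cis (- (\<xi> \<bullet> x))) = (LINT y|lborel. cnj (F y) * of_real (gauss_hat c (\<xi> - y)))" for \<xi>
  proof -
    have "(LINT x|lborel. A x * cis (- (\<xi> \<bullet> x)))
       = (LINT x|lborel. (complex_of_real (gauss c x) * cis (- (\<xi> \<bullet> x))) * (LINT y|lborel. cnj (F y) * cis (y \<bullet> x)))"
      unfolding A_def cFh by (simp add: mult_ac)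
    also have "\<dots> = (LINT y|lborel. cnj (F y) * (LINT x|lborel. (complex_of_real (gauss c x) * cis (- (\<xi> \<bullet> x))) * cis (y \<bullet> x)))"
      by (rule integral_kernel_swap[OF gi cF]) (auto intro!: continuous_intros)
    also have "(\<lambda>y. LINT x|lborel. (complex_of_real (gauss c x) * cis (- (\<xi> \<bullet> x))) * cis (y \<bullet> x)) = (\<lambda>y. of_real (gauss_hat c (\<xi> - y)))"
      unfolding fourier_gauss[OF c, symmetric]
      by (intro ext Bochner_Integration.integral_cong) (auto simp: mult.assoc cis_mult inner_diff_right inner_commute)
    finally show ?thesis .
  qed
  have sq: "A x * fourier F x = complex_of_real (gauss c x * (cmod (fourier F x))\<^sup>2)" for x
    unfolding A_def by (simp add: mult.assoc complex_norm_square[symmetric] mult.commute[of "cnj _"])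
  have "(LINT x|lborel. A x * fourier F x) = (LINT \<xi>|lborel. F \<xi> * (LINT x|lborel. A x * cis (- (\<xi> \<bullet> x))))"
    unfolding fourier_def by (rule integral_kernel_swap[OF A F]) (auto intro!: continuous_intros)
  then have eq: "complex_of_real (LINT x|lborel. gauss c x * (cmod (fourier F x))\<^sup>2)
     = (LINT \<xi>|lborel. F \<xi> * (LINT y|lborel. cnj (F y) * of_real (gauss_hat c (\<xi> - y))))"
    unfolding sq inner by (metis integral_complex_of_real)
  have "integrable lborel (\<lambda>x. gauss c x * (cmod (fourier F x))\<^sup>2)"
  proof (rule Bochner_Integration.integrable_bound[where f="\<lambda>x. gauss c x * N\<^sup>2"])
    show "integrable lborel (\<lambda>x. gauss c x * N\<^sup>2)" by (simp add: gauss_integrable[OF c])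
    show "AE x in lborel. norm (gauss c x * (cmod (fourier F x))\<^sup>2) \<le> norm (gauss c x * N\<^sup>2)"
      using bd gauss_nonneg by (intro AE_I2) (auto simp: abs_mult intro!: mult_left_mono power_mono)
  qed measurable
  then have "(\<integral>\<^sup>+ x. ennreal (gauss c x * (cmod (fourier F x))\<^sup>2) \<partial>lborel) = ennreal (LINT x|lborel. gauss c x * (cmod (fourier F x))\<^sup>2)"
    by (rule nn_integral_eq_integral) (auto simp: gauss_nonneg)
  also have "\<dots> = ennreal (norm (complex_of_real (LINT x|lborel. gauss c x * (cmod (fourier F x))\<^sup>2)))"
    by (subst norm_of_real, subst abs_of_nonneg) (auto intro!: Bochner_Integration.integral_nonneg simp: gauss_nonneg)
  also have "\<dots> \<le> (\<integral>\<^sup>+ \<xi>. ennreal (norm (F \<xi> * (LINT y|lborel. cnj (F y) * of_real (gauss_hat c (\<xi> - y))))) \<partial>lborel)"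
    unfolding eq by (rule ennreal_norm_integral_le)
  also have "\<dots> \<le> (\<integral>\<^sup>+ \<xi>. \<integral>\<^sup>+ y. ennreal (norm (F \<xi>)) * ennreal (norm (F y)) * ennreal (gauss_hat c (\<xi> - y)) \<partial>lborel \<partial>lborel)"
  proof (rule nn_integral_mono)
    fix \<xi>
    have "ennreal (norm (F \<xi> * (LINT y|lborel. cnj (F y) * of_real (gauss_hat c (\<xi> - y)))))
       \<le> ennreal (norm (F \<xi>)) * (\<integral>\<^sup>+ y. ennreal (norm (cnj (F y) * of_real (gauss_hat c (\<xi> - y)))) \<partial>lborel)"
      unfolding norm_mult[of "F \<xi>"] by (subst ennreal_mult) (auto intro!: mult_left_mono ennreal_norm_integral_le)
    also have "\<dots> = (\<integral>\<^sup>+ y. ennreal (norm (F \<xi>)) * ennreal (norm (F y)) * ennreal (gauss_hat c (\<xi> - y)) \<partial>lborel)"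
      by (subst nn_integral_cmult[symmetric]) (auto simp: norm_mult ennreal_mult gauss_hat_nonneg mult.assoc abs_of_nonneg)
    finally show "ennreal (norm (F \<xi> * (LINT y|lborel. cnj (F y) * of_real (gauss_hat c (\<xi> - y)))))
       \<le> (\<integral>\<^sup>+ y. ennreal (norm (F \<xi>)) * ennreal (norm (F y)) * ennreal (gauss_hat c (\<xi> - y)) \<partial>lborel)" .
  qed
  also have "\<dots> \<le> (\<integral>\<^sup>+ \<xi>. \<integral>\<^sup>+ y. (ennreal ((cmod (F \<xi>))\<^sup>2 / 2) * ennreal (gauss_hat c (\<xi> - y))
        + ennreal ((cmod (F y))\<^sup>2 / 2) * ennreal (gauss_hat c (\<xi> - y))) \<partial>lborel \<partial>lborel)"
  proof (intro nn_integral_mono)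
    fix \<xi> y
    have "cmod (F \<xi>) * cmod (F y) \<le> (cmod (F \<xi>))\<^sup>2 / 2 + (cmod (F y))\<^sup>2 / 2"
      using sum_squares_bound[of "cmod (F \<xi>)" "cmod (F y)"] by simp
    then have "ennreal (norm (F \<xi>)) * ennreal (norm (F y)) \<le> ennreal ((cmod (F \<xi>))\<^sup>2 / 2) + ennreal ((cmod (F y))\<^sup>2 / 2)"
      by (simp add: ennreal_mult[symmetric] ennreal_plus[symmetric] ennreal_leI del: ennreal_plus)
    then show "ennreal (norm (F \<xi>)) * ennreal (norm (F y)) * ennreal (gauss_hat c (\<xi> - y))
      \<le> ennreal ((cmod (F \<xi>))\<^sup>2 / 2) * ennreal (gauss_hat c (\<xi> - y)) + ennreal ((cmod (F y))\<^sup>2 / 2) * ennreal (gauss_hat c (\<xi> - y))"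
      unfolding distrib_right[symmetric] by (rule mult_right_mono) simp
  qed
  also have "\<dots> = (\<integral>\<^sup>+ \<xi>. \<integral>\<^sup>+ y. ennreal ((cmod (F \<xi>))\<^sup>2 / 2) * ennreal (gauss_hat c (\<xi> - y)) \<partial>lborel \<partial>lborel)
     + (\<integral>\<^sup>+ \<xi>. \<integral>\<^sup>+ y. ennreal ((cmod (F y))\<^sup>2 / 2) * ennreal (gauss_hat c (\<xi> - y)) \<partial>lborel \<partial>lborel)"
    by (subst nn_integral_add[symmetric]) (auto intro!: nn_integral_cong nn_integral_add)
  also have "(\<integral>\<^sup>+ \<xi>. \<integral>\<^sup>+ y. ennreal ((cmod (F y))\<^sup>2 / 2) * ennreal (gauss_hat c (\<xi> - y)) \<partial>lborel \<partial>lborel)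
     = (\<integral>\<^sup>+ y. \<integral>\<^sup>+ \<xi>. ennreal ((cmod (F y))\<^sup>2 / 2) * ennreal (gauss_hat c (y - \<xi>)) \<partial>lborel \<partial>lborel)"
    by (subst lborel_pair.Fubini') (simp_all add: gauss_hat_minus)
  also have "(\<integral>\<^sup>+ \<xi>. \<integral>\<^sup>+ y. ennreal ((cmod (F \<xi>))\<^sup>2 / 2) * ennreal (gauss_hat c (\<xi> - y)) \<partial>lborel \<partial>lborel)
     = ennreal ((2 * pi) ^ CARD('n)) * (\<integral>\<^sup>+ \<xi>. ennreal ((cmod (F \<xi>))\<^sup>2 / 2) \<partial>lborel)"
  proof -
    have "(\<integral>\<^sup>+ y. ennreal (gauss_hat c (\<xi> - y)) \<partial>lborel) = ennreal ((2 * pi) ^ CARD('n))" for \<xi> :: "real^'n"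
      using nn_integral_translate[of "\<lambda>y. ennreal (gauss_hat c y)" "- \<xi>"] gauss_hat_mass[OF c, where 'a="real^'n"]
      by (simp add: gauss_hat_minus[of c \<xi>])
    then show ?thesis by (simp add: nn_integral_cmult nn_integral_multc mult.commute)
  qed
  also have "\<dots> + \<dots> = ennreal ((2 * pi) ^ CARD('n)) * sqnorm F"
  proof -
    have "(\<integral>\<^sup>+ \<xi>. ennreal ((cmod (F \<xi>))\<^sup>2 / 2) \<partial>lborel) + (\<integral>\<^sup>+ \<xi>. ennreal ((cmod (F \<xi>))\<^sup>2 / 2) \<partial>lborel) = sqnorm F"
      unfolding sqnorm_def by (subst nn_integral_add[symmetric]) (auto simp: ennreal_plus[symmetric] simp del: ennreal_plus)
    then show ?thesis by (simp flip: distrib_left)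
  qed
  finally show ?thesis .
qed

text \<open>Plancherel's theorem as an inequality for integrable functions.  The damping is removed by Fatou's
  lemma.\<close>

lemma fourier_sqnorm_le:
  fixes F :: "real^'n::finite \<Rightarrow> complex"
  assumes F: "integrable lborel F"
  shows "sqnorm (fourier F) \<le> ennreal ((2 * pi) ^ CARD('n)) * sqnorm F"
proof -
  define c where "c = (\<lambda>m. 1 / real (Suc m))"
  have [measurable]: "fourier F \<in> borel_measurable borel" by (rule fourier_measurable[OF F])
  have lim: "(\<lambda>m. ennreal (gauss (c m) x * (cmod (fourier F x))\<^sup>2)) \<longlonglongrightarrow> ennreal ((cmod (fourier F x))\<^sup>2)" for x
  proof -
    have "c \<longlonglongrightarrow> 0" unfolding c_def using LIMSEQ_inverse_real_of_nat by (simp add: inverse_eq_divide)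
    then have "(\<lambda>m. gauss (c m) x * (cmod (fourier F x))\<^sup>2) \<longlonglongrightarrow> (\<Prod>b\<in>Basis. exp (- (0 * (x \<bullet> b))\<^sup>2 / 2)) * (cmod (fourier F x))\<^sup>2"
      unfolding gauss_def by (intro tendsto_intros) auto
    then show ?thesis by (intro tendsto_ennrealI) simp
  qed
  have "sqnorm (fourier F) = (\<integral>\<^sup>+ x. liminf (\<lambda>m. ennreal (gauss (c m) x * (cmod (fourier F x))\<^sup>2)) \<partial>lborel)"
    unfolding sqnorm_def using lim_imp_Liminf[OF _ lim] by simp
  also have "\<dots> \<le> liminf (\<lambda>m. \<integral>\<^sup>+ x. ennreal (gauss (c m) x * (cmod (fourier F x))\<^sup>2) \<partial>lborel)"
    by (rule nn_integral_liminf) measurable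
  also have "\<dots> \<le> liminf (\<lambda>m. ennreal ((2 * pi) ^ CARD('n)) * sqnorm F)"
    by (intro Liminf_mono always_eventually allI gauss_fourier_sqnorm_le[OF F]) (simp add: c_def)
  finally show ?thesis by (simp add: Liminf_const)
qed

section \<open>Fourier transforms of Schwartz functions\<close>

lemma has_vector_derivative_cis:
  "((\<lambda>s. cis (a + s * b)) has_vector_derivative \<i> * of_real b * cis (a + t * b)) (at t within S)"
proof -
  have "((\<lambda>z. exp (\<i> * (of_real a + z * of_real b))) has_field_derivative
      \<i> * of_real b * exp (\<i> * (of_real a + of_real t * of_real b))) (at (of_real t))"
    by (auto intro!: derivative_eq_intros)
  from has_vector_derivative_real_field[OF this] show ?thesis
    by (simp add: cis_conv_exp)
qed

lemma inner_axis_1: "axis i (1::real) \<bullet> \<xi> = \<xi> $ i"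
  by (simp add: inner_axis')

lemma fourier_dir_deriv:
  assumes f: "f \<in> schwartz"
  shows "fourier (dir_deriv (axis i 1) f) \<xi> = \<i> * of_real (\<xi> $ i) * fourier f \<xi>"
proof -
  define v where "v = (axis i 1 :: real^'a)"
  define G where "G = (\<lambda>x. f x * cis (- (x \<bullet> \<xi>)))"
  define G' where "G' = (\<lambda>x. f x * (\<i> * of_real (- (\<xi> $ i)) * cis (- (x \<bullet> \<xi>))) + dir_deriv v f x * cis (- (x \<bullet> \<xi>)))"
  have df: "dir_deriv v f \<in> schwartz" unfolding v_def by (rule schwartz_dir_deriv[OF f])
  note i1 = integrable_mult_cis[OF schwartz_integrable[OF f], of "\<lambda>x. - (x \<bullet> \<xi>)"]
  note i2 = integrable_mult_cis[OF schwartz_integrable[OF df], of "\<lambda>x. - (x \<bullet> \<xi>)"]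
  have "(LINT x|lborel. G' x) = 0"
  proof (rule integral_line_derivative_eq_0[where v=v and G=G])
    fix p t
    have "((\<lambda>s. cis (- (p \<bullet> \<xi>) + s * - (\<xi> $ i))) has_vector_derivative
        \<i> * of_real (- (\<xi> $ i)) * cis (- (p \<bullet> \<xi>) + t * - (\<xi> $ i))) (at t)"
      by (rule has_vector_derivative_cis)
    moreover have "- (p \<bullet> \<xi>) + s * - (\<xi> $ i) = - ((p + s *\<^sub>R v) \<bullet> \<xi>)" for s
      by (simp add: v_def inner_add_left inner_axis_1)
    ultimately have "((\<lambda>s. cis (- ((p + s *\<^sub>R v) \<bullet> \<xi>))) has_vector_derivative
        \<i> * of_real (- (\<xi> $ i)) * cis (- ((p + t *\<^sub>R v) \<bullet> \<xi>))) (at t)"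
      by simp
    then show "((\<lambda>s. G (p + s *\<^sub>R v)) has_vector_derivative G' (p + t *\<^sub>R v)) (at t)"
      unfolding G_def G'_def
      by (rule has_vector_derivative_mult[OF has_vector_derivative_dir_deriv[OF smooth_differentiable[OF schwartz_smooth[OF f]]]])
  next
    show "continuous_on UNIV G'"
      unfolding G'_def
      by (intro continuous_intros smooth_continuous[OF schwartz_smooth[OF f]] smooth_continuous[OF schwartz_smooth[OF df]])
    show "integrable lborel G" unfolding G_def using i1 by simp
    show "integrable lborel G'" unfolding G'_def
      using i1 i2 by (simp add: mult.left_commute[of "f _"])
  qed
  also have "(LINT x|lborel. G' x) = \<i> * of_real (- (\<xi> $ i)) * fourier f \<xi> + fourier (dir_deriv v f) \<xi>"
    unfolding G'_def fourier_def using i1 i2 by (simp add: mult.left_commute[of "f _"])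
  finally show ?thesis by (simp add: v_def add_eq_0_iff)
qed

text \<open>The weight is the squared modulus of \<open>\<Prod>\<^sub>j (1 + i \<xi>\<^sub>j)\<close>, and the factor \<open>1 + i \<xi>\<^sub>j\<close> on the Fourier side
  is the operator \<open>1 + \<partial>\<^sub>j\<close>.\<close>

lemma schwartz_fourier_weight:
  assumes f: "f \<in> schwartz"
  obtains g where "g \<in> schwartz" "\<And>\<xi>. (cmod (fourier g \<xi>))\<^sup>2 = weight \<xi> * (cmod (fourier f \<xi>))\<^sup>2"
proof -
  have ex: "\<exists>g\<in>schwartz. \<forall>\<xi>. fourier g \<xi> = (\<Prod>j\<in>J. 1 + \<i> * of_real (\<xi> $ j)) * fourier f \<xi>" if "finite J" for J :: "'a set"
    using that
  proof induction
    case empty then show ?case using f by auto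
  next
    case (insert j J)
    then obtain g where g: "g \<in> schwartz" "\<And>\<xi>. fourier g \<xi> = (\<Prod>j\<in>J. 1 + \<i> * of_real (\<xi> $ j)) * fourier f \<xi>"
      by blast
    note dg = schwartz_dir_deriv[OF g(1), of j]
    have "fourier (\<lambda>x. g x + dir_deriv (axis j 1) g x) \<xi> = (\<Prod>j\<in>insert j J. 1 + \<i> * of_real (\<xi> $ j)) * fourier f \<xi>" for \<xi>
      using insert by (subst fourier_add) (simp_all add: schwartz_integrable g(1) dg fourier_dir_deriv g(2) algebra_simps)
    then show ?case using schwartz_add[OF g(1) dg] by blast
  qed
  then obtain g where g: "g \<in> schwartz" "\<And>\<xi>. fourier g \<xi> = (\<Prod>j\<in>UNIV. 1 + \<i> * of_real (\<xi> $ j)) * fourier f \<xi>"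
    using ex[of UNIV] by auto
  have "(cmod (fourier g \<xi>))\<^sup>2 = weight \<xi> * (cmod (fourier f \<xi>))\<^sup>2" for \<xi>
    unfolding g(2) weight_def norm_mult prod_norm[symmetric] power_mult_distrib prod_power_distrib norm_one_plus_i_sq ..
  then show ?thesis using g(1) that by blast
qed

lemma schwartz_fourier_weight_finite:
  assumes f: "f \<in> schwartz"
  shows "(\<integral>\<^sup>+ \<xi>. ennreal (weight \<xi> * (cmod (fourier f \<xi>))\<^sup>2) \<partial>lborel) < \<infinity>"
proof -
  obtain g where g: "g \<in> schwartz" "\<And>\<xi>. (cmod (fourier g \<xi>))\<^sup>2 = weight \<xi> * (cmod (fourier f \<xi>))\<^sup>2"
    using schwartz_fourier_weight[OF f] by blast
  have "sqnorm (fourier g) < \<infinity>"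
    using fourier_sqnorm_le[OF schwartz_integrable[OF g(1)]] schwartz_sqnorm_finite[OF g(1)]
    by (auto simp: ennreal_mult_less_top intro: le_less_trans)
  then show ?thesis unfolding sqnorm_def g(2) .
qed

lemma schwartz_mult_coord:
  "f \<in> schwartz \<Longrightarrow> (\<lambda>x. c * of_real (x $ i) * f x) \<in> schwartz"
  using schwartz_mult_moderate[OF _ moderate.mult[OF moderate.const moderate.coord], of f c i]
  by (simp add: mult.commute)

text \<open>The difference quotient is avoided: the increment of the transform along a segment is an integral
  of the claimed derivative, by Fubini.\<close>

lemma fourier_line_derivative:
  assumes f: "f \<in> schwartz"
  shows "((\<lambda>s. fourier f (\<xi> + s *\<^sub>R axis i 1)) has_vector_derivative
      fourier (\<lambda>x. - \<i> * of_real (x $ i) * f x) (\<xi> + t *\<^sub>R axis i 1)) (at t)"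
proof -
  define h where "h = (\<lambda>x. - \<i> * of_real (x $ i) * f x)"
  have hs: "h \<in> schwartz" unfolding h_def by (rule schwartz_mult_coord[OF f])
  note hi = schwartz_integrable[OF hs] and fi = schwartz_integrable[OF f]
  define v where "v = (axis i 1 :: real^'a)"
  have cont: "continuous_on UNIV (\<lambda>t. fourier h (\<xi> + t *\<^sub>R v))"
    by (rule continuous_on_compose2[OF continuous_fourier[OF hi]]) (auto intro!: continuous_intros)
  have "integral {a..b} (\<lambda>t. fourier h (\<xi> + t *\<^sub>R v)) = fourier f (\<xi> + b *\<^sub>R v) - fourier f (\<xi> + a *\<^sub>R v)"
    if ab: "a \<le> b" for a b
  proof -
    define I where "I = (\<lambda>t::real. complex_of_real (indicator {a..b} t))"
    have Ii: "integrable lborel I" unfolding I_def by (intro integrable_of_real integrable_real_indicator) (simp_all add: ab)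
    have "integral {a..b} (\<lambda>t. fourier h (\<xi> + t *\<^sub>R v)) = (LINT t:{a..b}|lborel. fourier h (\<xi> + t *\<^sub>R v))"
      by (rule set_borel_integral_eq_integral(2)[symmetric])
         (auto intro!: borel_integrable_atLeastAtMost' continuous_on_subset[OF cont])
    also have "\<dots> = (LINT t|lborel. I t * (LINT x|lborel. h x * cis (- (x \<bullet> (\<xi> + t *\<^sub>R v)))))"
      unfolding set_lebesgue_integral_def I_def fourier_def by (simp add: scaleR_conv_of_real)
    also have "\<dots> = (LINT x|lborel. h x * (LINT t|lborel. I t * cis (- (x \<bullet> (\<xi> + t *\<^sub>R v)))))"
      by (rule integral_kernel_swap[OF Ii hi]) (auto intro!: continuous_intros)
    also have "\<dots> = (LINT x|lborel. f x * cis (- (x \<bullet> (\<xi> + b *\<^sub>R v))) - f x * cis (- (x \<bullet> (\<xi> + a *\<^sub>R v))))"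
    proof (rule Bochner_Integration.integral_cong)
      fix x
      \<comment> \<open>the integral of the kernel over the segment is the increment of the exponential\<close>
      have e: "- (x \<bullet> (\<xi> + t *\<^sub>R v)) = - (x \<bullet> \<xi>) + t * - (x $ i)" for t
        by (simp add: inner_add_right v_def inner_axis_1 inner_commute[of x "axis i 1"])
      have "(LINT t|lborel. indicator {a..b} t *\<^sub>R (\<i> * of_real (- (x $ i)) * cis (- (x \<bullet> \<xi>) + t * - (x $ i))))
          = cis (- (x \<bullet> \<xi>) + b * - (x $ i)) - cis (- (x \<bullet> \<xi>) + a * - (x $ i))"
        by (rule integral_FTC_Icc[OF ab has_vector_derivative_cis]) (auto intro!: continuous_intros)
      also have "(LINT t|lborel. indicator {a..b} t *\<^sub>R (\<i> * of_real (- (x $ i)) * cis (- (x \<bullet> \<xi>) + t * - (x $ i))))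
         = (LINT t|lborel. (\<i> * of_real (- (x $ i))) * (I t * cis (- (x \<bullet> (\<xi> + t *\<^sub>R v)))))"
        unfolding e I_def by (intro Bochner_Integration.integral_cong) (auto simp: scaleR_conv_of_real)
      also have "\<dots> = \<i> * of_real (- (x $ i)) * (LINT t|lborel. I t * cis (- (x \<bullet> (\<xi> + t *\<^sub>R v))))"
        by simp
      finally show "h x * (LINT t|lborel. I t * cis (- (x \<bullet> (\<xi> + t *\<^sub>R v))))
         = f x * cis (- (x \<bullet> (\<xi> + b *\<^sub>R v))) - f x * cis (- (x \<bullet> (\<xi> + a *\<^sub>R v)))"
        unfolding h_def e by (simp add: algebra_simps)
    qed simp
    also have "\<dots> = fourier f (\<xi> + b *\<^sub>R v) - fourier f (\<xi> + a *\<^sub>R v)"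
      unfolding fourier_def by (rule Bochner_Integration.integral_diff) (auto intro!: integrable_mult_cis fi)
    finally show ?thesis .
  qed
  from has_vector_derivative_of_integral[OF cont this] show ?thesis
    unfolding h_def v_def .
qed

section \<open>Bilinear operators with frozen symbol\<close>

definition mult_op :: "((real^'n::finite) \<times> (real^'n) \<Rightarrow> complex) \<Rightarrow> (real^'n \<Rightarrow> complex) \<Rightarrow> (real^'n \<Rightarrow> complex) \<Rightarrow> real^'n \<Rightarrow> complex" where
  "mult_op \<tau> f g x = (LINT p|lborel. \<tau> p * (fourier f (fst p) * fourier g (snd p) * cis (x \<bullet> (fst p + snd p))))"

text \<open>The hypothesis on the symbol for one frozen position and one derivative; the parameter bounds the
  squared \<open>L\<^sup>2\<close> norm.\<close>

definition fibre_bound :: "((real^'n::finite) \<times> (real^'n) \<Rightarrow> complex) \<Rightarrow> ennreal \<Rightarrow> bool" where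
  "fibre_bound \<tau> A \<longleftrightarrow> continuous_on UNIV \<tau> \<and> (\<forall>\<xi>. (\<integral>\<^sup>+ \<eta>. ennreal ((cmod (\<tau> (\<xi> - \<eta>, \<eta>)))\<^sup>2) \<partial>lborel) \<le> A)"

lemma fibre_bound_measurable: "fibre_bound \<tau> A \<Longrightarrow> \<tau> \<in> borel_measurable borel"
  by (auto simp: fibre_bound_def intro: borel_measurable_continuous_onI)

lemma measurable_comp_continuous:
  fixes g :: "'a::topological_space \<Rightarrow> 'b::topological_space"
  assumes "f \<in> borel_measurable borel" "continuous_on UNIV g"
  shows "(\<lambda>x. f (g x)) \<in> borel_measurable borel"
  using measurable_compose[OF borel_measurable_continuous_onI[OF assms(2)] assms(1)] .

lemma nn_integral_shear:
  fixes F :: "(real^'n::finite) \<times> (real^'n) \<Rightarrow> ennreal"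
  assumes F: "F \<in> borel_measurable borel"
  shows "(\<integral>\<^sup>+ \<xi>. \<integral>\<^sup>+ \<eta>. F (\<xi> - \<eta>, \<eta>) \<partial>lborel \<partial>lborel) = (\<integral>\<^sup>+ p. F p \<partial>lborel)"
proof -
  have m: "(\<lambda>p. F (fst p - snd p, snd p)) \<in> borel_measurable borel"
    by (rule measurable_comp_continuous[OF F]) (auto intro!: continuous_intros)
  have m2: "(\<lambda>p. F (fst p, snd p)) \<in> borel_measurable borel" using F by simp
  have "(\<integral>\<^sup>+ \<xi>. \<integral>\<^sup>+ \<eta>. F (\<xi> - \<eta>, \<eta>) \<partial>lborel \<partial>lborel) = (\<integral>\<^sup>+ \<eta>. \<integral>\<^sup>+ \<xi>. F (\<xi> - \<eta>, \<eta>) \<partial>lborel \<partial>lborel)"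
    using Tonelli_lborel[OF m] by simp
  also have "\<dots> = (\<integral>\<^sup>+ \<eta>. \<integral>\<^sup>+ \<xi>. F (\<xi>, \<eta>) \<partial>lborel \<partial>lborel)"
  proof (rule nn_integral_cong)
    fix \<eta> :: "real^'n"
    have "(\<lambda>\<xi>. F (\<xi>, \<eta>)) \<in> borel_measurable borel"
      by (rule measurable_comp_continuous[OF F]) (auto intro!: continuous_intros)
    from nn_integral_translate[OF this, of "- \<eta>"]
    show "(\<integral>\<^sup>+ \<xi>. F (\<xi> - \<eta>, \<eta>) \<partial>lborel) = (\<integral>\<^sup>+ \<xi>. F (\<xi>, \<eta>) \<partial>lborel)" by simp
  qed
  also have "\<dots> = (\<integral>\<^sup>+ p. F p \<partial>lborel)" using Tonelli_lborel(2)[OF m2] by simp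
  finally show ?thesis .
qed

lemma integral_shear:
  fixes F :: "(real^'n::finite) \<times> (real^'n) \<Rightarrow> complex"
  assumes F: "integrable lborel F"
  shows "(LINT \<xi>|lborel. LINT \<eta>|lborel. F (\<xi> - \<eta>, \<eta>)) = (LINT p|lborel. F p)"
    and "integrable lborel (\<lambda>\<xi>. LINT \<eta>|lborel. F (\<xi> - \<eta>, \<eta>))"
proof -
  have Fm: "F \<in> borel_measurable borel" using F by (simp add: integrable_iff_bounded)
  have m: "(\<lambda>p. F (fst p - snd p, snd p)) \<in> borel_measurable borel"
    by (rule measurable_comp_continuous[OF Fm]) (auto intro!: continuous_intros)
  have m2: "(\<lambda>p. F (fst p, snd p)) \<in> borel_measurable borel" using Fm by simp
  have Fn: "(\<lambda>p. ennreal (norm (F p))) \<in> borel_measurable borel" using Fm by simp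
  have fin0: "(\<integral>\<^sup>+ p. ennreal (norm (F p)) \<partial>lborel) < \<infinity>"
    using F by (simp add: integrable_iff_bounded)
  have fin: "(\<integral>\<^sup>+ \<xi>. \<integral>\<^sup>+ \<eta>. ennreal (norm (F (\<xi> - \<eta>, \<eta>))) \<partial>lborel \<partial>lborel) < \<infinity>"
    using nn_integral_shear[OF Fn] fin0 by simp
  have fin2: "(\<integral>\<^sup>+ \<xi>. \<integral>\<^sup>+ \<eta>. ennreal (norm (F (\<xi>, \<eta>))) \<partial>lborel \<partial>lborel) < \<infinity>"
    using Tonelli_lborel(1)[of "\<lambda>x y. ennreal (norm (F (x, y)))"] fin0 Fn by simp
  show "integrable lborel (\<lambda>\<xi>. LINT \<eta>|lborel. F (\<xi> - \<eta>, \<eta>))"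
    by (rule Fubini_lborel(4)[OF m fin])
  have "(LINT \<xi>|lborel. LINT \<eta>|lborel. F (\<xi> - \<eta>, \<eta>)) = (LINT \<eta>|lborel. LINT \<xi>|lborel. F (\<xi> - \<eta>, \<eta>))"
    using Fubini_lborel(2,3)[OF m fin] by simp
  also have "\<dots> = (LINT \<eta>|lborel. LINT \<xi>|lborel. F (\<xi>, \<eta>))"
  proof (rule Bochner_Integration.integral_cong)
    fix \<eta> :: "real^'n"
    have "(\<lambda>\<xi>. F (\<xi>, \<eta>)) \<in> borel_measurable borel"
      by (rule measurable_comp_continuous[OF Fm]) (auto intro!: continuous_intros)
    from integral_translate[OF this, of "- \<eta>"]
    show "(LINT \<xi>|lborel. F (\<xi> - \<eta>, \<eta>)) = (LINT \<xi>|lborel. F (\<xi>, \<eta>))" by simp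
  qed simp
  also have "\<dots> = (LINT p|lborel. F p)" using Fubini_lborel(3)[OF m2 fin2] by simp
  finally show "(LINT \<xi>|lborel. LINT \<eta>|lborel. F (\<xi> - \<eta>, \<eta>)) = (LINT p|lborel. F p)" .
qed

text \<open>The part of the bound for the integrand that depends on the two functions but not on the symbol,
  which makes it uniform over families of symbols.\<close>

definition freq_mass :: "(real^'n::finite \<Rightarrow> complex) \<Rightarrow> (real^'n \<Rightarrow> complex) \<Rightarrow> ennreal" where
  "freq_mass f g = (\<integral>\<^sup>+ p. ennreal (weight (fst p + snd p) * (cmod (fourier f (fst p) * fourier g (snd p)))\<^sup>2) \<partial>lborel)"

lemma fourier_pair_measurable:
  assumes "integrable lborel f" "integrable lborel g"
  shows "(\<lambda>p. fourier f (fst p) * fourier g (snd p)) \<in> borel_measurable borel"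
  by (intro borel_measurable_times measurable_comp_continuous[OF fourier_measurable] assms continuous_intros)

lemma freq_mass_finite:
  assumes f: "f \<in> schwartz" and g: "(g :: real^'n::finite \<Rightarrow> complex) \<in> schwartz"
  shows "freq_mass f g < \<infinity>"
proof -
  have [measurable]: "fourier f \<in> borel_measurable borel" "fourier g \<in> borel_measurable borel"
    using f g by (auto intro: fourier_measurable schwartz_integrable)
  define a where "a = (\<lambda>\<xi>. ennreal (weight \<xi> * (cmod (fourier f \<xi>))\<^sup>2))"
  define b where "b = (\<lambda>\<xi>. ennreal (weight \<xi> * (cmod (fourier g \<xi>))\<^sup>2))"
  have [measurable]: "a \<in> borel_measurable borel" "b \<in> borel_measurable borel"
    unfolding a_def b_def by measurable
  have m: "(\<lambda>p. a (fst p) * b (snd p)) \<in> borel_measurable borel"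
    unfolding borel_prod[symmetric] by measurable
  have "freq_mass f g \<le> (\<integral>\<^sup>+ p. ennreal (2 ^ CARD('n)) * (a (fst p) * b (snd p)) \<partial>lborel)"
    unfolding freq_mass_def
  proof (rule nn_integral_mono)
    fix p :: "(real^'n) \<times> (real^'n)"
    have "weight (fst p + snd p) * (cmod (fourier f (fst p) * fourier g (snd p)))\<^sup>2
       \<le> (2 ^ CARD('n) * (weight (fst p) * weight (snd p))) * (cmod (fourier f (fst p) * fourier g (snd p)))\<^sup>2"
      by (intro mult_right_mono weight_add_le) simp
    also have "\<dots> = 2 ^ CARD('n) * ((weight (fst p) * (cmod (fourier f (fst p)))\<^sup>2) * (weight (snd p) * (cmod (fourier g (snd p)))\<^sup>2))"
      by (simp add: norm_mult power_mult_distrib mult_ac)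
    finally have le: "weight (fst p + snd p) * (cmod (fourier f (fst p) * fourier g (snd p)))\<^sup>2
        \<le> 2 ^ CARD('n) * ((weight (fst p) * (cmod (fourier f (fst p)))\<^sup>2) * (weight (snd p) * (cmod (fourier g (snd p)))\<^sup>2))" .
    show "ennreal (weight (fst p + snd p) * (cmod (fourier f (fst p) * fourier g (snd p)))\<^sup>2)
       \<le> ennreal (2 ^ CARD('n)) * (a (fst p) * b (snd p))"
    proof -
      have nn: "0 \<le> weight (fst p) * (cmod (fourier f (fst p)))\<^sup>2" "0 \<le> weight (snd p) * (cmod (fourier g (snd p)))\<^sup>2"
        using weight_pos[of "fst p"] weight_pos[of "snd p"] by simp_all
      have "ennreal (2 ^ CARD('n)) * (a (fst p) * b (snd p))
          = ennreal (2 ^ CARD('n) * ((weight (fst p) * (cmod (fourier f (fst p)))\<^sup>2) * (weight (snd p) * (cmod (fourier g (snd p)))\<^sup>2)))"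
        unfolding a_def b_def ennreal_mult[OF nn, symmetric]
        by (rule ennreal_mult[symmetric]) (simp_all add: mult_nonneg_nonneg[OF nn])
      then show ?thesis using le by (simp add: ennreal_leI)
    qed
  qed
  also have "\<dots> = ennreal (2 ^ CARD('n)) * (\<integral>\<^sup>+ p. a (fst p) * b (snd p) \<partial>lborel)"
    by (rule nn_integral_cmult) (use m in simp)
  also have "(\<integral>\<^sup>+ p. a (fst p) * b (snd p) \<partial>lborel) = (\<integral>\<^sup>+ \<xi>. a \<xi> \<partial>lborel) * (\<integral>\<^sup>+ \<eta>. b \<eta> \<partial>lborel)"
    by (subst Tonelli_lborel(1)[symmetric, OF m]) (simp add: nn_integral_cmult nn_integral_multc)
  also have "ennreal (2 ^ CARD('n)) * \<dots> < \<infinity>"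
    using schwartz_fourier_weight_finite[OF f] schwartz_fourier_weight_finite[OF g]
    unfolding a_def b_def by (simp add: ennreal_mult_less_top)
  finally show ?thesis .
qed

text \<open>The pointwise size of \<open>\<tau>\<close> is not controlled, only its \<open>L\<^sup>2\<close> norms along the
  antidiagonals \<open>{(\<xi> - \<eta>, \<eta>)}\<close>.  Splitting by \<open>2ab \<le> a\<^sup>2 + b\<^sup>2\<close> with the weight at \<open>\<xi> + \<eta>\<close>
  puts an integrable function of \<open>\<xi>\<close> on those norms.\<close>

lemma mult_op_integrand_bound:
  fixes f g :: "real^'n::finite \<Rightarrow> complex"
  assumes \<tau>: "fibre_bound \<tau> A" and f: "f \<in> schwartz" and g: "g \<in> schwartz"
  shows "(\<integral>\<^sup>+ p. ennreal (cmod (\<tau> p * (fourier f (fst p) * fourier g (snd p) * cis (x \<bullet> (fst p + snd p))))) \<partial>lborel)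
      \<le> A * weight_mass TYPE('n) + freq_mass f g"
proof -
  note \<tau>m [measurable] = fibre_bound_measurable[OF \<tau>]
  note fg [measurable] = fourier_pair_measurable[OF schwartz_integrable[OF f] schwartz_integrable[OF g]]
  have w: "(\<lambda>p::(real^'n) \<times> (real^'n). weight (fst p + snd p)) \<in> borel_measurable borel"
    by (rule measurable_comp_continuous[OF weight_measurable]) (auto intro!: continuous_intros)
  define a where "a = (\<lambda>p. ennreal ((cmod (\<tau> p))\<^sup>2 / weight (fst p + snd p)))"
  define b where "b = (\<lambda>p. ennreal (weight (fst p + snd p) * (cmod (fourier f (fst p) * fourier g (snd p)))\<^sup>2))"
  have am [measurable]: "a \<in> borel_measurable borel" and [measurable]: "b \<in> borel_measurable borel"
    unfolding a_def b_def using w by measurable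
  have "(\<integral>\<^sup>+ p. ennreal (cmod (\<tau> p * (fourier f (fst p) * fourier g (snd p) * cis (x \<bullet> (fst p + snd p))))) \<partial>lborel)
     \<le> (\<integral>\<^sup>+ p. a p + b p \<partial>lborel)"
  proof (rule nn_integral_mono)
    fix p :: "(real^'n) \<times> (real^'n)"
    define W t s where "W = weight (fst p + snd p)" and "t = cmod (\<tau> p)" and "s = cmod (fourier f (fst p) * fourier g (snd p))"
    have W: "W > 0" unfolding W_def by (rule weight_pos)
    \<comment> \<open>the weight is divided between the two factors\<close>
    have "2 * ((t / sqrt W) * (sqrt W * s)) \<le> (t / sqrt W)\<^sup>2 + (sqrt W * s)\<^sup>2"
      using sum_squares_bound[of "t / sqrt W" "sqrt W * s"] by (simp only: mult.assoc)
    then have "2 * (t * s) \<le> t\<^sup>2 / W + W * s\<^sup>2"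
      using W by (simp add: power_mult_distrib power_divide)
    moreover have "0 \<le> t * s" by (simp add: t_def s_def)
    ultimately have "t * s \<le> t\<^sup>2 / W + W * s\<^sup>2" by linarith
    moreover have "cmod (\<tau> p * (fourier f (fst p) * fourier g (snd p) * cis (x \<bullet> (fst p + snd p)))) = t * s"
      unfolding t_def s_def by (simp add: norm_mult)
    ultimately show "ennreal (cmod (\<tau> p * (fourier f (fst p) * fourier g (snd p) * cis (x \<bullet> (fst p + snd p))))) \<le> a p + b p"
      unfolding a_def b_def W_def[symmetric] t_def[symmetric] s_def[symmetric]
      using W by (simp add: ennreal_plus[symmetric] ennreal_leI del: ennreal_plus)
  qed
  also have "\<dots> = (\<integral>\<^sup>+ p. a p \<partial>lborel) + freq_mass f g"
    unfolding freq_mass_def b_def[symmetric] by (rule nn_integral_add) measurable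
  also have "(\<integral>\<^sup>+ p. a p \<partial>lborel) \<le> A * weight_mass TYPE('n)"
  proof -
    have "(\<integral>\<^sup>+ p. a p \<partial>lborel) = (\<integral>\<^sup>+ \<xi>. \<integral>\<^sup>+ \<eta>. a (\<xi> - \<eta>, \<eta>) \<partial>lborel \<partial>lborel)"
      by (rule nn_integral_shear[OF am, symmetric])
    also have "\<dots> \<le> (\<integral>\<^sup>+ \<xi>. A * ennreal (1 / weight (\<xi>::real^'n)) \<partial>lborel)"
    proof (rule nn_integral_mono)
      fix \<xi> :: "real^'n"
      have mm: "(\<lambda>\<eta>. \<tau> (\<xi> - \<eta>, \<eta>)) \<in> borel_measurable borel"
        by (rule measurable_comp_continuous[OF \<tau>m]) (auto intro!: continuous_intros)
      have "(\<integral>\<^sup>+ \<eta>. a (\<xi> - \<eta>, \<eta>) \<partial>lborel) = (\<integral>\<^sup>+ \<eta>. ennreal ((cmod (\<tau> (\<xi> - \<eta>, \<eta>)))\<^sup>2) * ennreal (1 / weight \<xi>) \<partial>lborel)"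
        unfolding a_def using weight_pos[of \<xi>] by (simp add: ennreal_mult[symmetric])
      also have "\<dots> = (\<integral>\<^sup>+ \<eta>. ennreal ((cmod (\<tau> (\<xi> - \<eta>, \<eta>)))\<^sup>2) \<partial>lborel) * ennreal (1 / weight \<xi>)"
        by (rule nn_integral_multc) (use mm in measurable)
      also have "\<dots> \<le> A * ennreal (1 / weight \<xi>)"
        using \<tau> by (intro mult_right_mono) (auto simp: fibre_bound_def)
      finally show "(\<integral>\<^sup>+ \<eta>. a (\<xi> - \<eta>, \<eta>) \<partial>lborel) \<le> A * ennreal (1 / weight \<xi>)" .
    qed
    also have "\<dots> = A * weight_mass TYPE('n)"
      unfolding weight_mass_def by (rule nn_integral_cmult) measurable
    finally show ?thesis .
  qed
  finally show ?thesis by (simp add: add_right_mono)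
qed

lemma mult_op_integrable:
  fixes f g :: "real^'n::finite \<Rightarrow> complex"
  assumes \<tau>: "fibre_bound \<tau> A" "A < \<infinity>" and f: "f \<in> schwartz" and g: "g \<in> schwartz"
  shows "integrable lborel (\<lambda>p. \<tau> p * (fourier f (fst p) * fourier g (snd p) * cis (x \<bullet> (fst p + snd p))))"
proof (rule integrableI_bounded)
  have c: "(\<lambda>p. cis (x \<bullet> (fst p + snd p))) \<in> borel_measurable borel"
    by (rule measurable_comp_continuous[OF cis_measurable]) (auto intro!: continuous_intros)
  show "(\<lambda>p. \<tau> p * (fourier f (fst p) * fourier g (snd p) * cis (x \<bullet> (fst p + snd p)))) \<in> borel_measurable lborel"
    using fibre_bound_measurable[OF \<tau>(1)] fourier_pair_measurable[OF schwartz_integrable[OF f] schwartz_integrable[OF g]] c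
    by measurable
  have "A * weight_mass TYPE('n) + freq_mass f g < \<infinity>"
    using \<tau>(2) weight_mass_finite[where 'n='n] freq_mass_finite[OF f g] by (simp add: ennreal_mult_less_top)
  then show "(\<integral>\<^sup>+ p. ennreal (norm (\<tau> p * (fourier f (fst p) * fourier g (snd p) * cis (x \<bullet> (fst p + snd p))))) \<partial>lborel) < \<infinity>"
    using mult_op_integrand_bound[OF \<tau>(1) f g] by (rule le_less_trans[rotated])
qed

lemma ennreal_cmod_square: "ennreal ((cmod z)\<^sup>2) = (ennreal (cmod z))\<^sup>2"
  by (simp add: ennreal_power)

lemma mult_op_measurable:
  fixes f g :: "real^'n::finite \<Rightarrow> complex"
  assumes \<tau>: "fibre_bound \<tau> A" and f: "f \<in> schwartz" and g: "g \<in> schwartz"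
  shows "mult_op \<tau> f g \<in> borel_measurable borel"
proof -
  have m1: "(\<lambda>q. \<tau> (snd q)) \<in> borel_measurable (borel :: ((real^'n) \<times> (real^'n) \<times> (real^'n)) measure)"
    by (rule measurable_comp_continuous[OF fibre_bound_measurable[OF \<tau>]]) (intro continuous_intros)
  have m2: "(\<lambda>q. fourier f (fst (snd q)) * fourier g (snd (snd q))) \<in> borel_measurable (borel :: ((real^'n) \<times> (real^'n) \<times> (real^'n)) measure)"
    using measurable_comp_continuous[OF fourier_pair_measurable[OF schwartz_integrable[OF f] schwartz_integrable[OF g]] continuous_on_snd[OF continuous_on_id]] .
  have m3: "(\<lambda>q. cis (fst q \<bullet> (fst (snd q) + snd (snd q)))) \<in> borel_measurable (borel :: ((real^'n) \<times> (real^'n) \<times> (real^'n)) measure)"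
    by (intro borel_measurable_continuous_onI continuous_intros)
  have "(\<lambda>(x, p). \<tau> p * (fourier f (fst p) * fourier g (snd p) * cis (x \<bullet> (fst p + snd p)))) \<in> borel_measurable (borel :: ((real^'n) \<times> (real^'n) \<times> (real^'n)) measure)"
    unfolding split_beta' by (rule borel_measurable_times[OF m1 borel_measurable_times[OF m2 m3]])
  then have "(\<lambda>(x, p). \<tau> p * (fourier f (fst p) * fourier g (snd p) * cis (x \<bullet> (fst p + snd p)))) \<in> borel_measurable (lborel \<Otimes>\<^sub>M lborel)"
    by (simp only: measurable_lborel_pair)
  from lborel.borel_measurable_lebesgue_integral[OF this] show ?thesis
    unfolding mult_op_def by simp
qed

text \<open>In the sheared variable \<open>\<xi> + \<eta>\<close> the operator is an inverse Fourier transform of a function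
  whose size Cauchy-Schwarz on each antidiagonal controls.\<close>

lemma sqnorm_mult_op_le:
  fixes f g :: "real^'n::finite \<Rightarrow> complex"
  assumes \<tau>: "fibre_bound \<tau> A" "A < \<infinity>" and f: "f \<in> schwartz" and g: "g \<in> schwartz"
  shows "sqnorm (mult_op \<tau> f g) \<le> ennreal ((2 * pi) ^ (3 * CARD('n))) * A * sqnorm f * sqnorm g"
proof -
  have fi: "integrable lborel f" and gi: "integrable lborel g" using f g by (auto intro: schwartz_integrable)
  have fm [measurable]: "fourier f \<in> borel_measurable borel" and gm [measurable]: "fourier g \<in> borel_measurable borel"
    using fi gi by (auto intro: fourier_measurable)
  note \<tau>m = fibre_bound_measurable[OF \<tau>(1)]
  define q where "q = (\<lambda>p. \<tau> p * (fourier f (fst p) * fourier g (snd p)))"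
  define F where "F = (\<lambda>\<xi>. LINT \<eta>|lborel. q (\<xi> - \<eta>, \<eta>))"
  have qi: "integrable lborel (\<lambda>p. q p * cis (x \<bullet> (fst p + snd p)))" for x
    using mult_op_integrable[OF \<tau> f g, of x] by (simp add: q_def mult.assoc)
  have "integrable lborel q" using qi[of 0] by simp
  then have Fi: "integrable lborel F" unfolding F_def by (rule integral_shear(2))
  have op: "mult_op \<tau> f g x = fourier F (- x)" for x
  proof -
    have "mult_op \<tau> f g x = (LINT p|lborel. q p * cis (x \<bullet> (fst p + snd p)))"
      unfolding mult_op_def q_def by (simp add: mult.assoc)
    also have "\<dots> = (LINT \<xi>|lborel. LINT \<eta>|lborel. q (\<xi> - \<eta>, \<eta>) * cis (x \<bullet> \<xi>))"
      using integral_shear(1)[OF qi[of x]] by simp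
    also have "\<dots> = fourier F (- x)"
      unfolding fourier_def F_def by (simp add: inner_commute)
    finally show ?thesis .
  qed
  have "sqnorm (mult_op \<tau> f g) = sqnorm (fourier F)"
    unfolding sqnorm_def op
    using nn_integral_reflect[of "\<lambda>x. ennreal ((cmod (fourier F x))\<^sup>2)"] fourier_measurable[OF Fi] by simp
  also have "\<dots> \<le> ennreal ((2 * pi) ^ CARD('n)) * sqnorm F" by (rule fourier_sqnorm_le[OF Fi])
  also have "sqnorm F \<le> A * (sqnorm (fourier f) * sqnorm (fourier g))"
  proof -
    define b where "b = (\<lambda>p. ennreal (cmod (fourier f (fst p) * fourier g (snd p))) ^ 2)"
    have bm: "b \<in> borel_measurable borel"
      unfolding b_def using fourier_pair_measurable[OF fi gi] by measurable
    have "ennreal ((cmod (F \<xi>))\<^sup>2) \<le> A * (\<integral>\<^sup>+ \<eta>. b (\<xi> - \<eta>, \<eta>) \<partial>lborel)" for \<xi>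
    proof -
      have m1: "(\<lambda>\<eta>. ennreal (cmod (\<tau> (\<xi> - \<eta>, \<eta>)))) \<in> borel_measurable lborel"
      proof -
        have "(\<lambda>\<eta>. \<tau> (\<xi> - \<eta>, \<eta>)) \<in> borel_measurable borel"
          by (rule measurable_comp_continuous[OF \<tau>m]) (auto intro!: continuous_intros)
        then show ?thesis by measurable
      qed
      have m2: "(\<lambda>\<eta>. ennreal (cmod (fourier f (\<xi> - \<eta>) * fourier g \<eta>))) \<in> borel_measurable lborel"
        by measurable
      have "ennreal (cmod (F \<xi>)) \<le> (\<integral>\<^sup>+ \<eta>. ennreal (cmod (\<tau> (\<xi> - \<eta>, \<eta>))) * ennreal (cmod (fourier f (\<xi> - \<eta>) * fourier g \<eta>)) \<partial>lborel)"
        unfolding F_def q_def using ennreal_norm_integral_le[of lborel "\<lambda>\<eta>. \<tau> (\<xi> - \<eta>, \<eta>) * (fourier f (\<xi> - \<eta>) * fourier g \<eta>)"]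
        by (simp add: norm_mult ennreal_mult)
      then have "ennreal (cmod (F \<xi>)) ^ 2 \<le> (\<integral>\<^sup>+ \<eta>. ennreal (cmod (\<tau> (\<xi> - \<eta>, \<eta>))) * ennreal (cmod (fourier f (\<xi> - \<eta>) * fourier g \<eta>)) \<partial>lborel) ^ 2"
        by (rule power_mono) simp
      also have "\<dots> \<le> (\<integral>\<^sup>+ \<eta>. ennreal (cmod (\<tau> (\<xi> - \<eta>, \<eta>))) ^ 2 \<partial>lborel) * (\<integral>\<^sup>+ \<eta>. ennreal (cmod (fourier f (\<xi> - \<eta>) * fourier g \<eta>)) ^ 2 \<partial>lborel)"
        by (rule Cauchy_Schwarz_nn_integral[OF m1 m2])
      also have "\<dots> \<le> A * (\<integral>\<^sup>+ \<eta>. b (\<xi> - \<eta>, \<eta>) \<partial>lborel)"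
        unfolding b_def using \<tau>(1) by (intro mult_mono) (auto simp: fibre_bound_def ennreal_cmod_square)
      finally show ?thesis by (simp add: ennreal_cmod_square)
    qed
    then have "sqnorm F \<le> (\<integral>\<^sup>+ \<xi>. A * (\<integral>\<^sup>+ \<eta>. b (\<xi> - \<eta>, \<eta>) \<partial>lborel) \<partial>lborel)"
      unfolding sqnorm_def by (intro nn_integral_mono)
    also have "\<dots> = A * (\<integral>\<^sup>+ \<xi>. \<integral>\<^sup>+ \<eta>. b (\<xi> - \<eta>, \<eta>) \<partial>lborel \<partial>lborel)"
    proof (rule nn_integral_cmult)
      have "(\<lambda>(\<xi>, \<eta>). b (\<xi> - \<eta>, \<eta>)) \<in> borel_measurable (lborel \<Otimes>\<^sub>M lborel)"
        unfolding measurable_lborel_pair split_beta'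
        by (rule measurable_comp_continuous[OF bm]) (auto intro!: continuous_intros)
      then show "(\<lambda>\<xi>. \<integral>\<^sup>+ \<eta>. b (\<xi> - \<eta>, \<eta>) \<partial>lborel) \<in> borel_measurable lborel"
        by (rule lborel.borel_measurable_nn_integral)
    qed
    also have "(\<integral>\<^sup>+ \<xi>. \<integral>\<^sup>+ \<eta>. b (\<xi> - \<eta>, \<eta>) \<partial>lborel \<partial>lborel) = (\<integral>\<^sup>+ p. b p \<partial>lborel)"
      by (rule nn_integral_shear[OF bm])
    also have "\<dots> = (\<integral>\<^sup>+ \<xi>. \<integral>\<^sup>+ \<eta>. b (\<xi>, \<eta>) \<partial>lborel \<partial>lborel)"
      using Tonelli_lborel(1)[of "\<lambda>\<xi> \<eta>. b (\<xi>, \<eta>)"] bm by simp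
    also have "\<dots> = sqnorm (fourier f) * sqnorm (fourier g)"
      unfolding b_def sqnorm_def by (simp add: norm_mult ennreal_mult power_mult_distrib ennreal_power nn_integral_cmult nn_integral_multc)
    finally show ?thesis .
  qed
  also have "sqnorm (fourier f) * sqnorm (fourier g) \<le> (ennreal ((2 * pi) ^ CARD('n)) * sqnorm f) * (ennreal ((2 * pi) ^ CARD('n)) * sqnorm g)"
    by (intro mult_mono fourier_sqnorm_le fi gi) auto
  finally have "sqnorm (mult_op \<tau> f g) \<le> ennreal ((2 * pi) ^ CARD('n)) * (A *
      ((ennreal ((2 * pi) ^ CARD('n)) * sqnorm f) * (ennreal ((2 * pi) ^ CARD('n)) * sqnorm g)))"
    by (simp add: mult_left_mono)
  also have "\<dots> = (ennreal ((2 * pi) ^ CARD('n)) * ennreal ((2 * pi) ^ CARD('n)) * ennreal ((2 * pi) ^ CARD('n))) * A * sqnorm f * sqnorm g"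
    by (simp only: mult_ac)
  also have "ennreal ((2 * pi) ^ CARD('n)) * ennreal ((2 * pi) ^ CARD('n)) * ennreal ((2 * pi) ^ CARD('n)) = ennreal ((2 * pi) ^ (3 * CARD('n)))"
    by (simp add: ennreal_mult[symmetric] power_mult power3_eq_cube mult.commute[of 3] power_mult)
  finally show ?thesis .
qed


section \<open>Weighted bounds\<close>

text \<open>The operator transfers a factor \<open>1 + i (u\<^sub>j - c)\<close> from the first function to the output,
  at the price of a \<open>\<xi>\<^sub>j\<close> derivative of the symbol: on the Fourier side multiplication by \<open>u\<^sub>j\<close>
  is a derivative, which is integrated by parts against \<open>\<tau>(\<xi>, \<eta>) exp(i x \<cdot> (\<xi> + \<eta>))\<close>.\<close>

lemma mult_op_coord:
  fixes f g :: "real^'n::finite \<Rightarrow> complex"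
  assumes sm: "smooth \<tau>" and \<tau>: "fibre_bound \<tau> A" "fibre_bound (dir_deriv (axis j 1, 0) \<tau>) A" "A < \<infinity>"
    and f: "f \<in> schwartz" and g: "g \<in> schwartz"
  shows "mult_op \<tau> (\<lambda>u. (1 + \<i> * of_real (u $ j - c)) * f u) g x
    = (1 + \<i> * of_real (x $ j - c)) * mult_op \<tau> f g x + mult_op (dir_deriv (axis j 1, 0) \<tau>) f g x"
proof -
  define v where "v = (axis j 1 :: real^'n, 0 :: real^'n)"
  define q where "q = (\<lambda>u. - \<i> * of_real (u $ j) * f u)"
  have q: "q \<in> schwartz" unfolding q_def by (rule schwartz_mult_coord[OF f])
  note fi = schwartz_integrable[OF f] and qi = schwartz_integrable[OF q] and gi = schwartz_integrable[OF g]
  define e where "e = (\<lambda>p::(real^'n) \<times> (real^'n). cis (x \<bullet> (fst p + snd p)))"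
  define G where "G = (\<lambda>p. \<tau> p * (fourier f (fst p) * fourier g (snd p) * e p))"
  define G1 where "G1 = (\<lambda>p. dir_deriv v \<tau> p * (fourier f (fst p) * fourier g (snd p) * e p))"
  define G2 where "G2 = (\<lambda>p. \<tau> p * (fourier q (fst p) * fourier g (snd p) * e p))"
  have Gi: "integrable lborel G" and G1i: "integrable lborel G1" and G2i: "integrable lborel G2"
    unfolding G_def G1_def G2_def e_def v_def
    by (rule mult_op_integrable[OF \<tau>(1) \<tau>(3) f g] mult_op_integrable[OF \<tau>(2) \<tau>(3) f g] mult_op_integrable[OF \<tau>(1) \<tau>(3) q g])+
  have int: "mult_op \<tau> f g x = integral\<^sup>L lborel G" "mult_op (dir_deriv v \<tau>) f g x = integral\<^sup>L lborel G1"
    "mult_op \<tau> q g x = integral\<^sup>L lborel G2"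
    unfolding mult_op_def G_def G1_def G2_def e_def by auto
  have vB: "v \<in> Basis" unfolding v_def by (simp add: Basis_prod_def axis_in_Basis_iff)
  have cf: "continuous_on UNIV (\<lambda>p. fourier f (fst p))" "continuous_on UNIV (\<lambda>p. fourier q (fst p))" "continuous_on UNIV (\<lambda>p. fourier g (snd p))"
    by (auto intro!: continuous_on_compose2[OF continuous_fourier] continuous_intros fi qi gi)
  have ce: "continuous_on UNIV e" unfolding e_def by (intro continuous_intros)
  have "(LINT p|lborel. G1 p + G2 p + \<i> * of_real (x $ j) * G p) = 0"
  proof (rule integral_line_derivative_eq_0[where v=v and G=G])
    fix p :: "(real^'n) \<times> (real^'n)" and t :: real
    have d1: "((\<lambda>s. \<tau> (p + s *\<^sub>R v)) has_vector_derivative dir_deriv v \<tau> (p + t *\<^sub>R v)) (at t)"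
      by (rule has_vector_derivative_dir_deriv[OF smooth_differentiable[OF sm]])
    have d2: "((\<lambda>s. fourier f (fst (p + s *\<^sub>R v))) has_vector_derivative fourier q (fst (p + t *\<^sub>R v))) (at t)"
      using fourier_line_derivative[OF f, of "fst p" j t] by (simp add: v_def q_def)
    have d3: "((\<lambda>s. e (p + s *\<^sub>R v)) has_vector_derivative \<i> * of_real (x $ j) * e (p + t *\<^sub>R v)) (at t)"
    proof -
      have "x \<bullet> (fst (p + s *\<^sub>R v) + snd (p + s *\<^sub>R v)) = x \<bullet> (fst p + snd p) + s * (x $ j)" for s
        by (simp add: v_def inner_add_right inner_axis_1 inner_commute[of x "axis j 1"])
      then show ?thesis unfolding e_def using has_vector_derivative_cis[of "x \<bullet> (fst p + snd p)" "x $ j" t UNIV] by simp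
    qed
    have "((\<lambda>s. fourier f (fst (p + s *\<^sub>R v)) * (fourier g (snd p) * e (p + s *\<^sub>R v))) has_vector_derivative
       fourier f (fst (p + t *\<^sub>R v)) * (fourier g (snd p) * (\<i> * of_real (x $ j) * e (p + t *\<^sub>R v)))
        + fourier q (fst (p + t *\<^sub>R v)) * (fourier g (snd p) * e (p + t *\<^sub>R v))) (at t)"
      by (rule has_vector_derivative_mult[OF d2 has_vector_derivative_mult_right[OF d3]])
    from has_vector_derivative_mult[OF d1 this]
    show "((\<lambda>s. G (p + s *\<^sub>R v)) has_vector_derivative
        G1 (p + t *\<^sub>R v) + G2 (p + t *\<^sub>R v) + \<i> * of_real (x $ j) * G (p + t *\<^sub>R v)) (at t)"
      unfolding G_def G1_def G2_def by (simp add: v_def algebra_simps)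
  next
    show "continuous_on UNIV (\<lambda>p. G1 p + G2 p + \<i> * of_real (x $ j) * G p)"
      unfolding G_def G1_def G2_def
      by (intro continuous_intros cf ce smooth_continuous[OF sm] smooth_continuous[OF smooth_dir_deriv[OF sm vB]])
  qed (use Gi G1i G2i in auto)
  then have parts: "integral\<^sup>L lborel G2 = - integral\<^sup>L lborel G1 - \<i> * of_real (x $ j) * integral\<^sup>L lborel G"
    using Gi G1i G2i by (simp add: add_eq_0_iff algebra_simps)
  have hat: "fourier (\<lambda>u. (1 + \<i> * of_real (u $ j - c)) * f u) \<xi> = (1 - \<i> * of_real c) * fourier f \<xi> + - 1 * fourier q \<xi>" for \<xi>
  proof -
    have "(\<lambda>u. (1 + \<i> * of_real (u $ j - c)) * f u) = (\<lambda>u. (1 - \<i> * of_real c) * f u + - 1 * q u)"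
      by (auto simp: q_def algebra_simps)
    then show ?thesis
      using fourier_add[of "\<lambda>u. (1 - \<i> * of_real c) * f u" "\<lambda>u. - 1 * q u" \<xi>] fi qi
      by (simp only: fourier_cmult) simp
  qed
  have "mult_op \<tau> (\<lambda>u. (1 + \<i> * of_real (u $ j - c)) * f u) g x = (LINT p|lborel. (1 - \<i> * of_real c) * G p + - 1 * G2 p)"
    unfolding mult_op_def hat G_def G2_def e_def by (intro Bochner_Integration.integral_cong) (auto simp: algebra_simps)
  also have "\<dots> = (1 - \<i> * of_real c) * integral\<^sup>L lborel G - integral\<^sup>L lborel G2"
    using Gi G2i by simp
  finally show ?thesis
    unfolding parts v_def[symmetric] int by (simp add: algebra_simps)
qed

abbreviation xi_dirs :: "'n::finite list \<Rightarrow> ((real^'n) \<times> (real^'n)) list" where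
  "xi_dirs w \<equiv> map (\<lambda>j. (axis j 1, 0)) w"

lemma xi_dirs_Basis: "set (xi_dirs w) \<subseteq> Basis"
  by (auto simp: Basis_prod_def axis_in_Basis_iff)

text \<open>A complex square root of the weight: over all coordinates its squared modulus is
  \<open>weight (u - c)\<close>.  Each factor is of first order, so it costs a single derivative of the symbol.\<close>

definition shift_weight :: "real^'n::finite \<Rightarrow> 'n list \<Rightarrow> real^'n \<Rightarrow> complex" where
  "shift_weight c js u = prod_list (map (\<lambda>j. 1 + \<i> * of_real (u $ j - c $ j)) js)"

lemma schwartz_shift_weight:
  assumes h: "h \<in> schwartz" shows "(\<lambda>u. shift_weight c js u * h u) \<in> schwartz"
proof -
  have "shift_weight c js \<in> moderate" unfolding shift_weight_def
  proof (induction js)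
    case (Cons j js)
    have "(\<lambda>u. 1 + \<i> * of_real (u $ j - c $ j)) = (\<lambda>u. (1 - \<i> * of_real (c $ j)) + \<i> * of_real (u $ j))"
      by (auto simp: algebra_simps)
    then have "(\<lambda>u. 1 + \<i> * of_real (u $ j - c $ j)) \<in> moderate"
      using moderate.add[OF moderate.const moderate.mult[OF moderate.const moderate.coord], of "1 - \<i> * of_real (c $ j)" \<i> j] by metis
    from moderate.mult[OF this Cons] show ?case by simp
  qed (simp add: moderate.const)
  from schwartz_mult_moderate[OF h this] show ?thesis by (simp add: mult.commute)
qed

text \<open>One application of \<open>mult_op_coord\<close> per coordinate.  Either the factor passes to the output or the
  symbol is differentiated, so the subsets of coordinates index the terms; a missing factor on
  the output is restored at no cost because each factor has modulus at least one.\<close>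

lemma norm_mult_op_shift_weight_le:
  fixes h g :: "real^'n::finite \<Rightarrow> complex"
  assumes "smooth \<tau>" and "\<And>w. length w \<le> length js \<Longrightarrow> fibre_bound (word_deriv (xi_dirs w) \<tau>) A" and A: "A < \<infinity>"
    and h: "h \<in> schwartz" and g: "g \<in> schwartz"
  shows "cmod (mult_op \<tau> (\<lambda>u. shift_weight c js u * h u) g x)
    \<le> cmod (shift_weight c js x) * (\<Sum>w\<leftarrow>subseqs js. cmod (mult_op (word_deriv (xi_dirs w) \<tau>) h g x))"
  using assms(1,2)
proof (induction js arbitrary: \<tau>)
  case Nil
  then show ?case by (simp add: shift_weight_def)
next
  case (Cons j js)
  define \<tau>' where "\<tau>' = dir_deriv (axis j 1, 0 :: real^'n) \<tau>"
  define Pj where "Pj = (\<lambda>u::real^'n. 1 + \<i> * complex_of_real (u $ j - c $ j))"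
  have sm': "smooth \<tau>'" unfolding \<tau>'_def using Cons(2) by (intro smooth_dir_deriv) (auto simp: Basis_prod_def axis_in_Basis_iff)
  have comm: "word_deriv (xi_dirs w) \<tau>' = word_deriv (xi_dirs (j # w)) \<tau>" for w
  proof -
    have "word_deriv (xi_dirs w) \<tau>' = word_deriv (xi_dirs (w @ [j])) \<tau>"
      unfolding \<tau>'_def by (simp add: word_deriv_append)
    also have "\<dots> = word_deriv (xi_dirs (j # w)) \<tau>"
      by (rule word_deriv_permute[OF Cons(2) xi_dirs_Basis]) simp
    finally show ?thesis .
  qed
  have IH1: "cmod (mult_op \<tau> (\<lambda>u. shift_weight c js u * h u) g x)
    \<le> cmod (shift_weight c js x) * (\<Sum>w\<leftarrow>subseqs js. cmod (mult_op (word_deriv (xi_dirs w) \<tau>) h g x))"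
    by (rule Cons.IH[OF Cons(2)]) (use Cons(3) in simp)
  have IH2: "cmod (mult_op \<tau>' (\<lambda>u. shift_weight c js u * h u) g x)
    \<le> cmod (shift_weight c js x) * (\<Sum>w\<leftarrow>subseqs js. cmod (mult_op (word_deriv (xi_dirs (j # w)) \<tau>) h g x))"
    unfolding comm[symmetric]
  proof (rule Cons.IH[OF sm'])
    fix w :: "'n list" assume "length w \<le> length js"
    then show "fibre_bound (word_deriv (xi_dirs w) \<tau>') A"
      unfolding comm by (intro Cons(3)) simp
  qed
  have fb: "fibre_bound \<tau> A" "fibre_bound \<tau>' A"
    using Cons(3)[of "[]"] Cons(3)[of "[j]"] by (simp_all add: \<tau>'_def)
  have "mult_op \<tau> (\<lambda>u. shift_weight c (j # js) u * h u) g x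
      = Pj x * mult_op \<tau> (\<lambda>u. shift_weight c js u * h u) g x + mult_op \<tau>' (\<lambda>u. shift_weight c js u * h u) g x"
    unfolding Pj_def \<tau>'_def
    using mult_op_coord[OF Cons(2) fb[unfolded \<tau>'_def] A schwartz_shift_weight[OF h] g, of "c $ j" c js x]
    by (simp add: shift_weight_def mult.assoc)
  then have "cmod (mult_op \<tau> (\<lambda>u. shift_weight c (j # js) u * h u) g x)
    \<le> cmod (Pj x) * cmod (mult_op \<tau> (\<lambda>u. shift_weight c js u * h u) g x) + cmod (mult_op \<tau>' (\<lambda>u. shift_weight c js u * h u) g x)"
    by (simp only: norm_mult[symmetric] norm_triangle_ineq)
  also have "\<dots> \<le> cmod (Pj x) * cmod (mult_op \<tau> (\<lambda>u. shift_weight c js u * h u) g x) + cmod (Pj x) * cmod (mult_op \<tau>' (\<lambda>u. shift_weight c js u * h u) g x)"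
    using mult_right_mono[OF norm_one_plus_i_ge1[of "x $ j - c $ j"], of "cmod (mult_op \<tau>' (\<lambda>u. shift_weight c js u * h u) g x)"]
    unfolding Pj_def by simp
  also have "\<dots> \<le> cmod (Pj x) * (cmod (shift_weight c js x) * (\<Sum>w\<leftarrow>subseqs js. cmod (mult_op (word_deriv (xi_dirs w) \<tau>) h g x)))
     + cmod (Pj x) * (cmod (shift_weight c js x) * (\<Sum>w\<leftarrow>subseqs js. cmod (mult_op (word_deriv (xi_dirs (j # w)) \<tau>) h g x)))"
    by (intro add_mono mult_left_mono IH1 IH2) auto
  also have "\<dots> = cmod (shift_weight c (j # js) x) * (\<Sum>w\<leftarrow>subseqs (j # js). cmod (mult_op (word_deriv (xi_dirs w) \<tau>) h g x))"
  proof -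
    have "shift_weight c (j # js) x = Pj x * shift_weight c js x" by (simp add: shift_weight_def Pj_def)
    then show ?thesis by (simp add: Let_def norm_mult o_def distrib_left mult.assoc add.commute)
  qed
  finally show ?case .
qed

lemma shift_weight_nz: "shift_weight c js u \<noteq> 0"
  unfolding shift_weight_def using one_plus_i_nz by (induction js) (auto simp del: of_real_diff)

lemma norm_shift_weight_sq:
  assumes "distinct js" "set js = UNIV"
  shows "(cmod (shift_weight c js (u :: real^'n::finite)))\<^sup>2 = weight (u - c)"
proof -
  have "shift_weight c js u = (\<Prod>j\<in>UNIV. 1 + \<i> * of_real (u $ j - c $ j))"
    unfolding shift_weight_def using assms by (metis prod.distinct_set_conv_list)
  then show ?thesis
    unfolding weight_def by (simp only: prod_norm[symmetric] prod_power_distrib norm_one_plus_i_sq vector_minus_component)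
qed

lemma ennreal_sum_squares_le:
  fixes a :: "'i \<Rightarrow> ennreal"
  assumes "finite I"
  shows "(\<Sum>i\<in>I. a i)\<^sup>2 \<le> of_nat (card I) * (\<Sum>i\<in>I. (a i)\<^sup>2)"
  using Cauchy_Schwarz_nn_integral[of "\<lambda>_. 1" "count_space I" a] assms
  by (simp add: nn_integral_count_space_finite)

text \<open>The weighted estimate: the frozen operator is bounded for the weight that decays away from
  an arbitrary centre, with a constant that does not depend on the centre.\<close>

lemma mult_op_weighted_bound:
  fixes f g :: "real^'n::finite \<Rightarrow> complex"
  assumes sm: "smooth \<tau>" and fb: "\<And>w. length w \<le> CARD('n) \<Longrightarrow> fibre_bound (word_deriv (xi_dirs w) \<tau>) A" and A: "A < \<infinity>"
    and f: "f \<in> schwartz" and g: "g \<in> schwartz"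
  shows "(\<integral>\<^sup>+ x. ennreal ((cmod (mult_op \<tau> f g x))\<^sup>2 / weight (x - c)) \<partial>lborel)
    \<le> ennreal (4 ^ CARD('n) * (2 * pi) ^ (3 * CARD('n))) * A * (\<integral>\<^sup>+ u. ennreal ((cmod (f u))\<^sup>2 / weight (u - c)) \<partial>lborel) * sqnorm g"
proof -
  obtain js :: "'n list" where js: "distinct js" "set js = UNIV"
    using finite_distinct_list[of "UNIV::'n set"] by auto
  have len: "length js = CARD('n)" using js distinct_card by metis
  define r where "r = (\<lambda>u::real^'n. inverse (shift_weight c js u))"
  have "r \<in> moderate"
  proof -
    have "r = (\<lambda>u. prod_list (map (\<lambda>j. inverse (1 + \<i> * of_real (u $ j - c $ j))) js))"
      unfolding r_def shift_weight_def by (rule ext, induction js) auto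
    moreover have "(\<lambda>u. prod_list (map (\<lambda>j. inverse (1 + \<i> * of_real (u $ j - c $ j))) ks)) \<in> moderate" for ks :: "'n list"
      by (induction ks) (use moderate.const moderate.mult[OF moderate.resolvent] in auto)
    ultimately show ?thesis by simp
  qed
  define h where "h = (\<lambda>u. f u * r u)"
  have h: "h \<in> schwartz" unfolding h_def by (rule schwartz_mult_moderate[OF f]) fact
  have fh: "f = (\<lambda>u. shift_weight c js u * h u)"
    unfolding h_def r_def by (rule ext) (simp add: shift_weight_nz field_simps)
  define ws where "ws = subseqs js"
  have lw: "length ws = 2 ^ CARD('n)" unfolding ws_def by (simp add: length_subseqs len)
  have wl: "length (ws ! i) \<le> CARD('n)" if "i < length ws" for i
  proof -
    have "set (ws ! i) \<in> Pow (set js)" using that subseqs_powset[of js] by (metis image_eqI nth_mem ws_def)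
    moreover have "distinct (ws ! i)" using that subseqs_distinctD[OF _ js(1)] nth_mem ws_def by metis
    ultimately show ?thesis by (metis distinct_card card_mono finite js(2) PowD)
  qed
  define m where "m = (\<lambda>i. mult_op (word_deriv (xi_dirs (ws ! i)) \<tau>) h g)"
  have "ennreal ((cmod (mult_op \<tau> f g x))\<^sup>2 / weight (x - c)) \<le> of_nat (2 ^ CARD('n)) * (\<Sum>i<length ws. ennreal ((cmod (m i x))\<^sup>2))" for x
  proof -
    have "cmod (mult_op \<tau> f g x) \<le> cmod (shift_weight c js x) * (\<Sum>w\<leftarrow>ws. cmod (mult_op (word_deriv (xi_dirs w) \<tau>) h g x))"
      unfolding ws_def by (subst fh) (rule norm_mult_op_shift_weight_le[OF sm fb A h g], simp add: len)
    also have "(\<Sum>w\<leftarrow>ws. cmod (mult_op (word_deriv (xi_dirs w) \<tau>) h g x)) = (\<Sum>i<length ws. cmod (m i x))"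
      unfolding m_def by (simp add: sum_list_sum_nth atLeast0LessThan)
    finally have "(cmod (mult_op \<tau> f g x))\<^sup>2 \<le> (cmod (shift_weight c js x) * (\<Sum>i<length ws. cmod (m i x)))\<^sup>2"
      by (rule power_mono) simp
    then have "(cmod (mult_op \<tau> f g x))\<^sup>2 / weight (x - c) \<le> (\<Sum>i<length ws. cmod (m i x))\<^sup>2"
      by (simp add: power_mult_distrib norm_shift_weight_sq[OF js] pos_divide_le_eq[OF weight_pos] mult.commute)
    then have "ennreal ((cmod (mult_op \<tau> f g x))\<^sup>2 / weight (x - c)) \<le> ennreal ((\<Sum>i<length ws. cmod (m i x))\<^sup>2)"
      by (rule ennreal_leI)
    also have "\<dots> = (\<Sum>i<length ws. ennreal (cmod (m i x)))\<^sup>2"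
      by (simp add: ennreal_power[symmetric] sum_nonneg)
    also have "\<dots> \<le> of_nat (card {..<length ws}) * (\<Sum>i<length ws. (ennreal (cmod (m i x)))\<^sup>2)"
      by (rule ennreal_sum_squares_le) simp
    finally show ?thesis by (simp add: lw ennreal_cmod_square)
  qed
  then have "(\<integral>\<^sup>+ x. ennreal ((cmod (mult_op \<tau> f g x))\<^sup>2 / weight (x - c)) \<partial>lborel)
     \<le> (\<integral>\<^sup>+ x. of_nat (2 ^ CARD('n)) * (\<Sum>i<length ws. ennreal ((cmod (m i x))\<^sup>2)) \<partial>lborel)"
    by (rule nn_integral_mono)
  also have "\<dots> = of_nat (2 ^ CARD('n)) * (\<Sum>i<length ws. sqnorm (m i))"
  proof -
    have mm: "m i \<in> borel_measurable borel" if "i < length ws" for i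
      unfolding m_def using fb[OF wl[OF that]] A h g by (auto intro!: mult_op_measurable)
    then have mm2: "(\<lambda>x. ennreal ((cmod (m i x))\<^sup>2)) \<in> borel_measurable lborel" if "i < length ws" for i
      using that by measurable
    have "(\<integral>\<^sup>+ x. of_nat (2 ^ CARD('n)) * (\<Sum>i<length ws. ennreal ((cmod (m i x))\<^sup>2)) \<partial>lborel)
      = of_nat (2 ^ CARD('n)) * (\<integral>\<^sup>+ x. (\<Sum>i<length ws. ennreal ((cmod (m i x))\<^sup>2)) \<partial>lborel)"
      by (rule nn_integral_cmult) (intro borel_measurable_sum mm2, simp)
    also have "(\<integral>\<^sup>+ x. (\<Sum>i<length ws. ennreal ((cmod (m i x))\<^sup>2)) \<partial>lborel) = (\<Sum>i<length ws. sqnorm (m i))"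
      unfolding sqnorm_def by (rule nn_integral_sum) (intro mm2, simp)
    finally show ?thesis .
  qed
  also have "\<dots> \<le> of_nat (2 ^ CARD('n)) * (\<Sum>i<length ws. ennreal ((2 * pi) ^ (3 * CARD('n))) * A * sqnorm h * sqnorm g)"
    unfolding m_def by (intro mult_left_mono sum_mono sqnorm_mult_op_le fb A h g wl) auto
  also have "\<dots> = (of_nat (2 ^ CARD('n)) * of_nat (2 ^ CARD('n)) * ennreal ((2 * pi) ^ (3 * CARD('n)))) * A * sqnorm h * sqnorm g"
    by (simp add: lw mult_ac)
  also have "of_nat (2 ^ CARD('n)) * of_nat (2 ^ CARD('n)) * ennreal ((2 * pi) ^ (3 * CARD('n))) = ennreal (4 ^ CARD('n) * (2 * pi) ^ (3 * CARD('n)))"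
  proof -
    have "(4::real) ^ CARD('n) = 2 ^ CARD('n) * 2 ^ CARD('n)" by (simp flip: power_mult_distrib)
    then show ?thesis by (simp add: ennreal_mult ennreal_of_nat_eq_real_of_nat)
  qed
  also have "sqnorm h = (\<integral>\<^sup>+ u. ennreal ((cmod (f u))\<^sup>2 / weight (u - c)) \<partial>lborel)"
    unfolding sqnorm_def h_def r_def
    by (simp add: norm_mult norm_inverse power_mult_distrib power_inverse norm_shift_weight_sq[OF js] divide_inverse)
  finally show ?thesis .
qed

section \<open>The position variable\<close>

lemma word_deriv_affine:
  fixes L :: "'a::real_normed_vector \<Rightarrow> 'b::real_normed_vector"
  assumes L: "linear L"
  shows "word_deriv ds (\<lambda>x. F (a + L x)) = (\<lambda>x. word_deriv (map L ds) F (a + L x))"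
proof (induction ds)
  case (Cons d ds)
  have "dir_deriv d (\<lambda>x. G (a + L x)) x = dir_deriv (L d) G (a + L x)" for G :: "'b \<Rightarrow> complex" and x
    by (simp add: dir_deriv_def linear_add[OF L] linear_scale[OF L] add.assoc)
  then show ?case using Cons by auto
qed simp

lemma smooth_affine:
  fixes L :: "'a::euclidean_space \<Rightarrow> 'b::euclidean_space"
  assumes F: "smooth F" and L: "linear L" and B: "\<And>b. b \<in> Basis \<Longrightarrow> L b \<in> Basis"
  shows "smooth (\<lambda>x. F (a + L x))"
proof (rule smooth_coinduct[where Z="{(\<lambda>x. G (a + L x)) |G. smooth G}"])
  show "(\<lambda>x. F (a + L x)) \<in> {(\<lambda>x. G (a + L x)) |G. smooth G}" using F by auto
next
  fix f x assume "f \<in> {(\<lambda>x. G (a + L x)) |G. smooth G}"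
  then obtain G where f: "f = (\<lambda>x. G (a + L x))" and G: "smooth G" by auto
  have "(\<lambda>x. a + L x) differentiable (at x)"
    by (intro differentiable_add differentiable_const linear_imp_differentiable L)
  from differentiable_chain_at[OF this smooth_differentiable[OF G]]
  show "f differentiable (at x)" unfolding f by (simp add: o_def)
next
  fix f and b :: 'a assume "f \<in> {(\<lambda>x. G (a + L x)) |G. smooth G}" and b: "b \<in> Basis"
  then obtain G where f: "f = (\<lambda>x. G (a + L x))" and G: "smooth G" by auto
  have "dir_deriv b f = (\<lambda>x. dir_deriv (L b) G (a + L x))"
    using word_deriv_affine[OF L, of "[b]" G a] unfolding f by simp
  then show "dir_deriv b f \<in> {(\<lambda>x. G (a + L x)) |G. smooth G}"
    using smooth_dir_deriv[OF G B[OF b]] by auto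
qed

abbreviation y_dirs :: "'n::finite list \<Rightarrow> ((real^'n) \<times> (real^'n) \<times> (real^'n)) list" where
  "y_dirs w \<equiv> map (\<lambda>i. (axis i 1, 0)) w"

lemma y_dirs_Basis: "set (y_dirs w) \<subseteq> Basis"
  by (auto simp: Basis_prod_def axis_in_Basis_iff)

text \<open>The symbol differentiated in the position and then frozen there.\<close>

definition sym_slice :: "((real^'n::finite) \<times> (real^'n) \<times> (real^'n) \<Rightarrow> complex) \<Rightarrow> 'n list \<Rightarrow> real^'n \<Rightarrow> (real^'n) \<times> (real^'n) \<Rightarrow> complex" where
  "sym_slice S v y p = word_deriv (y_dirs v) S (y, p)"

lemma smooth_sym_slice: "smooth S \<Longrightarrow> smooth (sym_slice S v y)"
proof -
  assume "smooth S"
  then have "smooth (\<lambda>p. word_deriv (y_dirs v) S ((y, 0) + (0, p)))"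
    by (intro smooth_affine smooth_word_deriv y_dirs_Basis)
      (auto simp: linear_iff Basis_prod_def)
  then show ?thesis by (simp add: sym_slice_def[abs_def])
qed

definition short_words :: "'n::finite list set" where "short_words = {w. length w \<le> CARD('n) div 2 + 1}"

lemma finite_short_words: "finite (short_words :: 'n::finite list set)"
  unfolding short_words_def using finite_lists_length_le[of "UNIV::'n set" "CARD('n) div 2 + 1"] by simp

definition singularity_mass :: ennreal where
  "singularity_mass = (\<integral>\<^sup>+ (r::real). indicator {0<..1} r * ennreal (r powr (- 1 / 2)) \<partial>lborel)"

lemma singularity_mass_finite: "singularity_mass < \<infinity>"
proof -
  have "(\<lambda>r::real. r powr (- 1 / 2)) absolutely_integrable_on {0..1}"
    by (rule nonnegative_absolutely_integrable_1[OF integrable_on_powr_from_0]) auto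
  then have "integrable lborel (\<lambda>r::real. indicator {0..1} r *\<^sub>R r powr (- 1 / 2))"
    unfolding set_integrable_def by (subst (asm) integrable_completion) auto
  then have "(\<integral>\<^sup>+ (r::real). ennreal (norm (indicator {0..1} r *\<^sub>R r powr (- 1 / 2))) \<partial>lborel) < \<infinity>"
    by (simp add: integrable_iff_bounded)
  moreover have "singularity_mass \<le> (\<integral>\<^sup>+ (r::real). ennreal (norm (indicator {0..1} r *\<^sub>R r powr (- 1 / 2))) \<partial>lborel)"
    unfolding singularity_mass_def by (intro nn_integral_mono) (auto split: split_indicator)
  ultimately show ?thesis by (rule le_less_trans[rotated])
qed

lemma sum_sq_ennreal: "(a + b)\<^sup>2 \<le> 2 * a\<^sup>2 + 2 * (b::ennreal)\<^sup>2"
  using ennreal_sum_squares_le[of "{0::nat, 1}" "\<lambda>i. if i = 0 then a else b"] by (simp add: distrib_left)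

definition op_const :: "'n::finite itself \<Rightarrow> ennreal" where
  "op_const _ = (2 + 2 * singularity_mass\<^sup>2) * (ennreal (2 ^ CARD('n)) *
     (of_nat (card (short_words :: 'n list set)) * of_nat (card (short_words :: 'n list set))
       * ennreal (4 ^ CARD('n) * (2 * pi) ^ (3 * CARD('n))) * weight_mass TYPE('n)))"

lemma op_const_finite: "op_const TYPE('n::finite) < \<infinity>"
  unfolding op_const_def using singularity_mass_finite weight_mass_finite[where 'n='n]
  by (simp add: ennreal_mult_less_top power_less_top_ennreal of_nat_less_top)

text \<open>The hypothesis of the boundedness theorem in terms of words, with \<open>A\<close> in the role of the square of
  the constant of the symbol.\<close>

locale bounded_symbol =
  fixes S :: "(real^'n::finite) \<times> (real^'n) \<times> (real^'n) \<Rightarrow> complex" and A :: ennreal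
  assumes smooth_S: "smooth S" and A_finite: "A < \<infinity>"
    and fibre: "\<And>v w y. length v \<le> CARD('n) div 2 + 1 \<Longrightarrow> length w \<le> CARD('n) \<Longrightarrow>
      fibre_bound (word_deriv (xi_dirs w) (sym_slice S v y)) A"
begin

lemma fibre0: "length v \<le> CARD('n) div 2 + 1 \<Longrightarrow> fibre_bound (sym_slice S v y) A"
  using fibre[of v "[]" y] by simp

lemma mult_op_sym_slice_measurable:
  assumes f: "f \<in> schwartz" and g: "g \<in> schwartz"
  shows "(\<lambda>q. mult_op (sym_slice S v (fst q)) f g (snd q)) \<in> borel_measurable borel"
proof -
  have "continuous_on UNIV (\<lambda>q::((real^'n) \<times> (real^'n)) \<times> (real^'n) \<times> (real^'n). word_deriv (y_dirs v) S (fst (fst q), snd q))"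
    by (rule continuous_on_compose2[OF smooth_continuous[OF smooth_word_deriv[OF smooth_S y_dirs_Basis]]])
       (auto intro!: continuous_intros)
  then have m1: "(\<lambda>q. sym_slice S v (fst (fst q)) (snd q)) \<in> borel_measurable (borel :: (((real^'n) \<times> (real^'n)) \<times> (real^'n) \<times> (real^'n)) measure)"
    unfolding sym_slice_def by (rule borel_measurable_continuous_onI)
  have m2: "(\<lambda>q. fourier f (fst (snd q)) * fourier g (snd (snd q))) \<in> borel_measurable (borel :: (((real^'n) \<times> (real^'n)) \<times> (real^'n) \<times> (real^'n)) measure)"
    using measurable_comp_continuous[OF fourier_pair_measurable[OF schwartz_integrable[OF f] schwartz_integrable[OF g]] continuous_on_snd[OF continuous_on_id]] .
  have m3: "(\<lambda>q. cis (snd (fst q) \<bullet> (fst (snd q) + snd (snd q)))) \<in> borel_measurable (borel :: (((real^'n) \<times> (real^'n)) \<times> (real^'n) \<times> (real^'n)) measure)"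
    by (intro borel_measurable_continuous_onI continuous_intros)
  have "(\<lambda>(q, p). sym_slice S v (fst q) p * (fourier f (fst p) * fourier g (snd p) * cis (snd q \<bullet> (fst p + snd p)))) \<in> borel_measurable (borel :: (((real^'n) \<times> (real^'n)) \<times> (real^'n) \<times> (real^'n)) measure)"
    unfolding split_beta' by (rule borel_measurable_times[OF m1 borel_measurable_times[OF m2 m3]])
  then have "(\<lambda>(q, p). sym_slice S v (fst q) p * (fourier f (fst p) * fourier g (snd p) * cis (snd q \<bullet> (fst p + snd p)))) \<in> borel_measurable (lborel \<Otimes>\<^sub>M lborel)"
    by (simp only: measurable_lborel_pair)
  from lborel.borel_measurable_lebesgue_integral[OF this] show ?thesis
    unfolding mult_op_def by simp
qed

text \<open>Taylor expansion from \<open>x - u\<close> to \<open>x\<close> along the segment with direction \<open>u\<close>.\<close>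

definition taylor_term :: "real^'n \<Rightarrow> nat \<Rightarrow> real^'n \<Rightarrow> (real^'n) \<times> (real^'n) \<Rightarrow> complex" where
  "taylor_term u m z p = (\<Sum>w | length w = m. prod_list (map (\<lambda>i. u $ i) w) *\<^sub>R sym_slice S w z p)"

lemma finite_words_eq: "finite {w::'n list. length w = m}"
  using finite_lists_length_eq[of "UNIV::'n set" m] by simp

lemma continuous_taylor_term:
  "continuous_on UNIV (\<lambda>q. taylor_term u m (fst q) (snd q))"
  unfolding taylor_term_def sym_slice_def
  by (intro continuous_intros continuous_on_compose2[OF smooth_continuous[OF smooth_word_deriv[OF smooth_S y_dirs_Basis], of UNIV]]) auto

lemma taylor_segment:
  assumes k: "0 < k"
  shows "S (x, p) = (\<Sum>m<k. (1 / fact m) *\<^sub>R taylor_term u m (x - u) p)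
    + (LINT s|lborel. indicator {0..1} s *\<^sub>R (((1 - s) ^ (k - 1) / fact (k - 1)) *\<^sub>R taylor_term u k (x - u + s *\<^sub>R u) p))"
proof -
  define Df where "Df = (\<lambda>m s. taylor_term u m (x - u + s *\<^sub>R u) p)"
  have u: "(u, 0::(real^'n) \<times> (real^'n)) = (\<Sum>i\<in>UNIV. u $ i *\<^sub>R (axis i 1, 0))"
    by (simp add: prod_eq_iff fst_sum snd_sum basis_expansion[of u, unfolded scalar_mult_eq_scaleR])
  have Df: "(Df m has_vector_derivative Df (Suc m) t) (at t within {0..1})" for m t
  proof -
    have "((\<lambda>s. \<Sum>w | length w = m. prod_list (map (\<lambda>i. u $ i) w) *\<^sub>R word_deriv (y_dirs w) S ((x - u, p) + s *\<^sub>R (u, 0))) has_vector_derivative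
     (\<Sum>w | length w = Suc m. prod_list (map (\<lambda>i. u $ i) w) *\<^sub>R word_deriv (y_dirs w) S ((x - u, p) + t *\<^sub>R (u, 0)))) (at t)"
      by (rule has_vector_derivative_word_derivs_line[OF smooth_S _ _ u])
        (auto simp: Basis_prod_def axis_in_Basis_iff inj_def axis_eq_axis)
    from has_vector_derivative_at_within[OF this, of "{0..1}"] show ?thesis
      unfolding Df_def taylor_term_def sym_slice_def by simp
  qed
  define i where "i = (\<lambda>s. ((1 - s) ^ (k - 1) / fact (k - 1)) *\<^sub>R Df k s)"
  have "(i has_integral Df 0 1 - (\<Sum>m<k. ((1 - 0) ^ m / fact m) *\<^sub>R Df m 0)) {0..1}"
    unfolding i_def
    by (rule Taylor_has_integral[where Df=Df and p=k and a=0 and b=1 and f="Df 0", OF k refl Df zero_le_one])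
  then have I: "integral {0..1} i = Df 0 1 - (\<Sum>m<k. (1 / fact m) *\<^sub>R Df m 0)"
    by (simp add: integral_unique)
  have ci: "continuous_on {0..1} i"
    unfolding i_def Df_def
    by (intro continuous_intros continuous_on_compose2[OF continuous_taylor_term[of u k], where f="\<lambda>s. (x - u + s *\<^sub>R u, p)", simplified]) auto
  have "integral {0..1} i = (LINT s:{0..1}|lborel. i s)"
    by (rule set_borel_integral_eq_integral(2)[symmetric]) (rule borel_integrable_atLeastAtMost'[OF ci])
  moreover have "Df 0 1 = S (x, p)"
    unfolding Df_def taylor_term_def sym_slice_def by simp
  ultimately show ?thesis
    using I unfolding set_lebesgue_integral_def i_def Df_def by (simp add: algebra_simps)
qed

definition majorant :: "(real^'n \<Rightarrow> complex) \<Rightarrow> (real^'n \<Rightarrow> complex) \<Rightarrow> real^'n \<Rightarrow> real^'n \<Rightarrow> ennreal" where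
  "majorant f g y x = (\<Sum>w\<in>short_words. ennreal (cmod (mult_op (sym_slice S w y) f g x)))"

lemma majorant_measurable:
  assumes "f \<in> schwartz" "g \<in> schwartz"
  shows "(\<lambda>q. majorant f g (fst q) (snd q)) \<in> borel_measurable borel"
  unfolding majorant_def
proof (rule borel_measurable_sum)
  fix w :: "'n list"
  note [measurable] = mult_op_sym_slice_measurable[OF assms, of w]
  show "(\<lambda>q. ennreal (cmod (mult_op (sym_slice S w (fst q)) f g (snd q)))) \<in> borel_measurable borel"
    by measurable
qed

text \<open>A Sobolev inequality along one segment.  The Taylor formula is applied to the symbol for fixed
  frequencies, so no derivative of the operator in the position variable is needed.\<close>

lemma mult_op_segment_bound:
  assumes f: "f \<in> schwartz" and g: "g \<in> schwartz" and u: "u \<in> cbox 0 (1::real^'n)"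
  shows "ennreal (cmod (mult_op (\<lambda>p. S (x, p)) f g x))
    \<le> majorant f g (x - u) x + (\<integral>\<^sup>+ s. indicator {0..1} s * ennreal ((1 - s) ^ (CARD('n) div 2)) * majorant f g (x - u + s *\<^sub>R u) x \<partial>lborel)"
proof -
  define k where "k = CARD('n) div 2 + 1"
  define E where "E = (\<lambda>p. fourier f (fst p) * fourier g (snd p) * cis (x \<bullet> (fst p + snd p)))"
  define Q where "Q = (\<lambda>m z p. taylor_term u m z p * E p)"
  have Em: "E \<in> borel_measurable borel"
    unfolding E_def
    by (intro borel_measurable_times[OF fourier_pair_measurable[OF schwartz_integrable[OF f] schwartz_integrable[OF g]]]
        borel_measurable_continuous_onI continuous_intros)
  have op: "mult_op \<tau> f g x = (LINT p|lborel. \<tau> p * E p)" for \<tau>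
    by (simp add: mult_op_def E_def)
  have coef: "\<bar>prod_list (map (\<lambda>i. u $ i) w)\<bar> \<le> 1" for w
  proof (induction w)
    case (Cons i w)
    have "\<bar>u $ i\<bar> \<le> 1" using u by (auto simp: mem_box_cart)
    then show ?case using Cons by (simp add: abs_mult mult_le_one)
  qed simp
  have si: "integrable lborel (\<lambda>p. sym_slice S w z p * E p)" if "length w \<le> k" for w z
    unfolding E_def using mult_op_integrable[OF fibre0 A_finite f g] that by (simp add: k_def)
  have Qeq: "Q m z p = (\<Sum>w | length w = m. prod_list (map (\<lambda>i. u $ i) w) *\<^sub>R (sym_slice S w z p * E p))" for m z p
    unfolding Q_def taylor_term_def by (simp add: sum_distrib_right)
  have Qi: "integrable lborel (Q m z)" if "m \<le> k" for m z
    unfolding Qeq[abs_def] using that by (intro Bochner_Integration.integrable_sum integrable_scaleR_right si) auto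
  have Qint: "integral\<^sup>L lborel (Q m z) = (\<Sum>w | length w = m. prod_list (map (\<lambda>i. u $ i) w) *\<^sub>R mult_op (sym_slice S w z) f g x)"
    if "m \<le> k" for m z
    unfolding Qeq[abs_def] op using that
    by (subst Bochner_Integration.integral_sum) (auto intro!: integrable_scaleR_right si)
  have Qn: "cmod (integral\<^sup>L lborel (Q m z)) \<le> (\<Sum>w | length w = m. cmod (mult_op (sym_slice S w z) f g x))" if "m \<le> k" for m z
    unfolding Qint[OF that] by (rule order_trans[OF norm_sum]) (auto intro!: sum_mono mult_left_le_one_le coef)
  have majorant_le: "ennreal (\<Sum>w\<in>X. cmod (mult_op (sym_slice S w z) f g x)) \<le> majorant f g z x" if "X \<subseteq> short_words" for X z
  proof -
    have "ennreal (\<Sum>w\<in>X. cmod (mult_op (sym_slice S w z) f g x)) = (\<Sum>w\<in>X. ennreal (cmod (mult_op (sym_slice S w z) f g x)))"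
      by (simp add: sum_ennreal)
    also have "\<dots> \<le> majorant f g z x"
      unfolding majorant_def by (rule sum_mono2[OF finite_short_words that]) simp
    finally show ?thesis .
  qed
  define \<rho> where "\<rho> = (\<lambda>p s. indicator {0..1} s *\<^sub>R (((1 - s) ^ (k - 1) / fact (k - 1)) *\<^sub>R Q k (x - u + s *\<^sub>R u) p))"
  have \<rho>m: "(\<lambda>q. \<rho> (fst q) (snd q)) \<in> borel_measurable borel"
  proof -
    have 1: "(\<lambda>q::((real^'n) \<times> (real^'n)) \<times> real. indicator {0..1} (snd q) :: real) \<in> borel_measurable borel"
      unfolding borel_prod[symmetric] by measurable
    have 2: "(\<lambda>q::((real^'n) \<times> (real^'n)) \<times> real. (1 - snd q) ^ (k - 1) / fact (k - 1) :: real) \<in> borel_measurable borel"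
      by (intro borel_measurable_continuous_onI continuous_intros) auto
    have 3: "(\<lambda>q::((real^'n) \<times> (real^'n)) \<times> real. taylor_term u k (x - u + snd q *\<^sub>R u) (fst q)) \<in> borel_measurable borel"
      by (intro borel_measurable_continuous_onI continuous_on_compose2[OF continuous_taylor_term[of u k], where f="\<lambda>q. (x - u + snd q *\<^sub>R u, fst q)", simplified])
         (auto intro!: continuous_intros)
    have 4: "(\<lambda>q::((real^'n) \<times> (real^'n)) \<times> real. E (fst q)) \<in> borel_measurable borel"
      by (rule measurable_comp_continuous[OF Em]) (intro continuous_intros)
    show ?thesis unfolding \<rho>_def Q_def
      by (rule borel_measurable_scaleR[OF 1 borel_measurable_scaleR[OF 2 borel_measurable_times[OF 3 4]]])
  qed
  define M where "M = of_nat (card {w::'n list. length w = k}) * (A * weight_mass TYPE('n) + freq_mass f g)"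
  have "(\<integral>\<^sup>+ p. \<integral>\<^sup>+ s. ennreal (norm (\<rho> p s)) \<partial>lborel \<partial>lborel) = (\<integral>\<^sup>+ s. \<integral>\<^sup>+ p. ennreal (norm (\<rho> p s)) \<partial>lborel \<partial>lborel)"
    using \<rho>m by (subst Tonelli_lborel(1), simp, subst Tonelli_lborel(2)) auto
  also have "\<dots> \<le> (\<integral>\<^sup>+ s. M * indicator {0..1} s \<partial>(lborel :: real measure))"
  proof (rule nn_integral_mono)
    fix s :: real
    show "(\<integral>\<^sup>+ p. ennreal (norm (\<rho> p s)) \<partial>lborel) \<le> M * indicator {0..1} s"
    proof (cases "s \<in> {0..1}")
      case True
      define z where "z = x - u + s *\<^sub>R u"
      have "norm (\<rho> p s) \<le> (\<Sum>w | length w = k. cmod (sym_slice S w z p * E p))" for p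
      proof -
        have "norm (\<rho> p s) = \<bar>(1 - s) ^ (k - 1) / fact (k - 1)\<bar> * cmod (Q k z p)"
          unfolding \<rho>_def z_def using True by simp
        also have "\<dots> \<le> 1 * cmod (Q k z p)"
        proof (rule mult_right_mono)
          have "(1 - s) ^ (k - 1) \<le> 1" using True by (intro power_le_one) auto
          also have "(1::real) \<le> fact (k - 1)" by (rule fact_ge_1)
          finally show "\<bar>(1 - s) ^ (k - 1) / fact (k - 1)\<bar> \<le> 1"
            using True by (simp add: divide_le_eq)
        qed simp
        also have "cmod (Q k z p) \<le> (\<Sum>w | length w = k. cmod (sym_slice S w z p * E p))"
          unfolding Qeq by (rule order_trans[OF norm_sum]) (auto intro!: sum_mono mult_left_le_one_le coef simp del: norm_mult)
        finally show ?thesis by simp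
      qed
      then have "(\<integral>\<^sup>+ p. ennreal (norm (\<rho> p s)) \<partial>lborel) \<le> (\<integral>\<^sup>+ p. (\<Sum>w | length w = k. ennreal (cmod (sym_slice S w z p * E p))) \<partial>lborel)"
        by (intro nn_integral_mono) (simp add: sum_ennreal ennreal_leI del: norm_mult)
      also have "\<dots> = (\<Sum>w | length w = k. (\<integral>\<^sup>+ p. ennreal (cmod (sym_slice S w z p * E p)) \<partial>lborel))"
      proof (rule nn_integral_sum)
        fix w :: "'n list" assume "w \<in> {w. length w = k}"
        then have "integrable lborel (\<lambda>p. sym_slice S w z p * E p)" by (intro si) simp
        from borel_measurable_integrable[OF this]
        show "(\<lambda>p. ennreal (cmod (sym_slice S w z p * E p))) \<in> borel_measurable lborel" by measurable
      qed
      also have "\<dots> \<le> (\<Sum>w | length (w::'n list) = k. A * weight_mass TYPE('n) + freq_mass f g)"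
      proof (rule sum_mono)
        fix w :: "'n list" assume "w \<in> {w. length w = k}"
        then have "fibre_bound (sym_slice S w z) A" by (intro fibre0) (simp add: k_def)
        from mult_op_integrand_bound[OF this f g, of x]
        show "(\<integral>\<^sup>+ p. ennreal (cmod (sym_slice S w z p * E p)) \<partial>lborel) \<le> A * weight_mass TYPE('n) + freq_mass f g"
          by (simp add: E_def)
      qed
      finally show ?thesis using True by (simp add: M_def)
    qed (simp add: \<rho>_def)
  qed
  also have "\<dots> = M" by (simp add: nn_integral_cmult)
  also have "M < \<infinity>"
    unfolding M_def using A_finite weight_mass_finite[where 'n='n] freq_mass_finite[OF f g]
    by (simp add: ennreal_mult_less_top of_nat_less_top)
  finally have fin: "(\<integral>\<^sup>+ p. \<integral>\<^sup>+ s. ennreal (norm (\<rho> p s)) \<partial>lborel \<partial>lborel) < \<infinity>" .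
  have "S (x, p) * E p = (\<Sum>m<k. (1 / fact m) *\<^sub>R Q m (x - u) p) + (LINT s|lborel. \<rho> p s)" for p
  proof -
    have "0 < k" by (simp add: k_def)
    from taylor_segment[OF this, of x p u]
    have "S (x, p) * E p = (\<Sum>m<k. (1 / fact m) *\<^sub>R taylor_term u m (x - u) p) * E p
       + (LINT s|lborel. indicator {0..1} s *\<^sub>R (((1 - s) ^ (k - 1) / fact (k - 1)) *\<^sub>R taylor_term u k (x - u + s *\<^sub>R u) p)) * E p"
      by (simp add: distrib_right)
    also have "(LINT s|lborel. indicator {0..1} s *\<^sub>R (((1 - s) ^ (k - 1) / fact (k - 1)) *\<^sub>R taylor_term u k (x - u + s *\<^sub>R u) p)) * E p
       = (LINT s|lborel. \<rho> p s)"
      unfolding \<rho>_def Q_def by (subst integral_mult_left_zero[symmetric]) simp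
    finally show ?thesis unfolding Q_def by (simp add: sum_distrib_right)
  qed
  then have "mult_op (\<lambda>p. S (x, p)) f g x = (LINT p|lborel. (\<Sum>m<k. (1 / fact m) *\<^sub>R Q m (x - u) p) + (LINT s|lborel. \<rho> p s))"
    unfolding op by simp
  also have "\<dots> = (LINT p|lborel. (\<Sum>m<k. (1 / fact m) *\<^sub>R Q m (x - u) p)) + (LINT p|lborel. LINT s|lborel. \<rho> p s)"
    by (rule Bochner_Integration.integral_add[OF _ Fubini_lborel(4)[OF \<rho>m fin]]) (auto intro!: Qi Bochner_Integration.integrable_sum integrable_scaleR_right)
  also have "(LINT p|lborel. LINT s|lborel. \<rho> p s) = (LINT s|lborel. LINT p|lborel. \<rho> p s)"
    using Fubini_lborel(2,3)[OF \<rho>m fin] by simp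
  also have "(LINT p|lborel. (\<Sum>m<k. (1 / fact m) *\<^sub>R Q m (x - u) p)) = (\<Sum>m<k. (1 / fact m) *\<^sub>R integral\<^sup>L lborel (Q m (x - u)))"
    by (subst Bochner_Integration.integral_sum) (auto intro!: Qi integrable_scaleR_right)
  finally have eq: "mult_op (\<lambda>p. S (x, p)) f g x = (\<Sum>m<k. (1 / fact m) *\<^sub>R integral\<^sup>L lborel (Q m (x - u))) + (LINT s|lborel. LINT p|lborel. \<rho> p s)" .
  have "cmod (\<Sum>m<k. (1 / fact m) *\<^sub>R integral\<^sup>L lborel (Q m (x - u))) \<le> (\<Sum>m<k. \<Sum>w | length w = m. cmod (mult_op (sym_slice S w (x - u)) f g x))"
  proof (rule order_trans[OF norm_sum], rule sum_mono)
    fix m assume m: "m \<in> {..<k}"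
    have "norm ((1 / fact m) *\<^sub>R integral\<^sup>L lborel (Q m (x - u))) \<le> 1 * cmod (integral\<^sup>L lborel (Q m (x - u)))"
      unfolding norm_scaleR by (rule mult_right_mono) (simp_all add: fact_ge_1)
    also have "\<dots> \<le> (\<Sum>w | length w = m. cmod (mult_op (sym_slice S w (x - u)) f g x))"
      using Qn[of m "x - u"] m by simp
    finally show "norm ((1 / fact m) *\<^sub>R integral\<^sup>L lborel (Q m (x - u))) \<le> (\<Sum>w | length w = m. cmod (mult_op (sym_slice S w (x - u)) f g x))" .
  qed
  also have "\<dots> = (\<Sum>w\<in>(\<Union>m<k. {w. length w = m}). cmod (mult_op (sym_slice S w (x - u)) f g x))"
    by (rule sum.UNION_disjoint[symmetric]) (auto simp: finite_words_eq)
  finally have le: "cmod (\<Sum>m<k. (1 / fact m) *\<^sub>R integral\<^sup>L lborel (Q m (x - u)))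
      \<le> (\<Sum>w\<in>(\<Union>m<k. {w. length w = m}). cmod (mult_op (sym_slice S w (x - u)) f g x))" .
  have sub: "(\<Union>m<k. {w::'n list. length w = m}) \<subseteq> short_words" by (auto simp: short_words_def k_def)
  have 1: "ennreal (cmod (\<Sum>m<k. (1 / fact m) *\<^sub>R integral\<^sup>L lborel (Q m (x - u)))) \<le> majorant f g (x - u) x"
    by (rule order_trans[OF ennreal_leI[OF le] majorant_le[OF sub]])
  have 2: "ennreal (cmod (LINT s|lborel. LINT p|lborel. \<rho> p s))
     \<le> (\<integral>\<^sup>+ s. indicator {0..1} s * ennreal ((1 - s) ^ (k - 1)) * majorant f g (x - u + s *\<^sub>R u) x \<partial>lborel)"
  proof (rule order_trans[OF ennreal_norm_integral_le], rule nn_integral_mono)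
    fix s :: real
    show "ennreal (norm (LINT p|lborel. \<rho> p s)) \<le> indicator {0..1} s * ennreal ((1 - s) ^ (k - 1)) * majorant f g (x - u + s *\<^sub>R u) x"
    proof (cases "s \<in> {0..1}")
      case True
      define z where "z = x - u + s *\<^sub>R u"
      have nn: "0 \<le> (1 - s) ^ (k - 1)" using True by simp
      have "(LINT p|lborel. \<rho> p s) = ((1 - s) ^ (k - 1) / fact (k - 1)) *\<^sub>R integral\<^sup>L lborel (Q k z)"
        unfolding \<rho>_def z_def using True by simp
      then have "norm (LINT p|lborel. \<rho> p s) = \<bar>(1 - s) ^ (k - 1) / fact (k - 1)\<bar> * cmod (integral\<^sup>L lborel (Q k z))" by simp
      also have "\<dots> \<le> (1 - s) ^ (k - 1) * (\<Sum>w | length w = k. cmod (mult_op (sym_slice S w z) f g x))"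
      proof (rule mult_mono)
        show "\<bar>(1 - s) ^ (k - 1) / fact (k - 1)\<bar> \<le> (1 - s) ^ (k - 1)"
          using divide_left_mono[OF fact_ge_1[of "k - 1", where 'a=real] nn] nn
          unfolding abs_of_nonneg[OF divide_nonneg_nonneg[OF nn fact_ge_zero]] by simp
      qed (use Qn nn in auto)
      finally have "ennreal (norm (LINT p|lborel. \<rho> p s)) \<le> ennreal ((1 - s) ^ (k - 1)) * ennreal (\<Sum>w | length w = k. cmod (mult_op (sym_slice S w z) f g x))"
        using nn by (simp add: ennreal_mult'[symmetric] ennreal_leI)
      also have "\<dots> \<le> ennreal ((1 - s) ^ (k - 1)) * majorant f g z x"
        by (intro mult_left_mono majorant_le) (auto simp: short_words_def k_def)
      finally show ?thesis using True by (simp add: z_def)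
    qed (simp add: \<rho>_def)
  qed
  have 3: "ennreal (cmod (mult_op (\<lambda>p. S (x, p)) f g x))
     \<le> ennreal (cmod (\<Sum>m<k. (1 / fact m) *\<^sub>R integral\<^sup>L lborel (Q m (x - u)))) + ennreal (cmod (LINT s|lborel. LINT p|lborel. \<rho> p s))"
    unfolding eq by (simp add: ennreal_plus[symmetric] ennreal_leI norm_triangle_ineq del: ennreal_plus)
  have k1: "k - 1 = CARD('n) div 2" by (simp add: k_def)
  show ?thesis by (rule order_trans[OF 3 add_mono[OF 1 2[unfolded k1]]])
qed


text \<open>Averaging the segment bound over \<open>u\<close> in the unit cube.  The scaling \<open>v = r u\<close> costs \<open>r\<^sup>-\<^sup>n\<close>, and
  a Taylor expansion of order \<open>[n/2] + 1\<close> then leaves at worst the integrable singularity \<open>r\<^sup>-\<^sup>1\<^sup>/\<^sup>2\<close>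
  at the origin.\<close>

lemma mult_op_local_bound:
  assumes f: "f \<in> schwartz" and g: "g \<in> schwartz"
  shows "ennreal ((cmod (mult_op (\<lambda>p. S (x, p)) f g x))\<^sup>2)
    \<le> (2 + 2 * singularity_mass\<^sup>2) * (\<integral>\<^sup>+ u. indicator (cbox 0 1) u * (majorant f g (x - u) x)\<^sup>2 \<partial>lborel)"
proof -
  define q where "q = CARD('n) div 2"
  define T where "T = ennreal (cmod (mult_op (\<lambda>p. S (x, p)) f g x))"
  define \<Theta> where "\<Theta> = (\<lambda>y. majorant f g y x)"
  define V where "V = (cbox 0 1 :: (real^'n) set)"
  define B where "B = (\<integral>\<^sup>+ u. indicator V u * (\<Theta> (x - u))\<^sup>2 \<partial>lborel)"
  define rho where "rho = (\<lambda>r::real. indicator {0<..1} r * ennreal (r powr (- 1 / 2)))"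
  have \<Theta>m [measurable]: "\<Theta> \<in> borel_measurable borel"
    unfolding \<Theta>_def using measurable_comp_continuous[OF majorant_measurable[OF f g], of "\<lambda>y. (y, x)"]
    by (simp add: continuous_intros)
  have Vm [measurable]: "V \<in> sets borel" unfolding V_def by simp
  have rhom [measurable]: "rho \<in> borel_measurable borel" unfolding rho_def by measurable
  have massV: "(\<integral>\<^sup>+ u. indicator V u \<partial>lborel) = 1"
  proof -
    have "(\<integral>\<^sup>+ u. indicator V u \<partial>lborel) = emeasure lborel V" by (rule nn_integral_indicator) simp
    also have "\<dots> = (\<Prod>b\<in>Basis. (1 - 0 :: real^'n) \<bullet> b)"
      unfolding V_def by (rule emeasure_lborel_cbox) (auto simp: Basis_vec_def inner_axis)
    also have "\<dots> = 1" by (simp add: Basis_vec_def inner_axis prod.neutral)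
    finally show ?thesis .
  qed
  have seg: "T \<le> \<Theta> (x - u) + (\<integral>\<^sup>+ r. indicator {0<..1} r * ennreal (r ^ q) * \<Theta> (x - r *\<^sub>R u) \<partial>lborel)" if "u \<in> V" for u
  proof -
    \<comment> \<open>the substitution \<open>r = 1 - s\<close> moves the singular end of the segment to the origin\<close>
    define h where "h = (\<lambda>s. indicator {0..1} s * ennreal ((1 - s) ^ q) * \<Theta> (x - u + s *\<^sub>R u))"
    have hm: "h \<in> borel_measurable borel" unfolding h_def by measurable
    have "(\<integral>\<^sup>+ s. h s \<partial>lborel) = (\<integral>\<^sup>+ r. h (1 + - r) \<partial>lborel)"
      using nn_integral_translate[OF hm, of 1] nn_integral_reflect[of "\<lambda>t. h (1 + t)"] hm by simp
    also have "\<dots> = (\<integral>\<^sup>+ r. indicator {0<..1} r * ennreal (r ^ q) * \<Theta> (x - r *\<^sub>R u) \<partial>lborel)"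
    proof (rule nn_integral_cong_AE)
      show "AE r in lborel. h (1 + - r) = indicator {0<..1} r * ennreal (r ^ q) * \<Theta> (x - r *\<^sub>R u)"
        using AE_lborel_singleton[of 0]
      proof eventually_elim
        fix r :: real assume "r \<noteq> 0"
        then show "h (1 + - r) = indicator {0<..1} r * ennreal (r ^ q) * \<Theta> (x - r *\<^sub>R u)"
          unfolding h_def by (auto simp: algebra_simps split: split_indicator)
      qed
    qed
    finally show ?thesis
      using mult_op_segment_bound[OF f g, of u x] that unfolding T_def \<Theta>_def V_def q_def h_def by simp
  qed
  have cs: "(\<integral>\<^sup>+ r. indicator {0<..1} r * ennreal (r ^ q) * \<Theta> (x - r *\<^sub>R u) \<partial>lborel)\<^sup>2
     \<le> singularity_mass * (\<integral>\<^sup>+ r. rho r * (ennreal (r ^ CARD('n)) * (\<Theta> (x - r *\<^sub>R u))\<^sup>2) \<partial>lborel)" for u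
  proof -
    \<comment> \<open>Cauchy-Schwarz with \<open>r\<^sup>q = r\<^sup>-\<^sup>1\<^sup>/\<^sup>4 (r\<^sup>1\<^sup>/\<^sup>4 r\<^sup>q)\<close>; the squares are \<open>r\<^sup>-\<^sup>1\<^sup>/\<^sup>2\<close> and at most \<open>r\<^sup>-\<^sup>1\<^sup>/\<^sup>2 r\<^sup>n\<close>, since \<open>2q + 1 \<ge> n\<close>\<close>
    define F where "F = (\<lambda>r::real. indicator {0<..1} r * ennreal (r powr (- 1 / 4)))"
    define G where "G = (\<lambda>r. indicator {0<..1} r * ennreal (r powr (1 / 4) * r ^ q) * \<Theta> (x - r *\<^sub>R u))"
    have [measurable]: "F \<in> borel_measurable lborel" "G \<in> borel_measurable lborel"
      unfolding F_def G_def by measurable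
    have FG: "indicator {0<..1} r * ennreal (r ^ q) * \<Theta> (x - r *\<^sub>R u) = F r * G r" for r
    proof (cases "r \<in> {0<..1}")
      case True
      have "r powr (- 1 / 4) * (r powr (1 / 4) * r ^ q) = r ^ q"
        using True by (simp add: mult.assoc[symmetric] powr_add[symmetric])
      then show ?thesis unfolding F_def G_def using True
        by (simp add: mult.assoc[symmetric] ennreal_mult'[symmetric])
    qed (simp add: F_def G_def)
    have F2: "(F r)\<^sup>2 = rho r" for r
    proof (cases "r \<in> {0<..1}")
      case True
      have "(r powr (- 1 / 4))\<^sup>2 = r powr (- 1 / 2)"
        using True by (simp add: power2_eq_square powr_add[symmetric])
      then show ?thesis unfolding F_def rho_def using True by (simp add: ennreal_power)
    qed (simp add: F_def rho_def)
    have G2: "(G r)\<^sup>2 \<le> rho r * (ennreal (r ^ CARD('n)) * (\<Theta> (x - r *\<^sub>R u))\<^sup>2)" for r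
    proof (cases "r \<in> {0<..1}")
      case True
      have e: "r powr (1 / 2) = r * r powr (- 1 / 2)"
        using True powr_add[of r 1 "- 1 / 2"] by simp
      have "(r powr (1 / 4) * r ^ q)\<^sup>2 = r powr (1 / 2) * r ^ (2 * q)"
      proof -
        have "(r powr (1 / 4))\<^sup>2 = r powr (1 / 2)"
          using True by (simp add: power2_eq_square powr_add[symmetric])
        then show ?thesis by (simp add: power_mult_distrib power_mult[symmetric] mult.commute[of q])
      qed
      also have "\<dots> = r powr (- 1 / 2) * r ^ (2 * q + 1)" unfolding e by simp
      also have "\<dots> \<le> r powr (- 1 / 2) * r ^ CARD('n)"
        using True by (intro mult_left_mono power_decreasing) (auto simp: q_def)
      finally have "ennreal ((r powr (1 / 4) * r ^ q)\<^sup>2) \<le> ennreal (r powr (- 1 / 2) * r ^ CARD('n))"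
        by (rule ennreal_leI)
      then have "ennreal ((r powr (1 / 4) * r ^ q)\<^sup>2) * (\<Theta> (x - r *\<^sub>R u))\<^sup>2 \<le> ennreal (r powr (- 1 / 2) * r ^ CARD('n)) * (\<Theta> (x - r *\<^sub>R u))\<^sup>2"
        by (rule mult_right_mono) simp
      moreover have "(ennreal (r powr (1 / 4) * r ^ q))\<^sup>2 = ennreal ((r powr (1 / 4) * r ^ q)\<^sup>2)"
        using True by (intro ennreal_power) simp
      moreover have "ennreal (r powr (- 1 / 2) * r ^ CARD('n)) = ennreal (r powr (- 1 / 2)) * ennreal (r ^ CARD('n))"
        using True by (intro ennreal_mult) auto
      ultimately show ?thesis unfolding G_def rho_def using True by (simp only: power_mult_distrib) (simp add: mult.assoc)
    qed (simp add: G_def)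
    have "(\<integral>\<^sup>+ r. F r * G r \<partial>lborel)\<^sup>2 \<le> (\<integral>\<^sup>+ r. (F r)\<^sup>2 \<partial>lborel) * (\<integral>\<^sup>+ r. (G r)\<^sup>2 \<partial>lborel)"
      by (rule Cauchy_Schwarz_nn_integral) measurable
    also have "\<dots> \<le> singularity_mass * (\<integral>\<^sup>+ r. rho r * (ennreal (r ^ CARD('n)) * (\<Theta> (x - r *\<^sub>R u))\<^sup>2) \<partial>lborel)"
      unfolding F2 using G2 by (intro mult_mono nn_integral_mono) (auto simp: singularity_mass_def rho_def)
    finally show ?thesis unfolding FG .
  qed
  have scale: "ennreal (r ^ CARD('n)) * (\<integral>\<^sup>+ u. indicator V u * (\<Theta> (x - r *\<^sub>R u))\<^sup>2 \<partial>lborel) \<le> B" if r: "r \<in> {0<..1}" for r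
  proof -
    define F where "F = (\<lambda>v. indicator V (inverse r *\<^sub>R v) * (\<Theta> (x - v))\<^sup>2)"
    have Fm: "F \<in> borel_measurable borel" unfolding F_def by measurable
    have "ennreal (r ^ CARD('n)) * (\<integral>\<^sup>+ u. indicator V u * (\<Theta> (x - r *\<^sub>R u))\<^sup>2 \<partial>lborel) = (\<integral>\<^sup>+ v. F v \<partial>lborel)"
      using nn_integral_scale[OF Fm, of r] r by (simp add: F_def)
    also have "\<dots> \<le> B" unfolding B_def
    proof (rule nn_integral_mono)
      fix v
      \<comment> \<open>the cube has a vertex at the origin, so it contains its contractions\<close>
      have "v \<in> V" if "inverse r *\<^sub>R v \<in> V"
      proof -
        have "0 \<le> v $ i \<and> v $ i \<le> 1" for i
        proof -
          have "0 \<le> inverse r * v $ i" "inverse r * v $ i \<le> 1" using that by (auto simp: V_def mem_box_cart)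
          then have "0 \<le> v $ i" "v $ i \<le> r" using r by (auto simp: field_simps zero_le_divide_iff)
          then show ?thesis using r by auto
        qed
        then show ?thesis by (simp add: V_def mem_box_cart)
      qed
      then show "F v \<le> indicator V v * (\<Theta> (x - v))\<^sup>2"
        unfolding F_def by (auto split: split_indicator)
    qed
    finally show ?thesis .
  qed
  define H where "H = (\<lambda>u r. indicator V u * (rho r * (ennreal (r ^ CARD('n)) * (\<Theta> (x - r *\<^sub>R u))\<^sup>2)))"
  have Hm: "(\<lambda>p. H (fst p) (snd p)) \<in> borel_measurable borel"
  proof -
    have "(\<lambda>p::(real^'n) \<times> real. \<Theta> (x - snd p *\<^sub>R fst p)) \<in> borel_measurable (borel \<Otimes>\<^sub>M borel)"
      unfolding borel_prod by (rule measurable_comp_continuous[OF \<Theta>m]) (intro continuous_intros)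
    then show ?thesis unfolding H_def borel_prod[symmetric] by measurable
  qed
  have Hu: "(\<integral>\<^sup>+ r. H u r \<partial>lborel) = indicator V u * (\<integral>\<^sup>+ r. rho r * (ennreal (r ^ CARD('n)) * (\<Theta> (x - r *\<^sub>R u))\<^sup>2) \<partial>lborel)" for u
    unfolding H_def by (rule nn_integral_cmult) measurable
  have "T\<^sup>2 = (\<integral>\<^sup>+ u. indicator V u * T\<^sup>2 \<partial>lborel)"
    by (simp add: nn_integral_multc massV)
  also have "\<dots> \<le> (\<integral>\<^sup>+ u. 2 * (indicator V u * (\<Theta> (x - u))\<^sup>2) + 2 * singularity_mass * (\<integral>\<^sup>+ r. H u r \<partial>lborel) \<partial>lborel)"
  proof (rule nn_integral_mono)
    fix u
    show "indicator V u * T\<^sup>2 \<le> 2 * (indicator V u * (\<Theta> (x - u))\<^sup>2) + 2 * singularity_mass * (\<integral>\<^sup>+ r. H u r \<partial>lborel)"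
    proof (cases "u \<in> V")
      case True
      have "T\<^sup>2 \<le> (\<Theta> (x - u) + (\<integral>\<^sup>+ r. indicator {0<..1} r * ennreal (r ^ q) * \<Theta> (x - r *\<^sub>R u) \<partial>lborel))\<^sup>2"
        by (rule power_mono[OF seg[OF True]]) simp
      also have "\<dots> \<le> 2 * (\<Theta> (x - u))\<^sup>2 + 2 * (\<integral>\<^sup>+ r. indicator {0<..1} r * ennreal (r ^ q) * \<Theta> (x - r *\<^sub>R u) \<partial>lborel)\<^sup>2"
        by (rule sum_sq_ennreal)
      also have "\<dots> \<le> 2 * (\<Theta> (x - u))\<^sup>2 + 2 * (singularity_mass * (\<integral>\<^sup>+ r. rho r * (ennreal (r ^ CARD('n)) * (\<Theta> (x - r *\<^sub>R u))\<^sup>2) \<partial>lborel))"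
        by (intro add_left_mono mult_left_mono cs) simp
      finally show ?thesis unfolding Hu using True by (simp add: mult.assoc)
    qed simp
  qed
  also have "\<dots> = 2 * B + 2 * singularity_mass * (\<integral>\<^sup>+ u. \<integral>\<^sup>+ r. H u r \<partial>lborel \<partial>lborel)"
  proof -
    have "(\<lambda>(u, r). H u r) \<in> borel_measurable (lborel \<Otimes>\<^sub>M lborel)"
      using Hm by (simp add: split_beta' lborel_prod)
    then have [measurable]: "(\<lambda>u. \<integral>\<^sup>+ r. H u r \<partial>lborel) \<in> borel_measurable lborel"
      by (rule lborel.borel_measurable_nn_integral)
    show ?thesis unfolding B_def
      by (simp add: nn_integral_add nn_integral_cmult)
  qed
  also have "(\<integral>\<^sup>+ u. \<integral>\<^sup>+ r. H u r \<partial>lborel \<partial>lborel) = (\<integral>\<^sup>+ r. \<integral>\<^sup>+ u. H u r \<partial>lborel \<partial>lborel)"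
    using Tonelli_lborel[OF Hm] by simp
  also have "\<dots> \<le> (\<integral>\<^sup>+ r. rho r * B \<partial>lborel)"
  proof (rule nn_integral_mono)
    fix r
    have "(\<integral>\<^sup>+ u. H u r \<partial>lborel) = (\<integral>\<^sup>+ u. (rho r * ennreal (r ^ CARD('n))) * (indicator V u * (\<Theta> (x - r *\<^sub>R u))\<^sup>2) \<partial>lborel)"
      unfolding H_def by (simp add: mult_ac)
    also have "\<dots> = rho r * (ennreal (r ^ CARD('n)) * (\<integral>\<^sup>+ u. indicator V u * (\<Theta> (x - r *\<^sub>R u))\<^sup>2 \<partial>lborel))"
      by (subst nn_integral_cmult) (simp_all add: mult.assoc)
    also have "\<dots> \<le> rho r * B"
    proof (cases "r \<in> {0<..1}")
      case True then show ?thesis by (intro mult_left_mono scale) auto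
    qed (auto simp: rho_def)
    finally show "(\<integral>\<^sup>+ u. H u r \<partial>lborel) \<le> rho r * B" .
  qed
  also have "\<dots> = singularity_mass * B"
    by (simp add: nn_integral_multc singularity_mass_def rho_def)
  finally have "T\<^sup>2 \<le> 2 * B + 2 * singularity_mass * (singularity_mass * B)"
    by (simp add: add_left_mono mult_left_mono)
  also have "\<dots> = (2 + 2 * singularity_mass\<^sup>2) * B"
    by (simp add: distrib_right power2_eq_square mult.assoc)
  finally show ?thesis
    unfolding T_def B_def \<Theta>_def V_def by (simp add: ennreal_cmod_square)
qed

lemma majorant_weighted_bound:
  assumes f: "f \<in> schwartz" and g: "g \<in> schwartz"
  shows "(\<integral>\<^sup>+ x. ennreal (1 / weight (x - y)) * (majorant f g y x)\<^sup>2 \<partial>lborel)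
    \<le> of_nat (card (short_words :: 'n list set)) * of_nat (card (short_words :: 'n list set)) * ennreal (4 ^ CARD('n) * (2 * pi) ^ (3 * CARD('n))) * A * sqnorm g
       * (\<integral>\<^sup>+ u. ennreal ((cmod (f u))\<^sup>2 / weight (u - y)) \<partial>lborel)"
proof -
  define D where "D = (\<integral>\<^sup>+ u. ennreal ((cmod (f u))\<^sup>2 / weight (u - y)) \<partial>lborel)"
  define C1 where "C1 = ennreal (4 ^ CARD('n) * (2 * pi) ^ (3 * CARD('n)))"
  have le: "ennreal (1 / weight (x - y)) * (majorant f g y x)\<^sup>2
      \<le> of_nat (card (short_words :: 'n list set)) * (\<Sum>w\<in>short_words. ennreal ((cmod (mult_op (sym_slice S w y) f g x))\<^sup>2 / weight (x - y)))" for x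
  proof -
    have "ennreal (1 / weight (x - y)) * (majorant f g y x)\<^sup>2
       \<le> ennreal (1 / weight (x - y)) * (of_nat (card (short_words :: 'n list set)) * (\<Sum>w\<in>short_words. (ennreal (cmod (mult_op (sym_slice S w y) f g x)))\<^sup>2))"
      unfolding majorant_def by (intro mult_left_mono ennreal_sum_squares_le finite_short_words) simp
    also have "\<dots> = of_nat (card (short_words :: 'n list set)) * (\<Sum>w\<in>short_words. ennreal (1 / weight (x - y)) * ennreal ((cmod (mult_op (sym_slice S w y) f g x))\<^sup>2))"
      by (simp add: sum_distrib_left mult.left_commute ennreal_cmod_square)
    also have "\<dots> = of_nat (card (short_words :: 'n list set)) * (\<Sum>w\<in>short_words. ennreal ((cmod (mult_op (sym_slice S w y) f g x))\<^sup>2 / weight (x - y)))"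
      using weight_pos[of "x - y"] by (simp add: ennreal_mult'[symmetric] less_imp_le del: sum_ennreal)
    finally show ?thesis .
  qed
  have m: "(\<lambda>x. ennreal ((cmod (mult_op (sym_slice S w y) f g x))\<^sup>2 / weight (x - y))) \<in> borel_measurable lborel" if "w \<in> short_words" for w
  proof -
    have [measurable]: "mult_op (sym_slice S w y) f g \<in> borel_measurable borel"
      using that by (intro mult_op_measurable[OF fibre0 f g]) (simp add: short_words_def)
    show ?thesis by measurable
  qed
  have "(\<integral>\<^sup>+ x. ennreal (1 / weight (x - y)) * (majorant f g y x)\<^sup>2 \<partial>lborel)
    \<le> (\<integral>\<^sup>+ x. of_nat (card (short_words :: 'n list set)) * (\<Sum>w\<in>short_words. ennreal ((cmod (mult_op (sym_slice S w y) f g x))\<^sup>2 / weight (x - y))) \<partial>lborel)"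
    by (rule nn_integral_mono) (rule le)
  also have "\<dots> = of_nat (card (short_words :: 'n list set)) * (\<integral>\<^sup>+ x. (\<Sum>w\<in>short_words. ennreal ((cmod (mult_op (sym_slice S w y) f g x))\<^sup>2 / weight (x - y))) \<partial>lborel)"
    by (rule nn_integral_cmult) (rule borel_measurable_sum, rule m)
  also have "(\<integral>\<^sup>+ x. (\<Sum>w\<in>short_words. ennreal ((cmod (mult_op (sym_slice S w y) f g x))\<^sup>2 / weight (x - y))) \<partial>lborel)
     = (\<Sum>w\<in>short_words. (\<integral>\<^sup>+ x. ennreal ((cmod (mult_op (sym_slice S w y) f g x))\<^sup>2 / weight (x - y)) \<partial>lborel))"
    by (rule nn_integral_sum) (rule m)
  also have "\<dots> \<le> (\<Sum>w\<in>(short_words :: 'n list set). C1 * A * D * sqnorm g)"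
  proof (rule sum_mono)
    fix w :: "'n list" assume w: "w \<in> short_words"
    show "(\<integral>\<^sup>+ x. ennreal ((cmod (mult_op (sym_slice S w y) f g x))\<^sup>2 / weight (x - y)) \<partial>lborel) \<le> C1 * A * D * sqnorm g"
      unfolding C1_def D_def using w
      by (intro mult_op_weighted_bound smooth_sym_slice smooth_S fibre A_finite f g) (auto simp: short_words_def)
  qed
  also have "of_nat (card (short_words :: 'n list set)) * (\<Sum>w\<in>(short_words :: 'n list set). C1 * A * D * sqnorm g) = of_nat (card (short_words :: 'n list set)) * of_nat (card (short_words :: 'n list set)) * C1 * A * sqnorm g * D"
    by (simp add: mult_ac)
  finally show ?thesis unfolding C1_def D_def by (simp add: mult_left_mono)
qed

text \<open>The weight centred at \<open>y\<close> makes the sum over all positions converge: integrating the weighted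
  estimate in \<open>y\<close> only replaces the weight on \<open>f\<close> by its total mass.\<close>

theorem sqnorm_frozen_diagonal_le:
  assumes f: "f \<in> schwartz" and g: "g \<in> schwartz"
  shows "sqnorm (\<lambda>x. mult_op (\<lambda>p. S (x, p)) f g x) \<le> op_const TYPE('n) * A * sqnorm f * sqnorm g"
proof -
  define V where "V = (cbox 0 1 :: (real^'n) set)"
  define J where "J = 2 + 2 * singularity_mass\<^sup>2"
  define N where "N = of_nat (card (short_words :: 'n list set)) * of_nat (card (short_words :: 'n list set)) * ennreal (4 ^ CARD('n) * (2 * pi) ^ (3 * CARD('n))) * A * sqnorm g"
  have Vm [measurable]: "V \<in> sets borel" unfolding V_def by simp
  define H where "H = (\<lambda>x u. indicator V u * (majorant f g (x - u) x)\<^sup>2)"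
  have Hm: "(\<lambda>p. H (fst p) (snd p)) \<in> borel_measurable borel"
  proof -
    have "(\<lambda>p::(real^'n) \<times> (real^'n). majorant f g (fst p - snd p) (fst p)) \<in> borel_measurable (borel \<Otimes>\<^sub>M borel)"
      unfolding borel_prod using measurable_comp_continuous[OF majorant_measurable[OF f g], of "\<lambda>p. (fst p - snd p, fst p)"]
      by (simp add: continuous_intros)
    then show ?thesis unfolding H_def borel_prod[symmetric] by measurable
  qed
  have Hm2: "(\<lambda>(x, u). H x u) \<in> borel_measurable (lborel \<Otimes>\<^sub>M lborel)"
    using Hm by (simp add: split_beta' lborel_prod)
  define G where "G = (\<lambda>y u. indicator V u * (majorant f g y (u + y))\<^sup>2)"
  have Gm: "(\<lambda>p. G (fst p) (snd p)) \<in> borel_measurable borel"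
  proof -
    have "(\<lambda>p::(real^'n) \<times> (real^'n). majorant f g (fst p) (snd p + fst p)) \<in> borel_measurable (borel \<Otimes>\<^sub>M borel)"
      unfolding borel_prod using measurable_comp_continuous[OF majorant_measurable[OF f g], of "\<lambda>p. (fst p, snd p + fst p)"]
      by (simp add: continuous_intros)
    then show ?thesis unfolding G_def borel_prod[symmetric] by measurable
  qed
  have "sqnorm (\<lambda>x. mult_op (\<lambda>p. S (x, p)) f g x) \<le> (\<integral>\<^sup>+ x. J * (\<integral>\<^sup>+ u. H x u \<partial>lborel) \<partial>lborel)"
    unfolding sqnorm_def J_def H_def V_def by (intro nn_integral_mono mult_op_local_bound f g)
  also have "\<dots> = J * (\<integral>\<^sup>+ x. \<integral>\<^sup>+ u. H x u \<partial>lborel \<partial>lborel)"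
    by (rule nn_integral_cmult) (rule lborel.borel_measurable_nn_integral[OF Hm2])
  also have "(\<integral>\<^sup>+ x. \<integral>\<^sup>+ u. H x u \<partial>lborel \<partial>lborel) = (\<integral>\<^sup>+ u. \<integral>\<^sup>+ x. H x u \<partial>lborel \<partial>lborel)"
    using Tonelli_lborel[OF Hm] by simp
  also have "\<dots> = (\<integral>\<^sup>+ u. \<integral>\<^sup>+ y. G y u \<partial>lborel \<partial>lborel)"
  proof (rule nn_integral_cong)
    fix u
    have "(\<lambda>x. H x u) \<in> borel_measurable borel"
      using measurable_comp_continuous[OF Hm, of "\<lambda>x. (x, u)"] by (simp add: continuous_intros)
    from nn_integral_translate[OF this, of u]
    show "(\<integral>\<^sup>+ x. H x u \<partial>lborel) = (\<integral>\<^sup>+ y. G y u \<partial>lborel)"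
      unfolding H_def G_def by simp
  qed
  also have "\<dots> = (\<integral>\<^sup>+ y. \<integral>\<^sup>+ u. G y u \<partial>lborel \<partial>lborel)"
    using Tonelli_lborel[OF Gm] by simp
  also have "\<dots> \<le> (\<integral>\<^sup>+ y. (ennreal (2 ^ CARD('n)) * N) * (\<integral>\<^sup>+ u. ennreal ((cmod (f u))\<^sup>2 / weight (u - y)) \<partial>lborel) \<partial>lborel)"
  proof (rule nn_integral_mono)
    fix y :: "real^'n"
    define h where "h = (\<lambda>x. ennreal (1 / weight (x - y)) * (majorant f g y x)\<^sup>2)"
    have hm: "h \<in> borel_measurable borel"
    proof -
      have [measurable]: "(\<lambda>x. majorant f g y x) \<in> borel_measurable borel"
        using measurable_comp_continuous[OF majorant_measurable[OF f g], of "\<lambda>x. (y, x)"] by (simp add: continuous_intros)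
      show ?thesis unfolding h_def by measurable
    qed
    have "(\<integral>\<^sup>+ u. G y u \<partial>lborel) \<le> (\<integral>\<^sup>+ u. ennreal (2 ^ CARD('n)) * h (y + u) \<partial>lborel)"
    proof (rule nn_integral_mono)
      fix u
      show "G y u \<le> ennreal (2 ^ CARD('n)) * h (y + u)"
      proof (cases "u \<in> V")
        case True
        have "weight u \<le> (\<Prod>i\<in>(UNIV::'n set). 2)"
          unfolding weight_def
        proof (rule prod_mono)
          fix i
          have "(u $ i)\<^sup>2 \<le> 1" using True by (auto simp: V_def mem_box_cart power_le_one)
          then show "0 \<le> 1 + (u $ i)\<^sup>2 \<and> 1 + (u $ i)\<^sup>2 \<le> 2" by auto
        qed
        then have "1 \<le> 2 ^ CARD('n) * (1 / weight u)"
          using weight_pos[of u] by (simp add: field_simps)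
        then have "ennreal 1 \<le> ennreal (2 ^ CARD('n) * (1 / weight u))" by (rule ennreal_leI)
        then have "1 \<le> ennreal (2 ^ CARD('n)) * ennreal (1 / weight u)"
          by (subst ennreal_mult'[symmetric]) simp_all
        then have "1 * (majorant f g y (u + y))\<^sup>2 \<le> (ennreal (2 ^ CARD('n)) * ennreal (1 / weight u)) * (majorant f g y (u + y))\<^sup>2"
          by (rule mult_right_mono) simp
        then show ?thesis using True by (simp add: G_def h_def mult.assoc add.commute)
      qed (simp add: G_def)
    qed
    also have "\<dots> = ennreal (2 ^ CARD('n)) * (\<integral>\<^sup>+ u. h (y + u) \<partial>lborel)"
      by (rule nn_integral_cmult) (use hm in measurable)
    also have "(\<integral>\<^sup>+ u. h (y + u) \<partial>lborel) = (\<integral>\<^sup>+ x. h x \<partial>lborel)" by (rule nn_integral_translate[OF hm])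
    also have "\<dots> \<le> N * (\<integral>\<^sup>+ u. ennreal ((cmod (f u))\<^sup>2 / weight (u - y)) \<partial>lborel)"
      unfolding h_def N_def by (rule majorant_weighted_bound[OF f g])
    finally show "(\<integral>\<^sup>+ u. G y u \<partial>lborel) \<le> (ennreal (2 ^ CARD('n)) * N) * (\<integral>\<^sup>+ u. ennreal ((cmod (f u))\<^sup>2 / weight (u - y)) \<partial>lborel)"
      by (simp add: mult.assoc mult_left_mono)
  qed
  also have "\<dots> = (ennreal (2 ^ CARD('n)) * N) * (sqnorm f * weight_mass TYPE('n))"
  proof -
    define L where "L = (\<lambda>y u. ennreal ((cmod (f u))\<^sup>2 / weight (u - y)))"
    have [measurable]: "f \<in> borel_measurable borel" by (rule schwartz_measurable[OF f])
    have Lm: "(\<lambda>p. L (fst p) (snd p)) \<in> borel_measurable borel"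
    proof -
      have "(\<lambda>p::(real^'n) \<times> (real^'n). weight (snd p - fst p)) \<in> borel_measurable (borel \<Otimes>\<^sub>M borel)"
        unfolding borel_prod by (rule measurable_comp_continuous[OF weight_measurable]) (intro continuous_intros)
      then show ?thesis unfolding L_def borel_prod[symmetric] by measurable
    qed
    have "(\<lambda>(y, u). L y u) \<in> borel_measurable (lborel \<Otimes>\<^sub>M lborel)"
      using Lm by (simp add: split_beta' lborel_prod)
    then have Lm2: "(\<lambda>y. \<integral>\<^sup>+ u. L y u \<partial>lborel) \<in> borel_measurable lborel"
      by (rule lborel.borel_measurable_nn_integral)
    have "(\<integral>\<^sup>+ y. \<integral>\<^sup>+ u. L y u \<partial>lborel \<partial>lborel) = (\<integral>\<^sup>+ u. \<integral>\<^sup>+ y. L y u \<partial>lborel \<partial>lborel)"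
      using Tonelli_lborel[OF Lm] by simp
    also have "\<dots> = (\<integral>\<^sup>+ u. ennreal ((cmod (f u))\<^sup>2) * weight_mass TYPE('n) \<partial>lborel)"
    proof (rule nn_integral_cong)
      fix u :: "real^'n"
      have "(\<integral>\<^sup>+ y. L y u \<partial>lborel) = (\<integral>\<^sup>+ y. ennreal ((cmod (f u))\<^sup>2) * ennreal (1 / weight (- u + y)) \<partial>lborel)"
        unfolding L_def using weight_pos
        by (intro nn_integral_cong) (simp add: ennreal_mult'[symmetric] weight_minus[of u])
      also have "\<dots> = ennreal ((cmod (f u))\<^sup>2) * (\<integral>\<^sup>+ y. ennreal (1 / weight (- u + y)) \<partial>lborel)"
        by (rule nn_integral_cmult) measurable
      also have "(\<integral>\<^sup>+ y. ennreal (1 / weight (- u + y)) \<partial>lborel) = weight_mass TYPE('n)"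
        unfolding weight_mass_def by (rule nn_integral_translate) measurable
      finally show "(\<integral>\<^sup>+ y. L y u \<partial>lborel) = ennreal ((cmod (f u))\<^sup>2) * weight_mass TYPE('n)" .
    qed
    also have "\<dots> = sqnorm f * weight_mass TYPE('n)"
      unfolding sqnorm_def by (rule nn_integral_multc) measurable
    finally have "(\<integral>\<^sup>+ y. \<integral>\<^sup>+ u. L y u \<partial>lborel \<partial>lborel) = sqnorm f * weight_mass TYPE('n)" .
    moreover have "(\<integral>\<^sup>+ y. (ennreal (2 ^ CARD('n)) * N) * (\<integral>\<^sup>+ u. L y u \<partial>lborel) \<partial>lborel)
        = (ennreal (2 ^ CARD('n)) * N) * (\<integral>\<^sup>+ y. \<integral>\<^sup>+ u. L y u \<partial>lborel \<partial>lborel)"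
      by (rule nn_integral_cmult[OF Lm2])
    ultimately show ?thesis unfolding L_def by simp
  qed
  finally have "sqnorm (\<lambda>x. mult_op (\<lambda>p. S (x, p)) f g x) \<le> J * ((ennreal (2 ^ CARD('n)) * N) * (sqnorm f * weight_mass TYPE('n)))"
    by (simp add: mult_left_mono)
  also have "\<dots> = op_const TYPE('n) * A * sqnorm f * sqnorm g"
    unfolding op_const_def J_def[symmetric] N_def by (simp only: mult_ac)
  finally show ?thesis .
qed

end

section \<open>Density of the Schwartz space\<close>

lemma sqnorm_add_le:
  assumes [measurable]: "f \<in> borel_measurable borel" "g \<in> borel_measurable borel"
  shows "sqnorm (\<lambda>x. f x + g x) \<le> 2 * sqnorm f + 2 * sqnorm g"
proof -
  have "sqnorm (\<lambda>x. f x + g x) \<le> (\<integral>\<^sup>+ x. 2 * ennreal ((cmod (f x))\<^sup>2) + 2 * ennreal ((cmod (g x))\<^sup>2) \<partial>lborel)"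
    unfolding sqnorm_def
  proof (rule nn_integral_mono)
    fix x
    have "ennreal ((cmod (f x + g x))\<^sup>2) \<le> (ennreal (cmod (f x)) + ennreal (cmod (g x)))\<^sup>2"
      by (simp add: ennreal_plus[symmetric] ennreal_power ennreal_leI power_mono norm_triangle_ineq del: ennreal_plus)
    also have "\<dots> \<le> 2 * ennreal ((cmod (f x))\<^sup>2) + 2 * ennreal ((cmod (g x))\<^sup>2)"
      unfolding ennreal_cmod_square by (rule sum_sq_ennreal)
    finally show "ennreal ((cmod (f x + g x))\<^sup>2) \<le> 2 * ennreal ((cmod (f x))\<^sup>2) + 2 * ennreal ((cmod (g x))\<^sup>2)" .
  qed
  also have "\<dots> = 2 * sqnorm f + 2 * sqnorm g"
    unfolding sqnorm_def by (simp add: nn_integral_add nn_integral_cmult)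
  finally show ?thesis .
qed

lemma sqnorm_cmult:
  assumes [measurable]: "f \<in> borel_measurable borel"
  shows "sqnorm (\<lambda>x. c * f x) = ennreal ((cmod c)\<^sup>2) * sqnorm f"
  unfolding sqnorm_def by (simp add: norm_mult power_mult_distrib ennreal_mult nn_integral_cmult)

lemma sqnorm_minus_commute: "sqnorm (\<lambda>x. f x - g x) = sqnorm (\<lambda>x. g x - f x)"
  unfolding sqnorm_def by (simp add: norm_minus_commute)

definition approximable :: "(real^'n::finite \<Rightarrow> complex) \<Rightarrow> bool" where
  "approximable f \<longleftrightarrow> f \<in> borel_measurable borel \<and> (\<forall>e>0. \<exists>s\<in>schwartz. sqnorm (\<lambda>x. f x - s x) < ennreal e)"

lemma approximable_limit:
  assumes f: "f \<in> borel_measurable borel"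
    and h: "\<And>e::real. e > 0 \<Longrightarrow> \<exists>h. approximable h \<and> sqnorm (\<lambda>x. f x - h x) < ennreal e"
  shows "approximable f"
  unfolding approximable_def
proof (intro conjI f allI impI)
  fix e :: real assume e: "e > 0"
  obtain h where h: "approximable h" "sqnorm (\<lambda>x. f x - h x) < ennreal (e / 4)"
    using h[of "e / 4"] e by auto
  obtain s where s: "s \<in> schwartz" "sqnorm (\<lambda>x. h x - s x) < ennreal (e / 4)"
    using h(1) e unfolding approximable_def by (meson divide_pos_pos zero_less_numeral)
  have [measurable]: "f \<in> borel_measurable borel" "h \<in> borel_measurable borel" "s \<in> borel_measurable borel"
    using f h(1) schwartz_measurable[OF s(1)] by (auto simp: approximable_def)
  have "sqnorm (\<lambda>x. f x - s x) = sqnorm (\<lambda>x. (f x - h x) + (h x - s x))" by simp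
  also have "\<dots> \<le> 2 * sqnorm (\<lambda>x. f x - h x) + 2 * sqnorm (\<lambda>x. h x - s x)"
    by (rule sqnorm_add_le) measurable
  also have "\<dots> < 2 * ennreal (e / 4) + 2 * ennreal (e / 4)"
    using h(2) s(2) by (intro add_strict_mono ennreal_mult_strict_left_mono) auto
  also have "\<dots> = ennreal e"
    using e by (simp add: ennreal_plus[symmetric] ennreal_mult'[symmetric] del: ennreal_plus flip: ennreal_numeral)
  finally show "\<exists>s\<in>schwartz. sqnorm (\<lambda>x. f x - s x) < ennreal e" using s(1) by blast
qed

lemma approximable_schwartz: "s \<in> schwartz \<Longrightarrow> approximable s"
  unfolding approximable_def by (auto simp: sqnorm_def schwartz_measurable intro!: bexI[of _ s])

lemma approximable_add:
  assumes f: "approximable f" and g: "approximable g"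
  shows "approximable (\<lambda>x. f x + g x)"
proof -
  have [measurable]: "f \<in> borel_measurable borel" "g \<in> borel_measurable borel"
    using f g by (auto simp: approximable_def)
  show ?thesis
  proof (rule approximable_limit)
    show "(\<lambda>x. f x + g x) \<in> borel_measurable borel" by measurable
    fix e :: real assume e: "e > 0"
    then have e4: "e / 4 > 0" by simp
    obtain s where s: "s \<in> schwartz" "sqnorm (\<lambda>x. f x - s x) < ennreal (e / 4)"
      using f e4 unfolding approximable_def by blast
    obtain t where t: "t \<in> schwartz" "sqnorm (\<lambda>x. g x - t x) < ennreal (e / 4)"
      using g e4 unfolding approximable_def by blast
    have [measurable]: "s \<in> borel_measurable borel" "t \<in> borel_measurable borel"
      using s t by (auto intro: schwartz_measurable)
    have "sqnorm (\<lambda>x. (f x + g x) - (s x + t x)) = sqnorm (\<lambda>x. (f x - s x) + (g x - t x))"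
      by (simp add: algebra_simps)
    also have "\<dots> \<le> 2 * sqnorm (\<lambda>x. f x - s x) + 2 * sqnorm (\<lambda>x. g x - t x)"
      by (rule sqnorm_add_le) measurable
    also have "\<dots> < 2 * ennreal (e / 4) + 2 * ennreal (e / 4)"
      using s(2) t(2) by (intro add_strict_mono ennreal_mult_strict_left_mono) auto
    also have "\<dots> = ennreal e"
      using e by (simp add: ennreal_plus[symmetric] ennreal_mult'[symmetric] del: ennreal_plus flip: ennreal_numeral)
    finally show "\<exists>h. approximable h \<and> sqnorm (\<lambda>x. f x + g x - h x) < ennreal e"
      using approximable_schwartz[OF schwartz_add[OF s(1) t(1)]] by blast
  qed
qed

lemma approximable_cmult:
  assumes f: "approximable f" shows "approximable (\<lambda>x. c * f x)"
proof -
  have [measurable]: "f \<in> borel_measurable borel" using f by (auto simp: approximable_def)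
  show ?thesis
  proof (rule approximable_limit)
    show "(\<lambda>x. c * f x) \<in> borel_measurable borel" by measurable
    fix e :: real assume e: "e > 0"
    \<comment> \<open>adding one covers the case \<open>c = 0\<close>\<close>
    define d where "d = e / ((cmod c)\<^sup>2 + 1)"
    have c1: "0 < (cmod c)\<^sup>2 + 1" by (rule add_nonneg_pos) auto
    have d: "d > 0" unfolding d_def using e c1 by simp
    obtain s where s: "s \<in> schwartz" "sqnorm (\<lambda>x. f x - s x) < ennreal d"
      using f d unfolding approximable_def by blast
    have [measurable]: "s \<in> borel_measurable borel" using s by (auto intro: schwartz_measurable)
    have "sqnorm (\<lambda>x. c * f x - c * s x) = sqnorm (\<lambda>x. c * (f x - s x))"
      by (simp add: right_diff_distrib)
    also have "\<dots> = ennreal ((cmod c)\<^sup>2) * sqnorm (\<lambda>x. f x - s x)"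
      by (rule sqnorm_cmult) measurable
    also have "\<dots> \<le> ennreal ((cmod c)\<^sup>2) * ennreal d" using s(2) by (intro mult_left_mono) auto
    also have "\<dots> = ennreal ((cmod c)\<^sup>2 * d)" by (simp add: ennreal_mult')
    also have "\<dots> < ennreal e"
    proof (rule ennreal_lessI[OF e])
      have "(cmod c)\<^sup>2 * e < e * ((cmod c)\<^sup>2 + 1)" using e by (simp add: distrib_left mult.commute)
      then show "(cmod c)\<^sup>2 * d < e" unfolding d_def using c1 by (simp add: pos_divide_less_eq)
    qed
    finally show "\<exists>h. approximable h \<and> sqnorm (\<lambda>x. c * f x - h x) < ennreal e"
      using approximable_schwartz[OF schwartz_cmult[OF s(1)]] by blast
  qed
qed

lemma approximable_dominated:
  fixes f :: "real^'n::finite \<Rightarrow> complex" and w :: "real^'n \<Rightarrow> ennreal"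
  assumes h: "\<And>k. approximable (h k)" and f: "f \<in> borel_measurable borel"
    and lim: "AE x in lborel. (\<lambda>k::nat. h k x) \<longlonglongrightarrow> f x"
    and dom: "\<And>k x. ennreal ((cmod (f x - h k x))\<^sup>2) \<le> w x"
    and w: "w \<in> borel_measurable borel" "(\<integral>\<^sup>+ x. w x \<partial>lborel) < \<infinity>"
  shows "approximable f"
proof (rule approximable_limit[OF f])
  fix e :: real assume e: "e > 0"
  have [measurable]: "h k \<in> borel_measurable borel" "f \<in> borel_measurable borel" "w \<in> borel_measurable borel" for k
    using h f w by (auto simp: approximable_def)
  have "(\<lambda>k. \<integral>\<^sup>+ x. ennreal ((cmod (f x - h k x))\<^sup>2) \<partial>lborel) \<longlonglongrightarrow> (\<integral>\<^sup>+ (x::real^'n). 0 \<partial>lborel)"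
  proof (rule nn_integral_dominated_convergence[where w=w])
    show "AE x in lborel. (\<lambda>k. ennreal ((cmod (f x - h k x))\<^sup>2)) \<longlonglongrightarrow> 0"
      using lim
    proof eventually_elim
      fix x assume "(\<lambda>k. h k x) \<longlonglongrightarrow> f x"
      then have "(\<lambda>k. (cmod (f x - h k x))\<^sup>2) \<longlonglongrightarrow> (cmod (f x - f x))\<^sup>2"
        by (intro tendsto_intros)
      then have "(\<lambda>k. ennreal ((cmod (f x - h k x))\<^sup>2)) \<longlonglongrightarrow> ennreal ((cmod (f x - f x))\<^sup>2)"
        by (rule tendsto_ennrealI)
      then show "(\<lambda>k. ennreal ((cmod (f x - h k x))\<^sup>2)) \<longlonglongrightarrow> 0" by simp
    qed
  qed (use dom w in auto)
  then have "(\<lambda>k. sqnorm (\<lambda>x. f x - h k x)) \<longlonglongrightarrow> 0" unfolding sqnorm_def by simp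
  then have "eventually (\<lambda>k. sqnorm (\<lambda>x. f x - h k x) < ennreal e) sequentially"
    by (rule order_tendstoD(2)) (use e in simp)
  then obtain k where "sqnorm (\<lambda>x. f x - h k x) < ennreal e"
    by (auto simp: eventually_sequentially)
  then show "\<exists>h. approximable h \<and> sqnorm (\<lambda>x. f x - h x) < ennreal e" using h by blast
qed

text \<open>Schwartz functions that converge to the indicator of the box with centre \<open>c\<close> and half sides
  \<open>r\<^sub>i\<close> as \<open>m\<close> grows.\<close>

definition flat_bump :: "nat \<Rightarrow> real^'n::finite \<Rightarrow> real^'n \<Rightarrow> real^'n \<Rightarrow> real" where
  "flat_bump m c r x = exp (- (\<Sum>i\<in>UNIV. ((x $ i - c $ i) / r $ i) ^ (2 * m)))"

lemma flat_bump_prod: "flat_bump m c r x = (\<Prod>i\<in>UNIV. exp (- (((x $ i - c $ i) / r $ i) ^ (2 * m))))"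
  unfolding flat_bump_def by (simp add: sum_negf[symmetric] exp_sum)

lemma flat_bump_nonneg: "0 \<le> flat_bump m c r x"
  unfolding flat_bump_def by simp

lemma flat_bump_le1: "flat_bump m c r x \<le> 1"
proof -
  have "0 \<le> (\<Sum>i\<in>UNIV. ((x $ i - c $ i) / r $ i) ^ (2 * m))"
    by (rule sum_nonneg) (rule zero_le_even_power, simp)
  then show ?thesis unfolding flat_bump_def by simp
qed

lemma power_le_exp:
  fixes x :: real
  assumes "0 \<le> x" shows "x ^ a \<le> real a ^ a * exp x"
proof (cases "a = 0")
  case False
  have "(x / real a) ^ a \<le> (1 + x / real a) ^ a" using assms by (intro power_mono) auto
  also have "\<dots> \<le> exp x" using assms False by (intro exp_ge_one_plus_x_over_n_power_n) auto
  finally have "x ^ a / real a ^ a \<le> exp x" by (simp add: power_divide)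
  then show ?thesis using False by (simp add: pos_divide_le_eq mult.commute)
qed (use assms in simp)

lemma even_power_ge:
  fixes t :: real
  assumes "1 \<le> m" shows "t\<^sup>2 - 1 \<le> t ^ (2 * m)"
proof -
  have "t ^ (2 * m) = (t\<^sup>2) ^ m" by (rule power_mult)
  moreover have "t\<^sup>2 - 1 \<le> (t\<^sup>2) ^ m"
  proof (cases "1 \<le> t\<^sup>2")
    case True then show ?thesis using self_le_power[of "t\<^sup>2" m] assms by linarith
  next
    case False then show ?thesis using zero_le_power[of "t\<^sup>2" m] zero_le_power2[of t] by linarith
  qed
  ultimately show ?thesis by simp
qed

lemma flat_bump_schwartz:
  fixes c r :: "real^'n::finite"
  assumes m: "1 \<le> m" and r: "\<And>i. 0 < r $ i"
  shows "(\<lambda>x. complex_of_real (flat_bump m c r x)) \<in> schwartz"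
proof -
  define p where "p = (\<lambda>x::real^'n. \<Sum>i\<in>UNIV. ((complex_of_real (x $ i) + of_real (- c $ i)) * of_real (1 / r $ i)) ^ (2 * m))"
  have p: "p \<in> moderate" unfolding p_def
    by (intro moderate_sum moderate_power moderate.mult moderate.add moderate.const moderate.coord)
  have e: "complex_of_real (flat_bump m c r x) = exp (- p x)" for x
    unfolding flat_bump_def p_def by (simp add: exp_of_real[symmetric] divide_inverse)
  have "rapid (\<lambda>x. exp (- p x))"
    unfolding rapid_def
  proof
    fix \<alpha> :: "'n multi_index"
    define M where "M = (\<lambda>i. (\<bar>c $ i\<bar> + r $ i) ^ \<alpha> i * (real (\<alpha> i) ^ \<alpha> i * exp 3))"
    have one: "\<bar>x $ i\<bar> ^ \<alpha> i * exp (- (((x $ i - c $ i) / r $ i) ^ (2 * m))) \<le> M i" for x i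
    proof -
      define t where "t = (x $ i - c $ i) / r $ i"
      have x: "x $ i = c $ i + r $ i * t" unfolding t_def using r[of i] by simp
      have "\<bar>x $ i\<bar> \<le> \<bar>c $ i\<bar> + r $ i * \<bar>t\<bar>" unfolding x using r[of i] by (simp add: abs_mult order_trans[OF abs_triangle_ineq])
      also have "\<dots> \<le> (\<bar>c $ i\<bar> + r $ i) * (1 + \<bar>t\<bar>)" using r[of i] by (simp add: algebra_simps)
      finally have "\<bar>x $ i\<bar> ^ \<alpha> i \<le> ((\<bar>c $ i\<bar> + r $ i) * (1 + \<bar>t\<bar>)) ^ \<alpha> i" by (rule power_mono) simp
      also have "\<dots> \<le> (\<bar>c $ i\<bar> + r $ i) ^ \<alpha> i * (real (\<alpha> i) ^ \<alpha> i * exp (1 + \<bar>t\<bar>))"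
        unfolding power_mult_distrib using r[of i] by (intro mult_left_mono power_le_exp) auto
      finally have 1: "\<bar>x $ i\<bar> ^ \<alpha> i \<le> (\<bar>c $ i\<bar> + r $ i) ^ \<alpha> i * (real (\<alpha> i) ^ \<alpha> i * exp (1 + \<bar>t\<bar>))" .
      \<comment> \<open>the exponent \<open>t\<^sup>2\<^sup>m\<close> absorbs the exponential that bounds the monomial\<close>
      have "0 \<le> (\<bar>t\<bar> - 1)\<^sup>2 + t\<^sup>2 + 1" by (simp add: add_nonneg_nonneg)
      then have "\<bar>t\<bar> - 1 \<le> t\<^sup>2" by (simp add: power2_diff)
      then have "1 + \<bar>t\<bar> + - (t ^ (2 * m)) \<le> 3" using even_power_ge[OF m, of t] by linarith
      then have 2: "exp (1 + \<bar>t\<bar>) * exp (- (t ^ (2 * m))) \<le> exp 3"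
        unfolding exp_add[symmetric] by simp
      have "\<bar>x $ i\<bar> ^ \<alpha> i * exp (- (t ^ (2 * m))) \<le> (\<bar>c $ i\<bar> + r $ i) ^ \<alpha> i * (real (\<alpha> i) ^ \<alpha> i * exp (1 + \<bar>t\<bar>)) * exp (- (t ^ (2 * m)))"
        by (rule mult_right_mono[OF 1]) simp
      also have "\<dots> = (\<bar>c $ i\<bar> + r $ i) ^ \<alpha> i * (real (\<alpha> i) ^ \<alpha> i * (exp (1 + \<bar>t\<bar>) * exp (- (t ^ (2 * m)))))"
        by (simp only: mult.assoc)
      also have "\<dots> \<le> M i" unfolding M_def using r[of i] by (intro mult_left_mono 2) auto
      finally show ?thesis unfolding t_def .
    qed
    have "norm (monomial \<alpha> x *\<^sub>R exp (- p x)) \<le> (\<Prod>i\<in>UNIV. M i)" for x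
    proof -
      have "norm (monomial \<alpha> x *\<^sub>R exp (- p x)) = \<bar>monomial \<alpha> x\<bar> * flat_bump m c r x"
        unfolding e[symmetric] norm_scaleR norm_of_real by (simp add: flat_bump_nonneg)
      also have "\<dots> = (\<Prod>i\<in>UNIV. \<bar>x $ i\<bar> ^ \<alpha> i * exp (- (((x $ i - c $ i) / r $ i) ^ (2 * m))))"
        unfolding monomial_def flat_bump_prod prod.distrib abs_prod power_abs ..
      also have "\<dots> \<le> (\<Prod>i\<in>UNIV. M i)" by (intro prod_mono conjI one) auto
      finally show ?thesis .
    qed
    then show "bounded (range (\<lambda>x. monomial \<alpha> x *\<^sub>R exp (- p x)))" unfolding bounded_iff by blast
  qed
  from schwartz_exp_moderate[OF p this] show ?thesis unfolding e .
qed

text \<open>An integrable bound that is uniform in \<open>m\<close>.\<close>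

lemma flat_bump_le:
  fixes c r :: "real^'n::finite"
  assumes m: "1 \<le> m" and r: "\<And>i. 0 < r $ i"
  shows "flat_bump m c r x \<le> (\<Prod>i\<in>UNIV. 2 * (1 + (r $ i)\<^sup>2)) * (1 / weight (x - c))"
proof -
  have "exp (- (((x $ i - c $ i) / r $ i) ^ (2 * m))) \<le> 2 * (1 + (r $ i)\<^sup>2) / (1 + ((x - c) $ i)\<^sup>2)" for i
  proof -
    define t where "t = (x $ i - c $ i) / r $ i"
    have x: "(x - c) $ i = r $ i * t" unfolding t_def using r[of i] by simp
    have "1 + t ^ (2 * m) \<le> exp (t ^ (2 * m))" by (rule exp_ge_add_one_self)
    moreover have "t\<^sup>2 - 1 \<le> t ^ (2 * m)" by (rule even_power_ge[OF m])
    moreover have "0 \<le> t ^ (2 * m)" by simp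
    ultimately have "1 + t\<^sup>2 \<le> 2 * exp (t ^ (2 * m))" by linarith
    then have "(1 + t\<^sup>2) * exp (- (t ^ (2 * m))) \<le> 2"
      by (simp add: exp_minus field_simps)
    then have "(1 + (r $ i)\<^sup>2) * ((1 + t\<^sup>2) * exp (- (t ^ (2 * m)))) \<le> (1 + (r $ i)\<^sup>2) * 2"
      by (intro mult_left_mono) auto
    moreover have "(1 + (r $ i * t)\<^sup>2) * exp (- (t ^ (2 * m))) \<le> (1 + (r $ i)\<^sup>2) * ((1 + t\<^sup>2) * exp (- (t ^ (2 * m))))"
      unfolding mult.assoc[symmetric] by (intro mult_right_mono) (auto simp: algebra_simps power_mult_distrib)
    ultimately have "(1 + (r $ i * t)\<^sup>2) * exp (- (t ^ (2 * m))) \<le> 2 * (1 + (r $ i)\<^sup>2)"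
      by linarith
    moreover have "0 < 1 + (r $ i * t)\<^sup>2" by (simp add: add_pos_nonneg)
    ultimately show ?thesis unfolding x t_def[symmetric] by (simp add: pos_le_divide_eq mult.commute)
  qed
  then have "(\<Prod>i\<in>UNIV. exp (- (((x $ i - c $ i) / r $ i) ^ (2 * m)))) \<le> (\<Prod>i\<in>UNIV. 2 * (1 + (r $ i)\<^sup>2) / (1 + ((x - c) $ i)\<^sup>2))"
    by (intro prod_mono) auto
  then show ?thesis
    unfolding flat_bump_prod weight_def by (simp add: prod_dividef)
qed

text \<open>On the boundary of the box the limit is \<open>exp (- j)\<close> with \<open>j\<close> the number of faces that contain the
  point, hence the boundary is left out.\<close>

lemma flat_bump_tendsto:
  fixes c r :: "real^'n::finite"
  assumes r: "\<And>i. 0 < r $ i" and x: "x \<notin> cbox (c - r) (c + r) - box (c - r) (c + r)"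
  shows "(\<lambda>m. flat_bump (Suc m) c r x) \<longlonglongrightarrow> indicator (box (c - r) (c + r)) x"
proof -
  define t where "t = (\<lambda>i. (x $ i - c $ i) / r $ i)"
  have te: "(x $ i - c $ i) / r $ i = t i" for i by (simp add: t_def)
  have "\<bar>t i\<bar> = \<bar>x $ i - c $ i\<bar> / r $ i" for i
    unfolding t_def using r[of i] by (simp add: abs_divide)
  then have t1: "\<bar>t i\<bar> < 1 \<longleftrightarrow> \<bar>x $ i - c $ i\<bar> < r $ i" "\<bar>t i\<bar> \<le> 1 \<longleftrightarrow> \<bar>x $ i - c $ i\<bar> \<le> r $ i" for i
    using r[of i] by (simp_all add: pos_divide_less_eq pos_divide_le_eq)
  have "(c - r) $ i < x $ i \<and> x $ i < (c + r) $ i \<longleftrightarrow> \<bar>t i\<bar> < 1" for i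
    unfolding t1 by auto
  then have bx: "x \<in> box (c - r) (c + r) \<longleftrightarrow> (\<forall>i. \<bar>t i\<bar> < 1)"
    unfolding mem_box_cart by simp
  have "(c - r) $ i \<le> x $ i \<and> x $ i \<le> (c + r) $ i \<longleftrightarrow> \<bar>t i\<bar> \<le> 1" for i
    unfolding t1 by auto
  then have cbx: "x \<in> cbox (c - r) (c + r) \<longleftrightarrow> (\<forall>i. \<bar>t i\<bar> \<le> 1)"
    unfolding mem_box_cart by simp
  show ?thesis
  proof (cases "x \<in> box (c - r) (c + r)")
    case True
    then have t: "(t i)\<^sup>2 < 1" for i unfolding bx by (simp add: abs_square_less_1)
    have "(\<lambda>m. ((t i)\<^sup>2) ^ Suc m) \<longlonglongrightarrow> 0" for i
      using LIMSEQ_Suc[OF LIMSEQ_power_zero[of "(t i)\<^sup>2"]] t[of i] by simp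
    then have "(\<lambda>m. exp (- (\<Sum>i\<in>UNIV. ((t i)\<^sup>2) ^ Suc m))) \<longlonglongrightarrow> exp (- (\<Sum>i\<in>(UNIV::'n set). 0))"
      by (intro tendsto_intros)
    then show ?thesis using True unfolding flat_bump_def te power_mult by simp
  next
    case False
    then obtain j where j: "\<bar>t j\<bar> > 1" using x unfolding bx cbx by (auto simp: not_less not_le bx cbx)
    then have tj: "1 < (t j)\<^sup>2" using one_less_power[of "\<bar>t j\<bar>" 2] by simp
    have "filterlim (\<lambda>m. ((t j)\<^sup>2) ^ Suc m) at_top sequentially"
      using filterlim_at_infinity_imp_norm_at_top[OF filterlim_realpow_sequentially_gt1[of "(t j)\<^sup>2"]] tj
      by (subst filterlim_sequentially_Suc) (simp add: norm_power)
    then have "filterlim (\<lambda>m. (\<Sum>i\<in>UNIV. ((t i)\<^sup>2) ^ Suc m)) at_top sequentially"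
    proof (rule filterlim_at_top_mono)
      show "\<forall>\<^sub>F m in sequentially. ((t j)\<^sup>2) ^ Suc m \<le> (\<Sum>i\<in>UNIV. ((t i)\<^sup>2) ^ Suc m)"
        by (intro always_eventually allI member_le_sum) auto
    qed
    then have "(\<lambda>m. exp (- (\<Sum>i\<in>UNIV. ((t i)\<^sup>2) ^ Suc m))) \<longlonglongrightarrow> 0"
      by (intro filterlim_compose[OF exp_at_bot] filterlim_compose[OF filterlim_uminus_at_bot_at_top])
    then show ?thesis using False unfolding flat_bump_def te power_mult by simp
  qed
qed

lemma box_boundary_null: "AE x in lborel. x \<notin> cbox a b - box a (b::'a::euclidean_space)"
proof (cases "\<forall>i\<in>Basis. a \<bullet> i \<le> b \<bullet> i")
  case True
  have "emeasure lborel (cbox a b - box a b) = emeasure lborel (cbox a b) - emeasure lborel (box a b)"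
    using emeasure_lborel_box_finite[of a b] by (intro emeasure_Diff) (auto simp: box_subset_cbox)
  also have "\<dots> = 0" using True by simp
  finally have "cbox a b - box a b \<in> null_sets lborel" by (auto simp: null_sets_def)
  then show ?thesis by (rule AE_not_in)
next
  case False
  then have "cbox a b = {}" by (auto simp: box_eq_empty not_le)
  then show ?thesis by simp
qed

lemma approximable_zero: "approximable (\<lambda>_::real^'n::finite. 0)"
proof -
  have "approximable (\<lambda>x::real^'n. complex_of_real (flat_bump 1 0 1 x))"
    by (intro approximable_schwartz flat_bump_schwartz) auto
  from approximable_cmult[OF this, of 0] show ?thesis by simp
qed

lemma approximable_box: "approximable (\<lambda>x::real^'n::finite. complex_of_real (indicator (box a b) x))"
proof (cases "box a b = {}")
  case True then show ?thesis by (simp add: approximable_zero)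
next
  case False
  then obtain z where "z \<in> box a b" by auto
  then have ab: "a $ i < b $ i" for i unfolding mem_box_cart by (meson less_trans)
  define c r where "c = (1 / 2) *\<^sub>R (a + b)" and "r = (1 / 2) *\<^sub>R (b - a)"
  have r: "0 < r $ i" for i unfolding r_def using ab[of i] by simp
  have ab_eq: "a = c - r" "b = c + r" unfolding c_def r_def by (simp_all add: vec_eq_iff field_simps)
  define D where "D = (\<Prod>i\<in>UNIV. 2 * (1 + (r $ i)\<^sup>2))"
  have D: "0 \<le> D" unfolding D_def by (intro prod_nonneg) auto
  define w where "w = (\<lambda>x. ennreal (indicator (box a b) x) + ennreal D * ennreal (1 / weight (- c + x)))"
  show ?thesis
  proof (rule approximable_dominated[where w=w])
    show "approximable (\<lambda>x. complex_of_real (flat_bump (Suc k) c r x))" for k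
      by (intro approximable_schwartz flat_bump_schwartz r) simp
    show "(\<lambda>x. complex_of_real (indicator (box a b) x)) \<in> borel_measurable borel"
      by measurable
    show "w \<in> borel_measurable borel" unfolding w_def by measurable
    show "AE x in lborel. (\<lambda>k. complex_of_real (flat_bump (Suc k) c r x)) \<longlonglongrightarrow> complex_of_real (indicator (box a b) x)"
      using box_boundary_null[of a b]
    proof eventually_elim
      fix x assume "x \<notin> cbox a b - box a b"
      then show "(\<lambda>k. complex_of_real (flat_bump (Suc k) c r x)) \<longlonglongrightarrow> complex_of_real (indicator (box a b) x)"
        unfolding ab_eq by (intro tendsto_of_real flat_bump_tendsto r)
    qed
    show "ennreal ((cmod (complex_of_real (indicator (box a b) x) - complex_of_real (flat_bump (Suc k) c r x)))\<^sup>2) \<le> w x" for k x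
    proof -
      define I F :: real where "I = indicator (box a b) x" and "F = flat_bump (Suc k) c r x"
      have F: "0 \<le> F" "F \<le> 1" unfolding F_def by (rule flat_bump_nonneg flat_bump_le1)+
      have I: "0 \<le> I" "I \<le> 1" unfolding I_def by (auto split: split_indicator)
      have "\<bar>I - F\<bar> \<le> 1" using F I by auto
      then have "\<bar>I - F\<bar> ^ 2 \<le> \<bar>I - F\<bar>" using power_decreasing[of 1 2 "\<bar>I - F\<bar>"] by simp
      also have "\<dots> \<le> I + F" using F I by auto
      also have "F \<le> D * (1 / weight (- c + x))"
        using flat_bump_le[OF _ r, of "Suc k" c x] unfolding F_def D_def by simp
      finally have "\<bar>I - F\<bar> ^ 2 \<le> I + D * (1 / weight (- c + x))" by simp
      moreover have "cmod (complex_of_real I - complex_of_real F) = \<bar>I - F\<bar>"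
        by (simp flip: of_real_diff)
      ultimately have "ennreal ((cmod (complex_of_real I - complex_of_real F))\<^sup>2) \<le> ennreal (I + D * (1 / weight (- c + x)))"
        by (simp add: ennreal_leI)
      also have "\<dots> = ennreal I + ennreal D * ennreal (1 / weight (- c + x))"
        using I D weight_pos[of "- c + x"] by (simp add: ennreal_mult'[symmetric] less_imp_le)
      finally show ?thesis unfolding w_def I_def F_def .
    qed
    have "(\<integral>\<^sup>+ x. w x \<partial>lborel) = emeasure lborel (box a b) + ennreal D * (\<integral>\<^sup>+ x. ennreal (1 / weight (- c + x)) \<partial>lborel)"
      unfolding w_def by (subst nn_integral_add) (simp_all add: nn_integral_cmult ennreal_indicator)
    also have "(\<integral>\<^sup>+ x. ennreal (1 / weight (- c + x)) \<partial>lborel) = weight_mass TYPE('n)"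
      unfolding weight_mass_def by (rule nn_integral_translate) measurable
    finally show "(\<integral>\<^sup>+ x. w x \<partial>lborel) < \<infinity>"
      using weight_mass_finite[where 'n='n] emeasure_lborel_box_finite[of a b] by (simp add: ennreal_mult_less_top)
  qed
qed

text \<open>Dynkin's argument on the sets \<open>A\<close>.  Intersecting with a fixed box keeps all measures finite, so
  that complements are differences and disjoint unions converge in \<open>L\<^sup>2\<close>.\<close>

lemma approximable_indicator_bounded:
  fixes A :: "(real^'n::finite) set"
  assumes A: "A \<in> sets borel"
  shows "approximable (\<lambda>x. complex_of_real (indicator (A \<inter> box a b) x))"
proof -
  have I: "Int_stable (range (\<lambda>(a, b). box a b :: (real^'n) set))"
    by (auto simp: Int_stable_def box_Int_box)
  have P: "range (\<lambda>(a, b). box a b :: (real^'n) set) \<subseteq> Pow UNIV" by simp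
  have "A \<in> sigma_sets UNIV (range (\<lambda>(a, b). box a b :: (real^'n) set))"
    using A unfolding borel_eq_box by simp
  from I P this show ?thesis
  proof (induction rule: sigma_sets_induct_disjoint)
    case (basic A)
    then show ?case by (auto simp: box_Int_box approximable_box)
  next
    case empty
    show ?case by (simp add: approximable_zero)
  next
    case (compl A)
    have e: "complex_of_real (indicator ((UNIV - A) \<inter> box a b) x)
      = complex_of_real (indicator (box a b) x) + - 1 * complex_of_real (indicator (A \<inter> box a b) x)" for x
      by (auto split: split_indicator)
    show ?case unfolding e by (rule approximable_add[OF approximable_box approximable_cmult[OF compl(2)]])
  next
    case (union F)
    have Fb: "F i \<in> sets borel" for i using union(2) by (auto simp: borel_eq_box)
    show ?case
    proof (rule approximable_dominated[where w="\<lambda>x. indicator (box a b) x"])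
      define h where "h = (\<lambda>k x. \<Sum>i<k. complex_of_real (indicator (F i \<inter> box a b) x))"
      have h: "h k x = complex_of_real (indicator ((\<Union>i<k. F i) \<inter> box a b) x)" for k x
      proof (induction k)
        case (Suc k)
        have "F i \<inter> F k = {}" if "i < k" for i
          using disjoint_family_onD[OF union(1), of i k] that by simp
        then have "(\<Union>i<k. F i) \<inter> F k = {}" by auto
        then show ?case using Suc unfolding h_def by (auto simp: lessThan_Suc split: split_indicator)
      qed (simp add: h_def)
      show "approximable (h k)" for k
      proof (induction k)
        case 0 show ?case by (simp add: h_def approximable_zero)
      next
        case (Suc k)
        then show ?case using approximable_add[OF Suc union(3)[of k]] by (simp add: h_def)
      qed
      show "(\<lambda>x. complex_of_real (indicator ((\<Union>i. F i) \<inter> box a b) x)) \<in> borel_measurable borel"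
        using Fb by measurable
      show "AE x in lborel. (\<lambda>k. h k x) \<longlonglongrightarrow> complex_of_real (indicator ((\<Union>i. F i) \<inter> box a b) x)"
      proof (rule AE_I2)
        fix x
        show "(\<lambda>k. h k x) \<longlonglongrightarrow> complex_of_real (indicator ((\<Union>i. F i) \<inter> box a b) x)"
        proof (cases "x \<in> (\<Union>i. F i)")
          case True
          then obtain j where j: "x \<in> F j" by auto
          have "eventually (\<lambda>k. h k x = complex_of_real (indicator ((\<Union>i. F i) \<inter> box a b) x)) sequentially"
            using eventually_gt_at_top[of j] by eventually_elim (use j in \<open>auto simp: h split: split_indicator\<close>)
          then show ?thesis by (rule tendsto_eventually)
        next
          case False
          then show ?thesis by (auto simp: h)
        qed
      qed
      show "ennreal ((cmod (complex_of_real (indicator ((\<Union>i. F i) \<inter> box a b) x) - h k x))\<^sup>2) \<le> indicator (box a b) x" for k x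
        unfolding h by (auto split: split_indicator)
      show "(\<integral>\<^sup>+ x. indicator (box a b) x \<partial>lborel) < \<infinity>"
        using emeasure_lborel_box_finite[of a b] by simp
    qed measurable
  qed
qed

lemma approximable_indicator:
  fixes A :: "(real^'n::finite) set"
  assumes A: "A \<in> sets borel" "emeasure lborel A < \<infinity>"
  shows "approximable (\<lambda>x. complex_of_real (indicator A x))"
proof (rule approximable_dominated[where w="\<lambda>x. indicator A x" and
    h="\<lambda>k x. complex_of_real (indicator (A \<inter> box (- (real k *\<^sub>R One)) (real k *\<^sub>R One)) x)"])
  show "AE x in lborel. (\<lambda>k. complex_of_real (indicator (A \<inter> box (- (real k *\<^sub>R One)) (real k *\<^sub>R One)) x)) \<longlonglongrightarrow> complex_of_real (indicator A x)"
  proof (rule AE_I2)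
    fix x :: "real^'n"
    have "eventually (\<lambda>k. x \<in> box (- (real k *\<^sub>R One)) (real k *\<^sub>R One)) sequentially"
    proof -
      obtain j where j: "norm x < real j" using reals_Archimedean2 by blast
      have "x \<in> box (- (real k *\<^sub>R One)) (real k *\<^sub>R One)" if "j \<le> k" for k
      proof -
        have "\<bar>x \<bullet> b\<bar> < real k" if "b \<in> Basis" for b
          using Basis_le_norm[OF that, of x] j \<open>j \<le> k\<close> by linarith
        then show ?thesis by (auto simp: mem_box abs_less_iff inner_sum_left_Basis minus_less_iff)
      qed
      then show ?thesis by (auto simp: eventually_sequentially)
    qed
    then show "(\<lambda>k. complex_of_real (indicator (A \<inter> box (- (real k *\<^sub>R One)) (real k *\<^sub>R One)) x)) \<longlonglongrightarrow> complex_of_real (indicator A x)"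
      by (intro tendsto_eventually) (auto elim!: eventually_mono split: split_indicator)
  qed
  show "ennreal ((cmod (complex_of_real (indicator A x) - complex_of_real (indicator (A \<inter> box (- (real k *\<^sub>R One)) (real k *\<^sub>R One)) x)))\<^sup>2) \<le> indicator A x" for k x
    by (auto split: split_indicator)
qed (use A in \<open>auto intro: approximable_indicator_bounded\<close>)

text \<open>Every square integrable function is an \<open>L\<^sup>2\<close> limit of Schwartz functions, by way of simple
  functions, sets of finite measure, and boxes.\<close>

lemma approximable_sqnorm_finite:
  fixes f :: "real^'n::finite \<Rightarrow> complex"
  assumes f: "f \<in> borel_measurable borel" "sqnorm f < \<infinity>"
  shows "approximable f"
proof -
  have "f \<in> borel_measurable lborel" using f(1) by simp
  from borel_measurable_implies_sequence_metric[OF this, of 0]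
  obtain F where F: "\<And>i. simple_function lborel (F i)" "\<And>x. (\<lambda>i. F i x) \<longlonglongrightarrow> f x" "\<And>i x. cmod (F i x) \<le> 2 * cmod (f x)"
    by (auto simp: dist_norm)
  have Fm [measurable]: "F i \<in> borel_measurable borel" for i
    using borel_measurable_simple_function[OF F(1)] by simp
  have [measurable]: "f \<in> borel_measurable borel" by (rule f(1))
  show ?thesis
  proof (rule approximable_dominated[where w="\<lambda>x. 9 * ennreal ((cmod (f x))\<^sup>2)" and h=F])
    show "approximable (F i)" for i
    proof -
      have Fs: "sqnorm (F i) < \<infinity>"
      proof -
        have "sqnorm (F i) \<le> (\<integral>\<^sup>+ x. 4 * ennreal ((cmod (f x))\<^sup>2) \<partial>lborel)"
          unfolding sqnorm_def
        proof (rule nn_integral_mono)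
          fix x
          have "(cmod (F i x))\<^sup>2 \<le> (2 * cmod (f x))\<^sup>2" by (rule power_mono[OF F(3)]) simp
          then have "ennreal ((cmod (F i x))\<^sup>2) \<le> ennreal (4 * (cmod (f x))\<^sup>2)" by (intro ennreal_leI) simp
          then show "ennreal ((cmod (F i x))\<^sup>2) \<le> 4 * ennreal ((cmod (f x))\<^sup>2)" by (simp add: ennreal_mult')
        qed
        also have "\<dots> = 4 * sqnorm f" unfolding sqnorm_def by (rule nn_integral_cmult) measurable
        finally show ?thesis using f(2) by (auto simp: ennreal_mult_less_top intro: le_less_trans)
      qed
      have fin: "finite (range (F i))" using F(1)[of i] by (simp add: simple_function_def)
      have rep: "F i = (\<lambda>x. \<Sum>c\<in>range (F i). c * complex_of_real (indicator (F i -` {c}) x))"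
      proof (rule ext)
        fix x
        have "F i x = (\<Sum>c\<in>range (F i). indicator (F i -` {c}) x *\<^sub>R c)"
        proof -
          have "x \<in> space lborel" by simp
          from simple_function_indicator_representation_banach[OF F(1)[of i] this]
          show ?thesis unfolding space_lborel space_borel Int_UNIV_right .
        qed
        then show "F i x = (\<Sum>c\<in>range (F i). c * complex_of_real (indicator (F i -` {c}) x))"
          by (simp only: scaleR_conv_of_real mult.commute)
      qed
      have summand: "approximable (\<lambda>x. c * complex_of_real (indicator (F i -` {c}) x))" for c
      proof (cases "c = 0")
        case True then show ?thesis by (simp add: approximable_zero)
      next
        case False
        have m: "F i -` {c} \<in> sets borel" using measurable_sets_borel[OF Fm, of "{c}"] by simp
        have "ennreal ((cmod c)\<^sup>2) * emeasure lborel (F i -` {c}) = (\<integral>\<^sup>+ x. ennreal ((cmod c)\<^sup>2) * indicator (F i -` {c}) x \<partial>lborel)"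
          using m by (simp add: nn_integral_cmult)
        also have "\<dots> \<le> sqnorm (F i)" unfolding sqnorm_def
          by (intro nn_integral_mono) (auto split: split_indicator)
        finally have "ennreal ((cmod c)\<^sup>2) * emeasure lborel (F i -` {c}) < \<infinity>" using Fs by (rule le_less_trans)
        then have "emeasure lborel (F i -` {c}) < \<infinity>" using False by (auto simp: ennreal_mult_less_top)
        from approximable_cmult[OF approximable_indicator[OF m this]] show ?thesis .
      qed
      have "approximable (\<lambda>x. \<Sum>c\<in>X. c * complex_of_real (indicator (F i -` {c}) x))" if "finite X" for X
        using that by induction (simp_all add: approximable_zero approximable_add summand)
      from this[OF fin] rep show ?thesis by simp
    qed
    show "ennreal ((cmod (f x - F i x))\<^sup>2) \<le> 9 * ennreal ((cmod (f x))\<^sup>2)" for i x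
    proof -
      have "cmod (f x - F i x) \<le> 3 * cmod (f x)" using norm_triangle_ineq4[of "f x" "F i x"] F(3)[of i x] by simp
      then have "(cmod (f x - F i x))\<^sup>2 \<le> (3 * cmod (f x))\<^sup>2" by (rule power_mono) simp
      then have "ennreal ((cmod (f x - F i x))\<^sup>2) \<le> ennreal (9 * (cmod (f x))\<^sup>2)" by (intro ennreal_leI) simp
      then show ?thesis by (simp add: ennreal_mult')
    qed
    have "(\<integral>\<^sup>+ x. 9 * ennreal ((cmod (f x))\<^sup>2) \<partial>lborel) = 9 * sqnorm f" unfolding sqnorm_def by (rule nn_integral_cmult) measurable
    then show "(\<integral>\<^sup>+ x. 9 * ennreal ((cmod (f x))\<^sup>2) \<partial>lborel) < \<infinity>" using f(2) by (simp add: ennreal_mult_less_top)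
  qed (use F(2) in auto)
qed

section \<open>Extension by density\<close>

lemma L2norm_eq: "L2norm f = (if sqnorm f = \<infinity> then \<infinity> else ennreal (sqrt (enn2real (sqnorm f))))"
  unfolding L2norm_def sqnorm_def by (simp add: Let_def)

lemma L2_iff: "f \<in> L2 \<longleftrightarrow> f \<in> borel_measurable borel \<and> sqnorm f < \<infinity>"
  unfolding L2_def L2norm_eq by (auto simp: less_top)

lemma L2norm_le_iff:
  assumes "0 \<le> c" shows "L2norm f \<le> ennreal c \<longleftrightarrow> sqnorm f \<le> ennreal (c\<^sup>2)"
proof (cases "sqnorm f")
  case (real r)
  then have "sqrt r \<le> c \<longleftrightarrow> r \<le> c\<^sup>2" using assms real_le_lsqrt real_sqrt_le_iff[of r "c\<^sup>2"] by (simp add: real_sqrt_abs)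
  then show ?thesis using real assms by (simp add: L2norm_eq ennreal_le_iff)
next
  case top then show ?thesis by (simp add: L2norm_eq top_unique)
qed

lemma L2_linear:
  assumes "f \<in> L2" "h \<in> L2" shows "(\<lambda>x. a * f x + b * h x) \<in> L2"
proof -
  have [measurable]: "f \<in> borel_measurable borel" "h \<in> borel_measurable borel" using assms by (auto simp: L2_iff)
  have "sqnorm (\<lambda>x. a * f x + b * h x) \<le> 2 * sqnorm (\<lambda>x. a * f x) + 2 * sqnorm (\<lambda>x. b * h x)"
    by (rule sqnorm_add_le) measurable
  also have "\<dots> < \<infinity>"
    using assms by (simp add: sqnorm_cmult L2_iff ennreal_mult_less_top)
  finally show ?thesis by (simp add: L2_iff)
qed

text \<open>Geometric decay of \<open>L\<^sup>2\<close> norms forces absolute summability almost everywhere, since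
  \<open>\<Sum>\<^sub>k 2\<^sup>k |D\<^sub>k|\<^sup>2\<close> has finite integral.\<close>

lemma AE_summable_geometric:
  fixes D :: "nat \<Rightarrow> real^'n::finite \<Rightarrow> complex"
  assumes [measurable]: "\<And>k. D k \<in> borel_measurable borel"
    and bd: "\<And>k. sqnorm (D k) \<le> ennreal (M * (1 / 4) ^ k)" and M: "0 \<le> M"
  shows "AE x in lborel. summable (\<lambda>k. norm (D k x))"
proof -
  define G where "G = (\<lambda>x. \<Sum>k. ennreal (2 ^ k * (cmod (D k x))\<^sup>2))"
  have "(\<integral>\<^sup>+ x. G x \<partial>lborel) = (\<Sum>k. \<integral>\<^sup>+ x. ennreal (2 ^ k * (cmod (D k x))\<^sup>2) \<partial>lborel)"
    unfolding G_def by (rule nn_integral_suminf) measurable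
  also have "\<dots> = (\<Sum>k. ennreal (2 ^ k) * sqnorm (D k))"
    unfolding sqnorm_def by (simp add: ennreal_mult nn_integral_cmult)
  also have "\<dots> \<le> (\<Sum>k. ennreal (M * (1 / 2) ^ k))"
  proof (rule suminf_le)
    fix k
    have "ennreal (2 ^ k) * sqnorm (D k) \<le> ennreal (2 ^ k) * ennreal (M * (1 / 4) ^ k)"
      by (rule mult_left_mono[OF bd]) simp
    also have "\<dots> = ennreal (2 ^ k * (M * (1 / 4) ^ k))" using M by (simp add: ennreal_mult)
    also have "2 ^ k * (M * (1 / 4) ^ k) = M * (1 / 2) ^ k"
      by (simp add: power_mult_distrib[symmetric] mult.left_commute)
    finally show "ennreal (2 ^ k) * sqnorm (D k) \<le> ennreal (M * (1 / 2) ^ k)" .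
  qed auto
  also have "\<dots> = ennreal (\<Sum>k. M * (1 / 2) ^ k)"
    using M by (intro suminf_ennreal2 summable_mult summable_geometric) auto
  also have "\<dots> < \<infinity>" by simp
  finally have "(\<integral>\<^sup>+ x. G x \<partial>lborel) \<noteq> \<infinity>" by simp
  then have "AE x in lborel. G x \<noteq> \<infinity>"
    by (intro nn_integral_PInf_AE) (auto simp: G_def)
  then show ?thesis
  proof eventually_elim
    fix x assume "G x \<noteq> \<infinity>"
    then obtain g where g: "G x = ennreal g" "0 \<le> g" by (cases "G x") auto
    have "cmod (D k x) \<le> sqrt g * (1 / sqrt 2) ^ k" for k
    proof -
      have "ennreal (2 ^ k * (cmod (D k x))\<^sup>2) \<le> G x"
      proof -
        define a where "a = (\<lambda>k. ennreal (2 ^ k * (cmod (D k x))\<^sup>2))"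
        have "sum a {k} \<le> suminf a" by (rule sum_le_suminf) auto
        then show ?thesis by (simp add: a_def G_def)
      qed
      then have "2 ^ k * (cmod (D k x))\<^sup>2 \<le> g" using g by (simp add: ennreal_le_iff)
      then have "(cmod (D k x))\<^sup>2 \<le> g / 2 ^ k" by (simp add: field_simps)
      also have "\<dots> = (sqrt g * (1 / sqrt 2) ^ k)\<^sup>2"
        using g(2) by (simp add: power_mult_distrib power_divide power_mult[symmetric] mult.commute[of k] power_mult)
      finally show ?thesis by (rule power2_le_imp_le) (use g in simp)
    qed
    then have le: "\<And>k. norm (norm (D k x)) \<le> sqrt g * (1 / sqrt 2) ^ k" by simp
    have "summable (\<lambda>k. sqrt g * (1 / sqrt 2) ^ k)"
      by (intro summable_mult summable_geometric) simp
    then show "summable (\<lambda>k. norm (D k x))" using le by (rule summable_comparison_test'[where N=0]) 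
  qed
qed

text \<open>The sequence is constant for a Schwartz function, so the extension agrees there with the given
  operator everywhere; otherwise a geometric rate is fixed, which turns \<open>L\<^sup>2\<close> limits into limits
  almost everywhere.\<close>

definition approx_seq :: "(real^'n::finite \<Rightarrow> complex) \<Rightarrow> nat \<Rightarrow> real^'n \<Rightarrow> complex" where
  "approx_seq f = (if f \<in> schwartz then (\<lambda>_. f)
     else (SOME s. \<forall>k. s k \<in> schwartz \<and> sqnorm (\<lambda>x. f x - s k x) \<le> ennreal ((1 / 4) ^ k)))"

lemma approx_seq:
  assumes "f \<in> L2"
  shows "approx_seq f k \<in> schwartz" "sqnorm (\<lambda>x. f x - approx_seq f k x) \<le> ennreal ((1 / 4) ^ k)"
proof -
  have "approx_seq f k \<in> schwartz \<and> sqnorm (\<lambda>x. f x - approx_seq f k x) \<le> ennreal ((1 / 4) ^ k)"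
  proof (cases "f \<in> schwartz")
    case True then show ?thesis by (simp add: approx_seq_def sqnorm_def)
  next
    case False
    have "approximable f" using assms by (intro approximable_sqnorm_finite) (auto simp: L2_iff)
    then have "\<exists>s\<in>schwartz. sqnorm (\<lambda>x. f x - s x) < ennreal ((1 / 4) ^ k)" for k :: nat
      unfolding approximable_def by simp
    then have "\<forall>k. \<exists>s. s \<in> schwartz \<and> sqnorm (\<lambda>x. f x - s x) \<le> ennreal ((1 / 4) ^ k)"
      by (meson less_imp_le)
    then have "\<exists>s. \<forall>k. s k \<in> schwartz \<and> sqnorm (\<lambda>x. f x - s k x) \<le> ennreal ((1 / 4) ^ k)"
      by (rule choice)
    from someI_ex[OF this] show ?thesis using False by (simp add: approx_seq_def)
  qed
  then show "approx_seq f k \<in> schwartz" "sqnorm (\<lambda>x. f x - approx_seq f k x) \<le> ennreal ((1 / 4) ^ k)" by auto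
qed

text \<open>An operator that is bilinear and bounded on Schwartz functions; \<open>C\<close> bounds the square of its norm.\<close>

locale schwartz_form =
  fixes T :: "(real^'n::finite \<Rightarrow> complex) \<Rightarrow> (real^'n \<Rightarrow> complex) \<Rightarrow> real^'n \<Rightarrow> complex" and C :: real
  assumes C_nonneg: "0 \<le> C"
    and meas: "f \<in> schwartz \<Longrightarrow> g \<in> schwartz \<Longrightarrow> T f g \<in> borel_measurable borel"
    and bound: "f \<in> schwartz \<Longrightarrow> g \<in> schwartz \<Longrightarrow> sqnorm (T f g) \<le> ennreal C * sqnorm f * sqnorm g"
    and lin1: "f \<in> schwartz \<Longrightarrow> h \<in> schwartz \<Longrightarrow> g \<in> schwartz \<Longrightarrow>
       T (\<lambda>x. a * f x + b * h x) g x = a * T f g x + b * T h g x"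
    and lin2: "f \<in> schwartz \<Longrightarrow> g \<in> schwartz \<Longrightarrow> h \<in> schwartz \<Longrightarrow>
       T f (\<lambda>x. a * g x + b * h x) x = a * T f g x + b * T f h x"
begin

text \<open>Linearity of the extension in the second argument follows from linearity in the first.\<close>

lemma flip: "schwartz_form (\<lambda>g f. T f g) C"
proof
  show "0 \<le> C" by (rule C_nonneg)
next
  fix f g :: "real^'n \<Rightarrow> complex" assume fg: "f \<in> schwartz" "g \<in> schwartz"
  show "T g f \<in> borel_measurable borel" by (rule meas[OF fg(2,1)])
  show "sqnorm (T g f) \<le> ennreal C * sqnorm f * sqnorm g"
    using bound[OF fg(2,1)] by (simp only: mult.assoc mult.commute[of "sqnorm f"])
next
  fix f h g :: "real^'n \<Rightarrow> complex" and a b x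
  assume "f \<in> schwartz" "h \<in> schwartz" "g \<in> schwartz"
  then show "T g (\<lambda>x. a * f x + b * h x) x = a * T g f x + b * T g h x" by (intro lin2)
next
  fix f g h :: "real^'n \<Rightarrow> complex" and a b x
  assume "f \<in> schwartz" "g \<in> schwartz" "h \<in> schwartz"
  then show "T (\<lambda>x. a * g x + b * h x) f x = a * T g f x + b * T h f x" by (intro lin1)
qed

definition extension :: "(real^'n \<Rightarrow> complex) \<Rightarrow> (real^'n \<Rightarrow> complex) \<Rightarrow> real^'n \<Rightarrow> complex" where
  "extension f g x = lim (\<lambda>k. T (approx_seq f k) (approx_seq g k) x)"

text \<open>The value \<open>4\<close> for the unit ball is \<open>2 (1 + 1)\<close>, from \<open>|a + b|\<^sup>2 \<le> 2 |a|\<^sup>2 + 2 |b|\<^sup>2\<close> applied to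
  the function and the error of its approximation.\<close>

lemma approx_bound:
  assumes f: "f \<in> L2"
  obtains F where "0 \<le> F" "\<And>k. sqnorm (approx_seq f k) \<le> ennreal F"
    "\<And>k. sqnorm (\<lambda>x. approx_seq f (Suc k) x - approx_seq f k x) \<le> ennreal (4 * (1 / 4) ^ k)"
    "sqnorm f \<le> 1 \<Longrightarrow> F = 4"
proof -
  have [measurable]: "f \<in> borel_measurable borel" "approx_seq f k \<in> borel_measurable borel" for k
    using f approx_seq(1)[OF f] by (auto simp: L2_iff intro: schwartz_measurable)
  obtain r where r: "sqnorm f = ennreal r" "0 \<le> r" using f by (cases "sqnorm f") (auto simp: L2_iff)
  have p1: "(1 / 4 :: real) ^ k \<le> 1" for k by (rule power_le_one) auto
  have "sqnorm (approx_seq f k) \<le> ennreal (2 * max r 1 + 2)" for k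
  proof -
    have "sqnorm (approx_seq f k) = sqnorm (\<lambda>x. f x + (approx_seq f k x - f x))" by simp
    also have "\<dots> \<le> 2 * sqnorm f + 2 * sqnorm (\<lambda>x. approx_seq f k x - f x)"
      by (rule sqnorm_add_le) measurable
    also have "\<dots> \<le> 2 * ennreal r + 2 * ennreal 1"
      unfolding r(1) sqnorm_minus_commute[of "approx_seq f k"] using p1[of k]
      by (intro add_mono mult_left_mono order_trans[OF approx_seq(2)[OF f]] ennreal_leI) auto
    also have "\<dots> = ennreal (2 * r + 2)" using r(2) by (simp add: ennreal_mult')
    also have "\<dots> \<le> ennreal (2 * max r 1 + 2)" by (intro ennreal_leI) auto
    finally show ?thesis .
  qed
  moreover have "sqnorm (\<lambda>x. approx_seq f (Suc k) x - approx_seq f k x) \<le> ennreal (4 * (1 / 4) ^ k)" for k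
  proof -
    have "sqnorm (\<lambda>x. approx_seq f (Suc k) x - approx_seq f k x) = sqnorm (\<lambda>x. (approx_seq f (Suc k) x - f x) + (f x - approx_seq f k x))" by simp
    also have "\<dots> \<le> 2 * sqnorm (\<lambda>x. approx_seq f (Suc k) x - f x) + 2 * sqnorm (\<lambda>x. f x - approx_seq f k x)"
      by (rule sqnorm_add_le) measurable
    also have "\<dots> \<le> 2 * ennreal ((1 / 4) ^ k) + 2 * ennreal ((1 / 4) ^ k)"
    proof (intro add_mono mult_left_mono)
      have "ennreal ((1 / 4) ^ Suc k) \<le> ennreal ((1 / 4) ^ k)" by (intro ennreal_leI power_decreasing) auto
      then show "sqnorm (\<lambda>x. approx_seq f (Suc k) x - f x) \<le> ennreal ((1 / 4) ^ k)"
        unfolding sqnorm_minus_commute[of "approx_seq f (Suc k)"] by (rule order_trans[OF approx_seq(2)[OF f]])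
    qed (auto intro: approx_seq(2)[OF f])
    also have "\<dots> = ennreal (4 * (1 / 4) ^ k)"
      by (simp add: ennreal_mult' flip: distrib_right)
    finally show ?thesis .
  qed
  moreover have "2 * max r 1 + 2 = 4" if "sqnorm f \<le> 1" using that r by (simp add: ennreal_le_1)
  moreover have "0 \<le> 2 * max r 1 + 2" by simp
  ultimately show ?thesis using that[of "2 * max r 1 + 2"] by blast
qed

lemma diff1: "f \<in> schwartz \<Longrightarrow> h \<in> schwartz \<Longrightarrow> g \<in> schwartz \<Longrightarrow> T (\<lambda>x. f x - h x) g x = T f g x - T h g x"
  using lin1[of f h g 1 "-1" x] by simp

lemma diff2: "f \<in> schwartz \<Longrightarrow> g \<in> schwartz \<Longrightarrow> h \<in> schwartz \<Longrightarrow> T f (\<lambda>x. g x - h x) x = T f g x - T f h x"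
  using lin2[of f g h 1 "-1" x] by simp

lemma schwartz_diff: "f \<in> schwartz \<Longrightarrow> h \<in> schwartz \<Longrightarrow> (\<lambda>x. f x - h x) \<in> schwartz"
  using schwartz_add[OF _ schwartz_cmult[of h "-1"], of f] by simp

lemma AE_convergent:
  assumes f: "f \<in> L2" and g: "g \<in> L2"
  shows "AE x in lborel. convergent (\<lambda>k. T (approx_seq f k) (approx_seq g k) x)"
proof -
  let ?f = "approx_seq f" and ?g = "approx_seq g"
  note fs = approx_seq(1)[OF f] and gs = approx_seq(1)[OF g]
  obtain F where F: "0 \<le> F" "\<And>k. sqnorm (?f k) \<le> ennreal F" "\<And>k. sqnorm (\<lambda>x. ?f (Suc k) x - ?f k x) \<le> ennreal (4 * (1 / 4) ^ k)"
    using approx_bound[OF f] by metis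
  obtain G where G: "0 \<le> G" "\<And>k. sqnorm (?g k) \<le> ennreal G" "\<And>k. sqnorm (\<lambda>x. ?g (Suc k) x - ?g k x) \<le> ennreal (4 * (1 / 4) ^ k)"
    using approx_bound[OF g] by metis
  define D where "D = (\<lambda>k x. T (?f (Suc k)) (?g (Suc k)) x - T (?f k) (?g k) x)"
  have Deq: "D k = (\<lambda>x. T (\<lambda>x. ?f (Suc k) x - ?f k x) (?g (Suc k)) x + T (?f k) (\<lambda>x. ?g (Suc k) x - ?g k x) x)" for k
    unfolding D_def by (simp add: diff1 diff2 fs gs)
  have sd: "(\<lambda>x. ?f (Suc k) x - ?f k x) \<in> schwartz" "(\<lambda>x. ?g (Suc k) x - ?g k x) \<in> schwartz" for k
    by (auto intro: schwartz_diff fs gs)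
  have Dm: "D k \<in> borel_measurable borel" for k
    unfolding D_def using meas[OF fs gs] by measurable
  have "sqnorm (D k) \<le> ennreal ((8 * C * G + 8 * C * F) * (1 / 4) ^ k)" for k
  proof -
    define e :: real where "e = 4 * (1 / 4) ^ k"
    have e: "0 \<le> e" by (simp add: e_def)
    have "sqnorm (D k) \<le> 2 * sqnorm (T (\<lambda>x. ?f (Suc k) x - ?f k x) (?g (Suc k))) + 2 * sqnorm (T (?f k) (\<lambda>x. ?g (Suc k) x - ?g k x))"
      unfolding Deq by (rule sqnorm_add_le) (auto intro!: meas sd fs gs)
    also have "\<dots> \<le> 2 * (ennreal C * ennreal e * ennreal G) + 2 * (ennreal C * ennreal F * ennreal e)"
      unfolding e_def
      by (intro add_mono mult_left_mono order_trans[OF bound[OF sd(1) gs]] order_trans[OF bound[OF fs sd(2)]] mult_mono F G) auto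
    also have "\<dots> = ennreal (2 * (C * e * G) + 2 * (C * F * e))"
      using e F(1) G(1) C_nonneg by (simp add: ennreal_mult' ennreal_mult ennreal_plus)
    also have "2 * (C * e * G) + 2 * (C * F * e) = (8 * C * G + 8 * C * F) * (1 / 4) ^ k"
      by (simp add: e_def algebra_simps)
    finally show ?thesis .
  qed
  from AE_summable_geometric[of D, OF Dm this] have "AE x in lborel. summable (\<lambda>k. norm (D k x))"
    using C_nonneg F(1) G(1) by simp
  then show ?thesis
  proof eventually_elim
    fix x assume "summable (\<lambda>k. norm (D k x))"
    then have "summable (\<lambda>k. D k x)" by (rule summable_norm_cancel)
    then have "convergent (\<lambda>m. \<Sum>k<m. D k x)" by (simp add: summable_iff_convergent)
    moreover have "(\<Sum>k<m. D k x) = T (?f m) (?g m) x - T (?f 0) (?g 0) x" for m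
      unfolding D_def by (rule sum_lessThan_telescope)
    ultimately have "convergent (\<lambda>m. (T (?f m) (?g m) x - T (?f 0) (?g 0) x) + T (?f 0) (?g 0) x)"
      by (intro convergent_add convergent_const) simp
    then show "convergent (\<lambda>k. T (?f k) (?g k) x)" by simp
  qed
qed

lemma extension_measurable:
  assumes f: "f \<in> L2" and g: "g \<in> L2" shows "extension f g \<in> borel_measurable borel"
proof -
  have [measurable]: "T (approx_seq f k) (approx_seq g k) \<in> borel_measurable borel" for k
    by (intro meas approx_seq f g)
  show ?thesis unfolding extension_def[abs_def] by measurable
qed

lemma extension_sqnorm_le:
  assumes f: "f \<in> L2" and g: "g \<in> L2" and M: "\<And>k. sqnorm (T (approx_seq f k) (approx_seq g k)) \<le> M"
  shows "sqnorm (extension f g) \<le> M"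
proof -
  let ?h = "\<lambda>k. T (approx_seq f k) (approx_seq g k)"
  have [measurable]: "?h k \<in> borel_measurable borel" for k by (intro meas approx_seq f g)
  have "sqnorm (extension f g) = (\<integral>\<^sup>+ x. liminf (\<lambda>k. ennreal ((cmod (?h k x))\<^sup>2)) \<partial>lborel)"
    unfolding sqnorm_def
  proof (rule nn_integral_cong_AE, use AE_convergent[OF f g] in eventually_elim)
    fix x assume "convergent (\<lambda>k. ?h k x)"
    then have "(\<lambda>k. ?h k x) \<longlonglongrightarrow> extension f g x" unfolding extension_def by (simp add: convergent_LIMSEQ_iff)
    then have "(\<lambda>k. ennreal ((cmod (?h k x))\<^sup>2)) \<longlonglongrightarrow> ennreal ((cmod (extension f g x))\<^sup>2)"
      by (intro tendsto_ennrealI tendsto_intros)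
    from lim_imp_Liminf[OF _ this] show "ennreal ((cmod (extension f g x))\<^sup>2) = liminf (\<lambda>k. ennreal ((cmod (?h k x))\<^sup>2))" by simp
  qed
  also have "\<dots> \<le> liminf (\<lambda>k. sqnorm (?h k))"
    unfolding sqnorm_def by (rule nn_integral_liminf) measurable
  also have "\<dots> \<le> liminf (\<lambda>k. M)"
    by (intro Liminf_mono always_eventually allI M)
  finally show ?thesis by (simp add: Liminf_const)
qed

lemma extension_L2:
  assumes f: "f \<in> L2" and g: "g \<in> L2" shows "extension f g \<in> L2"
proof -
  obtain F where F: "0 \<le> F" "\<And>k. sqnorm (approx_seq f k) \<le> ennreal F" using approx_bound[OF f] by metis
  obtain G where G: "0 \<le> G" "\<And>k. sqnorm (approx_seq g k) \<le> ennreal G" using approx_bound[OF g] by metis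
  have "sqnorm (T (approx_seq f k) (approx_seq g k)) \<le> ennreal C * ennreal F * ennreal G" for k
    by (intro order_trans[OF bound] mult_mono F G approx_seq f g) auto
  then have "sqnorm (extension f g) \<le> ennreal C * ennreal F * ennreal G" by (rule extension_sqnorm_le[OF f g])
  also have "\<dots> < \<infinity>" by (simp add: ennreal_mult_less_top)
  finally show ?thesis using extension_measurable[OF f g] by (simp add: L2_iff)
qed

lemma extension_unit_bound:
  assumes f: "f \<in> L2" and g: "g \<in> L2" and "sqnorm f \<le> 1" "sqnorm g \<le> 1"
  shows "sqnorm (extension f g) \<le> ennreal (16 * C)"
proof -
  have 4: "sqnorm (approx_seq h k) \<le> ennreal 4" if h: "h \<in> L2" "sqnorm h \<le> 1" for h k
  proof -
    obtain F where F: "\<And>k. sqnorm (approx_seq h k) \<le> ennreal F" "sqnorm h \<le> 1 \<Longrightarrow> F = 4"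
      using approx_bound[OF h(1)] by metis
    show ?thesis using F(1)[of k] F(2)[OF h(2)] by simp
  qed
  have "sqnorm (T (approx_seq f k) (approx_seq g k)) \<le> ennreal C * ennreal 4 * ennreal 4" for k
    by (intro order_trans[OF bound] mult_mono 4 approx_seq assms) auto
  also have "ennreal C * ennreal 4 * ennreal 4 = ennreal (16 * C)"
    using C_nonneg by (simp add: ennreal_mult'[symmetric] del: ennreal_numeral)
  finally show ?thesis by (rule extension_sqnorm_le[OF f g])
qed

lemma extension_schwartz: "f \<in> schwartz \<Longrightarrow> g \<in> schwartz \<Longrightarrow> extension f g = T f g"
  unfolding extension_def[abs_def] approx_seq_def by simp

text \<open>The defect of linearity is the operator applied to the defect of linearity of the approximations,
  whose norm decays geometrically.\<close>

lemma extension_linear: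
  assumes f: "f \<in> L2" and h: "h \<in> L2" and g: "g \<in> L2"
  shows "AE x in lborel. extension (\<lambda>x. a * f x + b * h x) g x = a * extension f g x + b * extension h g x"
proof -
  define u where "u = (\<lambda>x. a * f x + b * h x)"
  have u: "u \<in> L2" unfolding u_def by (rule L2_linear[OF f h])
  let ?f = "approx_seq f" and ?g = "approx_seq g" and ?h = "approx_seq h" and ?u = "approx_seq u"
  note fs = approx_seq(1)[OF f] and gs = approx_seq(1)[OF g] and hs = approx_seq(1)[OF h] and us = approx_seq(1)[OF u]
  have [measurable]: "f \<in> borel_measurable borel" "h \<in> borel_measurable borel" "u \<in> borel_measurable borel"
    using f h u by (auto simp: L2_iff)
  have [measurable]: "?f k \<in> borel_measurable borel" "?h k \<in> borel_measurable borel" "?u k \<in> borel_measurable borel" for k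
    by (auto intro: schwartz_measurable fs hs us)
  obtain G where G: "0 \<le> G" "\<And>k. sqnorm (?g k) \<le> ennreal G" using approx_bound[OF g] by metis
  define d where "d = (\<lambda>k x. ?u k x - (a * ?f k x + b * ?h k x))"
  have lincomb: "(\<lambda>x. a * ?f k x + b * ?h k x) \<in> schwartz" for k
    by (intro schwartz_add schwartz_cmult fs hs)
  have ds: "d k \<in> schwartz" for k unfolding d_def by (intro schwartz_diff us lincomb)
  define N where "N = 2 + 4 * (cmod a)\<^sup>2 + 4 * (cmod b)\<^sup>2"
  have N: "0 \<le> N" by (simp add: N_def)
  have dn: "sqnorm (d k) \<le> ennreal (N * (1 / 4) ^ k)" for k
  proof -
    define e :: real where "e = (1 / 4) ^ k"
    have e: "0 \<le> e" by (simp add: e_def)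
    have "sqnorm (d k) = sqnorm (\<lambda>x. (?u k x - u x) + (a * (f x - ?f k x) + b * (h x - ?h k x)))"
      by (simp add: d_def u_def algebra_simps)
    also have "\<dots> \<le> 2 * sqnorm (\<lambda>x. ?u k x - u x) + 2 * sqnorm (\<lambda>x. a * (f x - ?f k x) + b * (h x - ?h k x))"
      by (rule sqnorm_add_le) measurable
    also have "\<dots> \<le> 2 * sqnorm (\<lambda>x. ?u k x - u x) + 2 * (2 * sqnorm (\<lambda>x. a * (f x - ?f k x)) + 2 * sqnorm (\<lambda>x. b * (h x - ?h k x)))"
      by (intro add_left_mono mult_left_mono sqnorm_add_le) auto
    also have "\<dots> = 2 * sqnorm (\<lambda>x. u x - ?u k x) + 2 * (2 * (ennreal ((cmod a)\<^sup>2) * sqnorm (\<lambda>x. f x - ?f k x)) + 2 * (ennreal ((cmod b)\<^sup>2) * sqnorm (\<lambda>x. h x - ?h k x)))"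
      by (simp add: sqnorm_cmult sqnorm_minus_commute[of "?u k"])
    also have "\<dots> \<le> 2 * ennreal e + 2 * (2 * (ennreal ((cmod a)\<^sup>2) * ennreal e) + 2 * (ennreal ((cmod b)\<^sup>2) * ennreal e))"
      unfolding e_def by (intro add_mono mult_left_mono approx_seq(2) f h u) auto
    also have "\<dots> = ennreal (2 * e + 2 * (2 * ((cmod a)\<^sup>2 * e) + 2 * ((cmod b)\<^sup>2 * e)))"
      using e by (simp add: ennreal_mult' ennreal_plus)
    also have "2 * e + 2 * (2 * ((cmod a)\<^sup>2 * e) + 2 * ((cmod b)\<^sup>2 * e)) = N * (1 / 4) ^ k"
      unfolding N_def e_def by (simp add: algebra_simps)
    finally show ?thesis .
  qed
  have Teq: "T (d k) (?g k) x = T (?u k) (?g k) x - (a * T (?f k) (?g k) x + b * T (?h k) (?g k) x)" for k x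
    unfolding d_def using diff1[OF us lincomb gs, of k k k x] lin1[OF fs hs gs] by simp
  have bd: "sqnorm (T (d k) (?g k)) \<le> ennreal ((C * N * G) * (1 / 4) ^ k)" for k
  proof -
    have "sqnorm (T (d k) (?g k)) \<le> ennreal C * ennreal (N * (1 / 4) ^ k) * ennreal G"
      by (intro order_trans[OF bound[OF ds gs]] mult_mono dn G) auto
    also have "\<dots> = ennreal (C * (N * (1 / 4) ^ k) * G)"
      using C_nonneg N G(1) by (simp add: ennreal_mult)
    also have "C * (N * (1 / 4) ^ k) * G = (C * N * G) * (1 / 4) ^ k" by simp
    finally show ?thesis .
  qed
  have Tm: "T (d k) (?g k) \<in> borel_measurable borel" for k by (rule meas[OF ds gs])
  have CNG: "0 \<le> C * N * G" using C_nonneg N G(1) by simp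
  from AE_summable_geometric[of "\<lambda>k. T (d k) (?g k)", OF Tm bd CNG] AE_convergent[OF f g] AE_convergent[OF h g] AE_convergent[OF u g]
  show ?thesis
  proof eventually_elim
    fix x
    assume s: "summable (\<lambda>k. norm (T (d k) (?g k) x))"
      and cf: "convergent (\<lambda>k. T (?f k) (?g k) x)" and ch: "convergent (\<lambda>k. T (?h k) (?g k) x)"
      and cu: "convergent (\<lambda>k. T (?u k) (?g k) x)"
    have "(\<lambda>k. T (d k) (?g k) x) \<longlonglongrightarrow> 0"
      using summable_LIMSEQ_zero[OF summable_norm_cancel[OF s]] .
    moreover have "(\<lambda>k. T (d k) (?g k) x) \<longlonglongrightarrow> extension u g x - (a * extension f g x + b * extension h g x)"
      unfolding Teq extension_def using cf ch cu by (intro tendsto_intros) (simp_all add: convergent_LIMSEQ_iff)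
    ultimately have "extension u g x - (a * extension f g x + b * extension h g x) = 0" by (rule LIMSEQ_unique[symmetric])
    then show "extension (\<lambda>x. a * f x + b * h x) g x = a * extension f g x + b * extension h g x" by (simp add: u_def)
  qed
qed

lemma extension_bilinear: "L2_bilinear extension"
proof -
  interpret fl: schwartz_form "\<lambda>g f. T f g" C by (rule flip)
  have e: "fl.extension g f = extension f g" for f g unfolding fl.extension_def[abs_def] extension_def[abs_def] by simp
  show ?thesis
    unfolding L2_bilinear_def using extension_L2 extension_linear fl.extension_linear[unfolded e] by blast
qed

end

section \<open>The boundedness theorem\<close>

text \<open>Both layers of the constant of the symbol, given by multi-indices, are rewritten as derivatives of
  the symbol on the product space along words: the position derivative inside and the derivative in
  \<open>\<xi>\<close> of \<open>\<sigma>(y, \<xi> - \<eta>, \<eta>)\<close> outside.\<close>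

lemma symbol_slice_fibre_bound:
  fixes \<sigma> :: "'n::finite bilinear_symbol"
  assumes sm: "smooth (\<lambda>(x, \<xi>, \<eta>). \<sigma> x \<xi> \<eta>)" and fin: "symbol_const \<sigma> < \<infinity>"
    and v: "length v \<le> CARD('n) div 2 + 1" and w: "length w \<le> 2 * (2 * CARD('n) + 1)"
  shows "fibre_bound (word_deriv (xi_dirs w) (sym_slice (\<lambda>(x, \<xi>, \<eta>). \<sigma> x \<xi> \<eta>) v y)) (ennreal ((enn2real (symbol_const \<sigma>))\<^sup>2))"
proof -
  define S where "S = (\<lambda>(x, \<xi>, \<eta>). \<sigma> x \<xi> \<eta>)"
  have S: "smooth S" unfolding S_def by (rule sm)
  have eq: "word_deriv (xi_dirs w) (sym_slice S v y) (\<xi> - \<eta>, \<eta>)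
     = mderiv (count_list w) (\<lambda>\<xi>'. mderiv (count_list v) (\<lambda>y'. \<sigma> y' (\<xi>' - \<eta>) \<eta>) y) \<xi>" for \<xi> \<eta>
  proof -
    have L1: "linear (\<lambda>y'::real^'n. (y', 0::(real^'n) \<times> (real^'n)))" and L2: "linear (\<lambda>\<xi>'::real^'n. (\<xi>', 0::real^'n))"
      by (auto simp: linear_iff)
    have B1: "(b, 0::(real^'n) \<times> (real^'n)) \<in> Basis" and B2: "(b, 0::real^'n) \<in> Basis" if "b \<in> Basis" for b :: "real^'n"
      using that by (auto simp: Basis_prod_def)
    have inner: "mderiv (count_list v) (\<lambda>y'. \<sigma> y' (\<xi>' - \<eta>) \<eta>) y = sym_slice S v y ((- \<eta>, \<eta>) + (\<xi>', 0))" for \<xi>'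
    proof -
      have f: "(\<lambda>y'. \<sigma> y' (\<xi>' - \<eta>) \<eta>) = (\<lambda>y'. S ((0, \<xi>' - \<eta>, \<eta>) + (y', 0)))" by (simp add: S_def)
      have "smooth (\<lambda>y'. S ((0, \<xi>' - \<eta>, \<eta>) + (y', 0)))" by (rule smooth_affine[OF S L1 B1])
      then have "mderiv (count_list v) (\<lambda>y'. \<sigma> y' (\<xi>' - \<eta>) \<eta>) = word_deriv (coord_dirs v) (\<lambda>y'. S ((0, \<xi>' - \<eta>, \<eta>) + (y', 0)))"
        unfolding f by (rule word_deriv_eq_mderiv[symmetric])
      also have "\<dots> = (\<lambda>y'. word_deriv (y_dirs v) S ((0, \<xi>' - \<eta>, \<eta>) + (y', 0)))"
        unfolding word_deriv_affine[OF L1] by (simp add: o_def)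
      finally show ?thesis by (simp add: sym_slice_def)
    qed
    have "mderiv (count_list w) (\<lambda>\<xi>'. sym_slice S v y ((- \<eta>, \<eta>) + (\<xi>', 0)))
       = word_deriv (coord_dirs w) (\<lambda>\<xi>'. sym_slice S v y ((- \<eta>, \<eta>) + (\<xi>', 0)))"
      by (rule word_deriv_eq_mderiv[symmetric]) (rule smooth_affine[OF smooth_sym_slice[OF S] L2 B2])
    also have "\<dots> = (\<lambda>\<xi>'. word_deriv (xi_dirs w) (sym_slice S v y) ((- \<eta>, \<eta>) + (\<xi>', 0)))"
      unfolding word_deriv_affine[OF L2] by (simp add: o_def)
    finally show ?thesis unfolding inner by simp
  qed
  have c: "symbol_const \<sigma> = ennreal (enn2real (symbol_const \<sigma>))" using fin by (simp add: less_top)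
  have "(\<integral>\<^sup>+ \<eta>. ennreal ((cmod (word_deriv (xi_dirs w) (sym_slice S v y) (\<xi> - \<eta>, \<eta>)))\<^sup>2) \<partial>lborel)
      \<le> ennreal ((enn2real (symbol_const \<sigma>))\<^sup>2)" for \<xi>
  proof -
    have "L2norm (\<lambda>\<eta>. mderiv (count_list w) (\<lambda>\<xi>'. mderiv (count_list v) (\<lambda>y'. \<sigma> y' (\<xi>' - \<eta>) \<eta>) y) \<xi>) \<le> symbol_const \<sigma>"
      unfolding symbol_const_def
      by (rule SUP_upper2[where i="(count_list w, count_list v)"])
         (use v w in \<open>auto simp: coord_word_exists(2) intro!: SUP_upper2[where i="(\<xi>, y)"]\<close>)
    then have "sqnorm (\<lambda>\<eta>. word_deriv (xi_dirs w) (sym_slice S v y) (\<xi> - \<eta>, \<eta>)) \<le> ennreal ((enn2real (symbol_const \<sigma>))\<^sup>2)"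
      unfolding eq[symmetric] by (subst (asm) c) (simp add: L2norm_le_iff)
    then show ?thesis by (simp add: sqnorm_def)
  qed
  moreover have "continuous_on UNIV (word_deriv (xi_dirs w) (sym_slice S v y))"
    by (intro smooth_continuous smooth_word_deriv smooth_sym_slice S xi_dirs_Basis)
  ultimately show ?thesis unfolding fibre_bound_def S_def by blast
qed

theorem theorem3:
  shows "\<exists>C::real. C > 0 \<and>
    (\<forall>\<sigma> :: 'n::finite bilinear_symbol.
       smooth (\<lambda>(x, \<xi>, \<eta>). \<sigma> x \<xi> \<eta>) \<longrightarrow> symbol_const \<sigma> < \<infinity> \<longrightarrow>
         (\<forall>f\<in>schwartz. \<forall>g\<in>schwartz. \<forall>x. integrable lborel (T_integrand \<sigma> f g x)) \<and>
         (\<exists>B :: 'n bilinear_operator.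
            L2_bilinear B \<and>
            (\<forall>f\<in>schwartz. \<forall>g\<in>schwartz. AE x in lborel. B f g x = T_op \<sigma> f g x) \<and>
            L2_opnorm B \<le> ennreal C * symbol_const \<sigma>))"
proof -
  define \<kappa> where "\<kappa> = enn2real (op_const TYPE('n))"
  have \<kappa>: "op_const TYPE('n) = ennreal \<kappa>" "0 \<le> \<kappa>"
    unfolding \<kappa>_def using op_const_finite[where 'n='n] by (simp_all add: less_top)
  \<comment> \<open>the factor 16 in the bound for squared norms on the unit ball gives 4 here; adding one makes \<open>C\<close> positive\<close>
  define C where "C = 4 * sqrt \<kappa> + 1"
  have C: "0 < C" unfolding C_def using \<kappa>(2) by (simp add: add_nonneg_pos)
  have main: "(\<forall>f\<in>schwartz. \<forall>g\<in>schwartz. \<forall>x. integrable lborel (T_integrand \<sigma> f g x)) \<and>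
         (\<exists>B :: 'n bilinear_operator. L2_bilinear B \<and>
            (\<forall>f\<in>schwartz. \<forall>g\<in>schwartz. AE x in lborel. B f g x = T_op \<sigma> f g x) \<and>
            L2_opnorm B \<le> ennreal C * symbol_const \<sigma>)"
    if sm: "smooth (\<lambda>(x, \<xi>, \<eta>). \<sigma> x \<xi> \<eta>)" and fin: "symbol_const \<sigma> < \<infinity>" for \<sigma> :: "'n bilinear_symbol"
  proof -
    define S where "S = (\<lambda>(x, \<xi>, \<eta>). \<sigma> x \<xi> \<eta>)"
    define c where "c = enn2real (symbol_const \<sigma>)"
    have c: "symbol_const \<sigma> = ennreal c" "0 \<le> c" unfolding c_def using fin by (simp_all add: less_top)
    interpret bounded_symbol S "ennreal (c\<^sup>2)"
    proof
      fix v w :: "'n list" and y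
      assume "length v \<le> CARD('n) div 2 + 1" "length w \<le> CARD('n)"
      then show "fibre_bound (word_deriv (xi_dirs w) (sym_slice S v y)) (ennreal (c\<^sup>2))"
        unfolding S_def c_def by (intro symbol_slice_fibre_bound sm fin) auto
    qed (simp_all add: S_def sm)
    have slice: "sym_slice S [] x = (\<lambda>p. S (x, p))" for x by (auto simp: sym_slice_def)
    have fb: "fibre_bound (\<lambda>p. S (x, p)) (ennreal (c\<^sup>2))" for x
      using fibre0[of "[]" x] by (simp add: slice)
    have integrand: "T_integrand \<sigma> f g x = (\<lambda>p. S (x, p) * (fourier f (fst p) * fourier g (snd p) * cis (x \<bullet> (fst p + snd p))))" for f g x
      unfolding T_integrand_def S_def by (auto simp: mult.assoc)
    have op: "T_op \<sigma> f g x = mult_op (\<lambda>p. S (x, p)) f g x" for f g x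
      unfolding T_op_def mult_op_def integrand ..
    have int: "integrable lborel (T_integrand \<sigma> f g x)" if "f \<in> schwartz" "g \<in> schwartz" for f g x
      unfolding integrand by (rule mult_op_integrable[OF fb _ that]) simp
    interpret schwartz_form "T_op \<sigma>" "\<kappa> * c\<^sup>2"
    proof
      show "0 \<le> \<kappa> * c\<^sup>2" using \<kappa>(2) by simp
    next
      fix f g :: "real^'n \<Rightarrow> complex" assume f: "f \<in> schwartz" and g: "g \<in> schwartz"
      have "(\<lambda>x. mult_op (sym_slice S [] (fst (x, x))) f g (snd (x, x))) \<in> borel_measurable borel"
        by (rule measurable_comp_continuous[OF mult_op_sym_slice_measurable[OF f g, of "[]"], of "\<lambda>x. (x, x)"]) (intro continuous_intros)
      then show "T_op \<sigma> f g \<in> borel_measurable borel" unfolding op[abs_def] by (simp add: slice)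
      have "sqnorm (T_op \<sigma> f g) = sqnorm (\<lambda>x. mult_op (\<lambda>p. S (x, p)) f g x)" unfolding sqnorm_def op ..
      also have "\<dots> \<le> op_const TYPE('n) * ennreal (c\<^sup>2) * sqnorm f * sqnorm g"
        by (rule sqnorm_frozen_diagonal_le[OF f g])
      also have "op_const TYPE('n) * ennreal (c\<^sup>2) = ennreal (\<kappa> * c\<^sup>2)" using \<kappa> by (simp add: ennreal_mult)
      finally show "sqnorm (T_op \<sigma> f g) \<le> ennreal (\<kappa> * c\<^sup>2) * sqnorm f * sqnorm g" .
    next
      fix f h g :: "real^'n \<Rightarrow> complex" and a b x
      assume f: "f \<in> schwartz" and h: "h \<in> schwartz" and g: "g \<in> schwartz"
      have "fourier (\<lambda>x. a * f x + b * h x) \<xi> = a * fourier f \<xi> + b * fourier h \<xi>" for \<xi>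
        using f h by (subst fourier_add) (auto simp: fourier_cmult intro: schwartz_integrable)
      then have "T_integrand \<sigma> (\<lambda>x. a * f x + b * h x) g x = (\<lambda>p. a * T_integrand \<sigma> f g x p + b * T_integrand \<sigma> h g x p)"
        unfolding integrand by (auto simp: algebra_simps)
      then show "T_op \<sigma> (\<lambda>x. a * f x + b * h x) g x = a * T_op \<sigma> f g x + b * T_op \<sigma> h g x"
        unfolding T_op_def using int[OF f g] int[OF h g] by simp
    next
      fix f g h :: "real^'n \<Rightarrow> complex" and a b x
      assume f: "f \<in> schwartz" and g: "g \<in> schwartz" and h: "h \<in> schwartz"
      have "fourier (\<lambda>x. a * g x + b * h x) \<xi> = a * fourier g \<xi> + b * fourier h \<xi>" for \<xi>
        using g h by (subst fourier_add) (auto simp: fourier_cmult intro: schwartz_integrable)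
      then have "T_integrand \<sigma> f (\<lambda>x. a * g x + b * h x) x = (\<lambda>p. a * T_integrand \<sigma> f g x p + b * T_integrand \<sigma> f h x p)"
        unfolding integrand by (auto simp: algebra_simps)
      then show "T_op \<sigma> f (\<lambda>x. a * g x + b * h x) x = a * T_op \<sigma> f g x + b * T_op \<sigma> f h x"
        unfolding T_op_def using int[OF f g] int[OF f h] by simp
    qed
    have "L2_opnorm extension \<le> ennreal (C * c)"
      unfolding L2_opnorm_def
    proof (rule SUP_least, clarify)
      fix f g :: "real^'n \<Rightarrow> complex"
      assume fg: "f \<in> L2" "g \<in> L2" "L2norm f \<le> 1" "L2norm g \<le> 1"
      have "sqnorm f \<le> 1" "sqnorm g \<le> 1"
        using fg(3,4) L2norm_le_iff[of 1 f] L2norm_le_iff[of 1 g] by simp_all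
      then have "sqnorm (extension f g) \<le> ennreal (16 * (\<kappa> * c\<^sup>2))" by (rule extension_unit_bound[OF fg(1,2)])
      also have "\<dots> \<le> ennreal ((C * c)\<^sup>2)"
      proof (rule ennreal_leI)
        have "(4 * sqrt \<kappa>)\<^sup>2 \<le> C\<^sup>2" unfolding C_def using \<kappa>(2) by (intro power_mono) auto
        then have "16 * \<kappa> \<le> C\<^sup>2" using \<kappa>(2) by (simp add: power_mult_distrib)
        then have "16 * \<kappa> * c\<^sup>2 \<le> C\<^sup>2 * c\<^sup>2" by (rule mult_right_mono) simp
        then show "16 * (\<kappa> * c\<^sup>2) \<le> (C * c)\<^sup>2" by (simp add: power_mult_distrib)
      qed
      finally show "L2norm (extension f g) \<le> ennreal (C * c)"
        using C c(2) by (subst L2norm_le_iff) auto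
    qed
    also have "ennreal (C * c) = ennreal C * symbol_const \<sigma>" using C c by (simp add: ennreal_mult)
    finally have "L2_opnorm extension \<le> ennreal C * symbol_const \<sigma>" .
    then show ?thesis
      using int extension_bilinear extension_schwartz by (intro conjI ballI allI exI[of _ extension]) auto
  qed
  show ?thesis using C main by blast
qed

end
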